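(* Let $K$ be a field, let $A=K[a_1,\dots,a_m]$, let $R=P/I$ be a positive $A$-algebra of dimension $d$, let $\Theta:\operatorname{Spec}(R)\to\mathbb{A}^m_K$ be its canonical morphism, let $G=(g_1,\dots,g_s)$ be a tuple of $W$-homogeneous polynomials which generate $I$, and let $\mathcal{L}_A(G)$ be the $A$-linear coefficient matrix of $G$. (a) For every $\Gamma\in K^m$, we have $$\operatorname{rk}(\mathcal{L}_K(G_\Gamma))=n-m-\dim_K(\operatorname{Cot}_{\langle X\rangle/I_\Gamma}(K[X]/I_\Gamma))\le n-m-d_{F_\Gamma}.$$ (b) $\operatorname{Sing}_v(\Theta)=\{\Gamma\in K^m\mid\operatorname{rk}(\mathcal{L}_K(G_\Gamma))<n-m-d_{F_\Gamma}\}$. (c) $\operatorname{Sing}_0(\Theta)\setminus\operatorname{Sing}_v(\Theta)=\{\Gamma\in K^m\mid\operatorname{rk}(\mathcal{L}_K(G_\Gamma))=n-m-d_{F_\Gamma}<n-d_{\Gamma_0}\}$.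
   Context: $A=K[a_1,\dots,a_m]$ is a trivially graded polynomial ring over the field $K$, and $P=A[x_1,\dots,x_k]$ is graded by $\deg(a_i)=0$ and $\deg(x_j)=w_j$, with positive integers $w_j$; $W=(w_1,\dots,w_k)$, $n=m+k$, $X=\{x_1,\dots,x_k\}$, $K[X]=K[x_1,\dots,x_k]$. A positive $A$-algebra is a ring $R=P/I$ where $I$ is a $W$-homogeneous ideal of $P$ with $I\cap A=\{0\}$ (hence $I\subseteq\langle x_1,\dots,x_k\rangle$). The canonical morphism $\Theta:\operatorname{Spec}(R)\to\mathbb{A}^m_K=\operatorname{Spec}(A)$ is induced by $A\to R$. For $\Gamma=(\gamma_1,\dots,\gamma_m)\in K^m$: $R_{\Gamma_0}$ is the localization of $R$ at the maximal ideal $\langle a_1-\gamma_1,\dots,a_m-\gamma_m,x_1,\dots,x_k\rangle/I$ of the zero point $\Gamma_0=(\gamma_1,\dots,\gamma_m,0,\dots,0)$, and $d_{\Gamma_0}$ is its Krull dimension; $I_\Gamma\subseteq K[X]$ is the image of $I$ under $P\to K[X]$, $a_i\mapsto\gamma_i$, $x_j\mapsto x_j$; $K[X]/I_\Gamma$ is the coordinate ring of the fiber $F_\Gamma=\Theta^{-1}(\Gamma)$; $R_{F_\Gamma}$ is the localization of $K[X]/I_\Gamma$ at $\langle X\rangle/I_\Gamma$ and $d_{F_\Gamma}$ is its Krull dimension; $\operatorname{Cot}_{\langle X\rangle/I_\Gamma}(K[X]/I_\Gamma)=\mathfrak{n}/\mathfrak{n}^2$ with $\mathfrak{n}=\langle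 X\rangle/I_\Gamma$. For a local $K$-algebra $(S,\mathfrak{m})$ with $S/\mathfrak{m}=K$, $\operatorname{ecod}(S)=\dim_K(\mathfrak{m}/\mathfrak{m}^2)-\dim(S)$. The sets are $\operatorname{Sing}_0(\Theta)=\{\Gamma\in K^m\mid\operatorname{ecod}(R_{\Gamma_0})>0\}$ and $\operatorname{Sing}_v(\Theta)=\{\Gamma\in K^m\mid\operatorname{ecod}(R_{F_\Gamma})>0\}$. For $f\in P$ written as $f=f_0+f_1x_1+\cdots+f_kx_k+g$ with $f_0,\dots,f_k\in A$ and $g\in\langle X\rangle^2$, the $A$-linear part is $\operatorname{Lin}_A(f)=f_1x_1+\cdots+f_kx_k$. Writing $\operatorname{Lin}_A(g_i)=g_{i1}x_1+\cdots+g_{ik}x_k$ with $g_{ij}\in A$, the $A$-linear coefficient matrix of $G$ is $\mathcal{L}_A(G)=(g_{ij})\in\operatorname{Mat}_{s,k}(A)$, and $\mathcal{L}_K(G_\Gamma)=(g_{ij}(\gamma_1,\dots,\gamma_m))\in\operatorname{Mat}_{s,k}(K)$. *)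

theory Defs
  imports
    "HOL-Library.Poly_Mapping"
    "HOL-Library.Extended_Real"
    "HOL-Algebra.QuotRing"
    "HOL-Algebra.Ideal_Product"
    "Jordan_Normal_Form.DL_Rank"
begin

section \<open>Polynomial rings\<close>

text \<open>
  Polynomials are finitely supported maps from monomials to coefficients. The indeterminates
  \<open>a\<^sub>1, \<dots>, a\<^sub>m\<close> and \<open>x\<^sub>1, \<dots>, x\<^sub>k\<close> are \<open>AVar 0, \<dots>, AVar (m - 1)\<close> and
  \<open>XVar 0, \<dots>, XVar (k - 1)\<close>; the rings \<open>A\<close>, \<open>K[X]\<close> and \<open>P\<close> are the
  subrings of polynomials in which only the appropriate indeterminates occur.
\<close>

datatype pvar = AVar nat | XVar nat

type_synonym monomial = "pvar \<Rightarrow>\<^sub>0 nat"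
type_synonym 'a mpoly = "monomial \<Rightarrow>\<^sub>0 'a"

definition Const :: "'a::zero \<Rightarrow> 'a mpoly" where
  "Const c = Poly_Mapping.single 0 c"

definition Var :: "pvar \<Rightarrow> 'a::zero_neq_one mpoly" where
  "Var v = Poly_Mapping.single (Poly_Mapping.single v 1) 1"

definition mpoly_vars :: "'a::zero mpoly \<Rightarrow> pvar set" where
  "mpoly_vars p = (\<Union>t \<in> Poly_Mapping.keys p. Poly_Mapping.keys t)"

definition mpoly_ring :: "pvar set \<Rightarrow> 'a::comm_ring_1 mpoly ring" where
  "mpoly_ring V =
    \<lparr>carrier = {p. mpoly_vars p \<subseteq> V}, mult = (*), one = 1, zero = 0, add = (+)\<rparr>"

definition A_vars :: "nat \<Rightarrow> pvar set" where
  "A_vars m = AVar ` {..<m}"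

definition X_vars :: "nat \<Rightarrow> pvar set" where
  "X_vars k = XVar ` {..<k}"

definition A_ring :: "nat \<Rightarrow> 'a::comm_ring_1 mpoly ring" where
  "A_ring m = mpoly_ring (A_vars m)"

definition KX_ring :: "nat \<Rightarrow> 'a::comm_ring_1 mpoly ring" where
  "KX_ring k = mpoly_ring (X_vars k)"

definition P_ring :: "nat \<Rightarrow> nat \<Rightarrow> 'a::comm_ring_1 mpoly ring" where
  "P_ring m k = mpoly_ring (A_vars m \<union> X_vars k)"

text \<open>The value of a polynomial under \<open>v \<mapsto> \<sigma> v\<close>, where \<open>h\<close> is applied to the coefficients.\<close>

definition mpoly_eval :: "('a::zero \<Rightarrow> 'b::comm_semiring_1) \<Rightarrow> (pvar \<Rightarrow> 'b) \<Rightarrow> 'a mpoly \<Rightarrow> 'b" where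
  "mpoly_eval h \<sigma> p =
    (\<Sum>t \<in> Poly_Mapping.keys p.
      h (Poly_Mapping.lookup p t) *
        (\<Prod>v \<in> Poly_Mapping.keys t. \<sigma> v ^ Poly_Mapping.lookup t v))"


section \<open>The grading and positive algebras\<close>

primrec var_weight :: "(nat \<Rightarrow> nat) \<Rightarrow> pvar \<Rightarrow> nat" where
  "var_weight w (AVar i) = 0"
| "var_weight w (XVar j) = w j"

definition W_degree :: "(nat \<Rightarrow> nat) \<Rightarrow> monomial \<Rightarrow> nat" where
  "W_degree w t = (\<Sum>v \<in> Poly_Mapping.keys t. var_weight w v * Poly_Mapping.lookup t v)"

definition W_homogeneous :: "(nat \<Rightarrow> nat) \<Rightarrow> 'a::zero mpoly \<Rightarrow> bool" where
  "W_homogeneous w p \<longleftrightarrow> (\<exists>e. \<forall>t \<in> Poly_Mapping.keys p. W_degree w t = e)"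

definition W_component :: "(nat \<Rightarrow> nat) \<Rightarrow> nat \<Rightarrow> 'a::comm_monoid_add mpoly \<Rightarrow> 'a mpoly" where
  "W_component w e p =
    (\<Sum>t | t \<in> Poly_Mapping.keys p \<and> W_degree w t = e.
      Poly_Mapping.single t (Poly_Mapping.lookup p t))"

definition W_homogeneous_ideal ::
    "nat \<Rightarrow> nat \<Rightarrow> (nat \<Rightarrow> nat) \<Rightarrow> 'a::comm_ring_1 mpoly set \<Rightarrow> bool" where
  "W_homogeneous_ideal m k w I \<longleftrightarrow>
    ideal I (P_ring m k) \<and> (\<forall>f \<in> I. \<forall>e. W_component w e f \<in> I)"

text \<open>The quotient \<open>P_ring m k Quot I\<close> is a positive \<open>A\<close>-algebra with respect to
  the weights \<open>w 0, \<dots>, w (k - 1)\<close>.\<close>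

definition positive_algebra ::
    "nat \<Rightarrow> nat \<Rightarrow> (nat \<Rightarrow> nat) \<Rightarrow> 'a::comm_ring_1 mpoly set \<Rightarrow> bool" where
  "positive_algebra m k w I \<longleftrightarrow>
    (\<forall>j<k. 0 < w j) \<and> W_homogeneous_ideal m k w I \<and> I \<inter> carrier (A_ring m) = {0}"


section \<open>Krull dimension, localization, cotangent space and embedding codimension\<close>

text \<open>Being a supremum in the extended reals, the dimension of the zero ring is \<open>-\<infinity>\<close>.\<close>

definition krull_dim :: "('a, 'b) ring_scheme \<Rightarrow> ereal" where
  "krull_dim R = Sup {ereal (real l) | l. \<exists>p :: nat \<Rightarrow> 'a set.
    (\<forall>i\<le>l. primeideal (p i) R) \<and> (\<forall>i<l. p i \<subset> p (Suc i))}"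

text \<open>The fraction \<open>a / s\<close>, as an equivalence class of pairs.\<close>

definition loc_frac :: "('a, 'b) ring_scheme \<Rightarrow> 'a set \<Rightarrow> 'a \<Rightarrow> 'a \<Rightarrow> ('a \<times> 'a) set" where
  "loc_frac R S a s = {(b, t). b \<in> carrier R \<and> t \<in> S \<and>
    (\<exists>u \<in> S. u \<otimes>\<^bsub>R\<^esub> (t \<otimes>\<^bsub>R\<^esub> a) = u \<otimes>\<^bsub>R\<^esub> (s \<otimes>\<^bsub>R\<^esub> b))}"

definition localization :: "('a, 'b) ring_scheme \<Rightarrow> 'a set \<Rightarrow> ('a \<times> 'a) set ring" where
  "localization R S =
    \<lparr>carrier = {loc_frac R S a s | a s. a \<in> carrier R \<and> s \<in> S},
     mult = (\<lambda>X Y. \<Union>(a, s) \<in> X. \<Union>(b, t) \<in> Y. loc_frac R S (a \<otimes>\<^bsub>R\<^esub> b) (s \<otimes>\<^bsub>R\<^esub> t)),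
     one = loc_frac R S \<one>\<^bsub>R\<^esub> \<one>\<^bsub>R\<^esub>,
     zero = loc_frac R S \<zero>\<^bsub>R\<^esub> \<one>\<^bsub>R\<^esub>,
     add = (\<lambda>X Y. \<Union>(a, s) \<in> X. \<Union>(b, t) \<in> Y.
       loc_frac R S ((t \<otimes>\<^bsub>R\<^esub> a) \<oplus>\<^bsub>R\<^esub> (s \<otimes>\<^bsub>R\<^esub> b)) (s \<otimes>\<^bsub>R\<^esub> t))\<rparr>"

text \<open>For a prime ideal \<open>\<pp>\<close> of \<open>R\<close>: the local ring \<open>R\<^sub>\<pp>\<close> and its maximal ideal
  \<open>\<pp> R\<^sub>\<pp>\<close>.\<close>

definition local_ring_at :: "('a, 'b) ring_scheme \<Rightarrow> 'a set \<Rightarrow> ('a \<times> 'a) set ring" where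
  "local_ring_at R \<pp> = localization R (carrier R - \<pp>)"

definition local_max_ideal :: "('a, 'b) ring_scheme \<Rightarrow> 'a set \<Rightarrow> ('a \<times> 'a) set set" where
  "local_max_ideal R \<pp> = {loc_frac R (carrier R - \<pp>) a s | a s. a \<in> \<pp> \<and> s \<in> carrier R - \<pp>}"

text \<open>
  \<open>\<mm> / \<mm>\<^sup>2\<close> as a vector space over \<open>K\<close>, for a \<open>K\<close>-algebra \<open>S\<close> with structure map \<open>\<iota>\<close> and
  an ideal \<open>\<mm>\<close>. It is realised inside \<open>S / \<mm>\<^sup>2\<close>; the fields \<open>mult\<close> and \<open>one\<close> of the record
  play no role.
\<close>

definition cotangent_space ::
    "('k \<Rightarrow> 'a) \<Rightarrow> ('a, 'b) ring_scheme \<Rightarrow> 'a set \<Rightarrow> ('k, 'a set) module" where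
  "cotangent_space \<iota> S \<mm> =
    (let J = ideal_prod S \<mm> \<mm>; Q = S Quot J in
      \<lparr>carrier = (\<lambda>x. J +>\<^bsub>S\<^esub> x) ` \<mm>, mult = mult Q, one = one Q, zero = zero Q, add = add Q,
       smult = (\<lambda>c X. (J +>\<^bsub>S\<^esub> \<iota> c) \<otimes>\<^bsub>Q\<^esub> X)\<rparr>)"

definition cot_dim :: "('k::field \<Rightarrow> 'a) \<Rightarrow> ('a, 'b) ring_scheme \<Rightarrow> 'a set \<Rightarrow> nat" where
  "cot_dim \<iota> S \<mm> = vectorspace.dim class_ring (cotangent_space \<iota> S \<mm>)"

definition ecod :: "('k::field \<Rightarrow> 'a) \<Rightarrow> ('a, 'b) ring_scheme \<Rightarrow> 'a set \<Rightarrow> ereal" where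
  "ecod \<iota> S \<mm> = ereal (real (cot_dim \<iota> S \<mm>)) - krull_dim S"


section \<open>Local rings along the zero section and in the fibers\<close>

text \<open>A point \<open>\<Gamma>\<close> of \<open>K\<^sup>m\<close> is a vector in \<open>carrier_vec m\<close>.\<close>

definition R_ring :: "nat \<Rightarrow> nat \<Rightarrow> 'a::field mpoly set \<Rightarrow> 'a mpoly set ring" where
  "R_ring m k I = P_ring m k Quot I"

definition R_scalar :: "nat \<Rightarrow> nat \<Rightarrow> 'a::field mpoly set \<Rightarrow> 'a \<Rightarrow> 'a mpoly set" where
  "R_scalar m k I c = I +>\<^bsub>P_ring m k\<^esub> Const c"

definition zero_point_ideal :: "nat \<Rightarrow> nat \<Rightarrow> 'a::field vec \<Rightarrow> 'a mpoly set" where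
  "zero_point_ideal m k \<Gamma> =
    Idl\<^bsub>P_ring m k\<^esub> ((\<lambda>i. Var (AVar i) - Const (\<Gamma> $ i)) ` {..<m} \<union> Var ` X_vars k)"

definition R_zero_point_ideal ::
    "nat \<Rightarrow> nat \<Rightarrow> 'a::field mpoly set \<Rightarrow> 'a vec \<Rightarrow> 'a mpoly set set" where
  "R_zero_point_ideal m k I \<Gamma> = (\<lambda>f. I +>\<^bsub>P_ring m k\<^esub> f) ` zero_point_ideal m k \<Gamma>"

definition R_zero_point ::
    "nat \<Rightarrow> nat \<Rightarrow> 'a::field mpoly set \<Rightarrow> 'a vec \<Rightarrow> ('a mpoly set \<times> 'a mpoly set) set ring" where
  "R_zero_point m k I \<Gamma> = local_ring_at (R_ring m k I) (R_zero_point_ideal m k I \<Gamma>)"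

definition d_zero_point :: "nat \<Rightarrow> nat \<Rightarrow> 'a::field mpoly set \<Rightarrow> 'a vec \<Rightarrow> ereal" where
  "d_zero_point m k I \<Gamma> = krull_dim (R_zero_point m k I \<Gamma>)"

definition specialize :: "'a::field vec \<Rightarrow> 'a mpoly \<Rightarrow> 'a mpoly" where
  "specialize \<Gamma> =
    mpoly_eval Const (\<lambda>v. case v of AVar i \<Rightarrow> Const (\<Gamma> $ i) | XVar j \<Rightarrow> Var (XVar j))"

definition fiber_ring :: "nat \<Rightarrow> 'a::field mpoly set \<Rightarrow> 'a vec \<Rightarrow> 'a mpoly set ring" where
  "fiber_ring k I \<Gamma> = KX_ring k Quot (specialize \<Gamma> ` I)"

definition fiber_scalar :: "nat \<Rightarrow> 'a::field mpoly set \<Rightarrow> 'a vec \<Rightarrow> 'a \<Rightarrow> 'a mpoly set" where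
  "fiber_scalar k I \<Gamma> c = (specialize \<Gamma> ` I) +>\<^bsub>KX_ring k\<^esub> Const c"

definition fiber_origin_ideal :: "nat \<Rightarrow> 'a::field mpoly set \<Rightarrow> 'a vec \<Rightarrow> 'a mpoly set set" where
  "fiber_origin_ideal k I \<Gamma> =
    (\<lambda>f. (specialize \<Gamma> ` I) +>\<^bsub>KX_ring k\<^esub> f) ` (Idl\<^bsub>KX_ring k\<^esub> (Var ` X_vars k))"

definition R_fiber ::
    "nat \<Rightarrow> 'a::field mpoly set \<Rightarrow> 'a vec \<Rightarrow> ('a mpoly set \<times> 'a mpoly set) set ring" where
  "R_fiber k I \<Gamma> = local_ring_at (fiber_ring k I \<Gamma>) (fiber_origin_ideal k I \<Gamma>)"

definition d_fiber :: "nat \<Rightarrow> 'a::field mpoly set \<Rightarrow> 'a vec \<Rightarrow> ereal" where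
  "d_fiber k I \<Gamma> = krull_dim (R_fiber k I \<Gamma>)"

text \<open>The structure map of a local ring \<open>R\<^sub>\<pp>\<close> as an algebra over \<open>K\<close>, given that of \<open>R\<close>.\<close>

definition local_scalar ::
    "('k \<Rightarrow> 'a) \<Rightarrow> ('a, 'b) ring_scheme \<Rightarrow> 'a set \<Rightarrow> 'k \<Rightarrow> ('a \<times> 'a) set" where
  "local_scalar \<iota> R \<pp> c = loc_frac R (carrier R - \<pp>) (\<iota> c) \<one>\<^bsub>R\<^esub>"

definition Sing_0 :: "nat \<Rightarrow> nat \<Rightarrow> 'a::field mpoly set \<Rightarrow> 'a vec set" where
  "Sing_0 m k I = {\<Gamma> \<in> carrier_vec m.
    ecod (local_scalar (R_scalar m k I) (R_ring m k I) (R_zero_point_ideal m k I \<Gamma>))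
      (R_zero_point m k I \<Gamma>)
      (local_max_ideal (R_ring m k I) (R_zero_point_ideal m k I \<Gamma>)) > 0}"

definition Sing_v :: "nat \<Rightarrow> nat \<Rightarrow> 'a::field mpoly set \<Rightarrow> 'a vec set" where
  "Sing_v m k I = {\<Gamma> \<in> carrier_vec m.
    ecod (local_scalar (fiber_scalar k I \<Gamma>) (fiber_ring k I \<Gamma>) (fiber_origin_ideal k I \<Gamma>))
      (R_fiber k I \<Gamma>)
      (local_max_ideal (fiber_ring k I \<Gamma>) (fiber_origin_ideal k I \<Gamma>)) > 0}"


section \<open>Linear coefficient matrices\<close>

text \<open>
  The coefficient \<open>f\<^sub>j \<in> A\<close> of \<open>x\<^sub>j\<close> in the \<open>A\<close>-linear part of \<open>f\<close> collects the
  terms of \<open>f\<close> whose monomial is \<open>x\<^sub>j\<close> times a power product of the \<open>a\<^sub>i\<close>.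
  By \<open>lin_coeff_decomposition\<close> and \<open>lin_coeff_unique\<close> below,
  these are exactly the coefficients in
  \<open>f = f\<^sub>0 + f\<^sub>1 x\<^sub>1 + \<dots> + f\<^sub>k x\<^sub>k + g\<close> with \<open>f\<^sub>j \<in> A\<close> and \<open>g \<in> \<langle>X\<rangle>\<^sup>2\<close>.
\<close>

definition lin_coeff :: "nat \<Rightarrow> 'a::comm_monoid_add mpoly \<Rightarrow> 'a mpoly" where
  "lin_coeff j f =
    (\<Sum>t | t \<in> Poly_Mapping.keys f \<and>
        (\<forall>i. Poly_Mapping.lookup t (XVar i) = (if i = j then 1 else 0)).
      Poly_Mapping.single (t - Poly_Mapping.single (XVar j) 1) (Poly_Mapping.lookup f t))"

lemma keys_plus_nat: "Poly_Mapping.keys (s + t) = Poly_Mapping.keys s \<union> Poly_Mapping.keys (t :: monomial)"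
  by (auto simp: in_keys_iff lookup_add)

lemma mpoly_vars_add:
  fixes p q :: "'a::comm_ring_1 mpoly"
  assumes "mpoly_vars p \<subseteq> V" "mpoly_vars q \<subseteq> V" shows "mpoly_vars (p + q) \<subseteq> V"
  using assms by (auto simp: mpoly_vars_def dest!: subsetD[OF keys_add])

lemma mpoly_vars_uminus:
  fixes p :: "'a::comm_ring_1 mpoly"
  shows "mpoly_vars (- p) = mpoly_vars p"
  by (simp add: mpoly_vars_def)

lemma mpoly_vars_mult:
  fixes p q :: "'a::comm_ring_1 mpoly"
  assumes "mpoly_vars p \<subseteq> V" "mpoly_vars q \<subseteq> V" shows "mpoly_vars (p * q) \<subseteq> V"
proof -
  have "Poly_Mapping.keys t \<subseteq> V" if t: "t \<in> Poly_Mapping.keys (p * q)" for t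
  proof -
    obtain a b where "t = a + b" "a \<in> Poly_Mapping.keys p" "b \<in> Poly_Mapping.keys q"
      using t keys_mult[of p q] by blast
    then show ?thesis using assms by (auto simp: mpoly_vars_def keys_plus_nat)
  qed
  then show ?thesis by (auto simp: mpoly_vars_def)
qed

lemma mpoly_vars_single:
  "c \<noteq> 0 \<Longrightarrow> mpoly_vars (Poly_Mapping.single t c) = Poly_Mapping.keys t"
  by (simp add: mpoly_vars_def)

lemma mpoly_vars_0 [simp]: "mpoly_vars 0 = {}"
  by (simp add: mpoly_vars_def)

lemma mpoly_vars_one [simp]: "mpoly_vars (1 :: 'a::comm_ring_1 mpoly) = {}"
  by (simp add: mpoly_vars_def)

lemma mpoly_ring_cring: "cring (mpoly_ring V :: 'a::comm_ring_1 mpoly ring)"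
proof (rule cringI)
  show "abelian_group (mpoly_ring V :: 'a mpoly ring)"
  proof (rule abelian_groupI)
    fix x :: "'a mpoly" assume "x \<in> carrier (mpoly_ring V)"
    then show "\<exists>y\<in>carrier (mpoly_ring V). y \<oplus>\<^bsub>mpoly_ring V\<^esub> x = \<zero>\<^bsub>mpoly_ring V\<^esub>"
      by (intro bexI[of _ "- x"]) (auto simp: mpoly_ring_def mpoly_vars_uminus)
  qed (auto simp: mpoly_ring_def mpoly_vars_add algebra_simps)
  show "comm_monoid (mpoly_ring V :: 'a mpoly ring)"
    by (rule comm_monoidI)
       (auto simp: mpoly_ring_def mpoly_vars_mult algebra_simps)
qed (auto simp: mpoly_ring_def algebra_simps)

lemma mpoly_sum_singles:
  fixes p :: "'a::comm_monoid_add mpoly"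
  shows "p = (\<Sum>t \<in> Poly_Mapping.keys p. Poly_Mapping.single t (Poly_Mapping.lookup p t))"
  by (rule poly_mapping_eqI)
     (simp add: lookup_sum lookup_single when_def in_keys_iff)

lemma mpoly_var_induct [consumes 1, case_names zero single add]:
  fixes p :: "'a::comm_monoid_add mpoly"
  assumes "mpoly_vars p \<subseteq> V" "P 0"
    "\<And>t c. Poly_Mapping.keys t \<subseteq> V \<Longrightarrow> P (Poly_Mapping.single t c)"
    "\<And>p q. P p \<Longrightarrow> P q \<Longrightarrow> P (p + q)"
  shows "P p"
proof -
  have "P (\<Sum>t \<in> T. Poly_Mapping.single t (Poly_Mapping.lookup p t))"
    if "finite T" "T \<subseteq> Poly_Mapping.keys p" for T
    using that
  proof (induction T rule: finite_induct)
    case (insert t T)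
    then have "Poly_Mapping.keys t \<subseteq> V" using assms(1) by (auto simp: mpoly_vars_def)
    then show ?case using insert assms(3,4) by simp
  qed (use assms in simp)
  from this[of "Poly_Mapping.keys p"] show ?thesis using mpoly_sum_singles[of p] by simp
qed

lemma lookup_lin_coeff:
  "Poly_Mapping.lookup (lin_coeff j f) t =
    (if \<forall>i. Poly_Mapping.lookup t (XVar i) = 0
     then Poly_Mapping.lookup f (t + Poly_Mapping.single (XVar j) 1) else 0)"
proof -
  let ?x = "Poly_Mapping.single (XVar j) (1::nat)"
  let ?T = "{u \<in> Poly_Mapping.keys f. \<forall>i. Poly_Mapping.lookup u (XVar i) = (if i = j then 1 else 0)}"
  have fin: "finite ?T" by simp
  have eq: "u - ?x = t \<longleftrightarrow> u = t + ?x" if "u \<in> ?T" for u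
  proof
    assume "u - ?x = t"
    then show "u = t + ?x" using that
      by (intro poly_mapping_eqI) (auto simp: lookup_add lookup_minus lookup_single when_def)
  qed auto
  have "Poly_Mapping.lookup (lin_coeff j f) t =
      (\<Sum>u \<in> ?T. if u = t + ?x then Poly_Mapping.lookup f u else 0)"
    unfolding lin_coeff_def lookup_sum lookup_single when_def
    by (intro sum.cong refl) (use eq in auto)
  also have "\<dots> = (if t + ?x \<in> ?T then Poly_Mapping.lookup f (t + ?x) else 0)"
    by (simp add: sum.delta'[OF fin] sum.delta[OF fin])
  also have "\<dots> = (if \<forall>i. Poly_Mapping.lookup t (XVar i) = 0
     then Poly_Mapping.lookup f (t + ?x) else 0)"
    by (auto simp: lookup_add lookup_single when_def in_keys_iff)
  finally show ?thesis .
qed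

lemma lin_coeff_0 [simp]: "lin_coeff j 0 = 0"
  by (simp add: lin_coeff_def)

lemma lin_coeff_add: "lin_coeff j (f + g) = lin_coeff j f + lin_coeff j g"
  by (rule poly_mapping_eqI) (simp add: lookup_lin_coeff lookup_add)

lemma lin_coeff_sum: "lin_coeff j (\<Sum>i\<in>S. f i) = (\<Sum>i\<in>S. lin_coeff j (f i))"
  by (induction S rule: infinite_finite_induct) (auto simp: lin_coeff_add)

lemma A_monomial: "Poly_Mapping.keys t \<subseteq> A_vars m \<Longrightarrow> Poly_Mapping.lookup t (XVar i) = 0"
  by (auto simp: A_vars_def in_keys_iff)

lemma lin_coeff_A: "f \<in> carrier (A_ring m) \<Longrightarrow> lin_coeff j f = 0"
  unfolding A_ring_def mpoly_ring_def
proof (simp, induction rule: mpoly_var_induct)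
  case (single t c)
  have "t \<noteq> u + Poly_Mapping.single (XVar j) 1" for u
    using A_monomial[OF single, of j] by (auto simp: lookup_add)
  then show ?case by (intro poly_mapping_eqI) (auto simp: lookup_lin_coeff lookup_single when_def)
qed (auto simp: lin_coeff_add)

lemma lin_coeff_A_mult_Var:
  fixes c :: "'a::comm_ring_1 mpoly"
  assumes "c \<in> carrier (A_ring m)"
  shows "lin_coeff j (c * Var (XVar i)) = (if i = j then c else 0)"
proof -
  have "mpoly_vars c \<subseteq> A_vars m" using assms by (simp add: A_ring_def mpoly_ring_def)
  then show ?thesis
  proof (induction rule: mpoly_var_induct)
    case (single t c)
    note z = A_monomial[OF single]
    have "u = t" if "t + Poly_Mapping.single (XVar j) 1 = u + Poly_Mapping.single (XVar j) (1::nat)" for u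
      using that by simp
    moreover have "i = j" if "t + Poly_Mapping.single (XVar i) 1 = u + Poly_Mapping.single (XVar j) (1::nat)" for u
    proof (rule ccontr)
      assume "i \<noteq> j"
      then show False using arg_cong[OF that, of "\<lambda>s. Poly_Mapping.lookup s (XVar j)"] z[of j]
        by (simp add: lookup_add lookup_single when_def)
    qed
    ultimately show ?case using z
      by (intro poly_mapping_eqI)
         (auto simp: lookup_lin_coeff lookup_single when_def Var_def mult_single)
  qed (auto simp: lin_coeff_add distrib_right)
qed

definition X_square :: "nat \<Rightarrow> nat \<Rightarrow> 'a::comm_ring_1 mpoly set" where
  "X_square m k =
    ideal_prod (P_ring m k) (Idl\<^bsub>P_ring m k\<^esub> (Var ` X_vars k)) (Idl\<^bsub>P_ring m k\<^esub> (Var ` X_vars k))"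

lemma Var_in_P: "Var ` (A_vars m \<union> X_vars k) \<subseteq> (carrier (P_ring m k) :: 'a::comm_ring_1 mpoly set)"
  by (auto simp: P_ring_def mpoly_ring_def Var_def mpoly_vars_single)

lemma Var_X_in_P: "Var ` X_vars k \<subseteq> (carrier (P_ring m k) :: 'a::comm_ring_1 mpoly set)"
  using Var_in_P by blast

lemma P_ring_cring: "cring (P_ring m k :: 'a::comm_ring_1 mpoly ring)"
  by (simp add: P_ring_def mpoly_ring_cring)

lemma Idl_X_monomials:
  fixes p :: "'a::comm_ring_1 mpoly"
  assumes "p \<in> Idl\<^bsub>P_ring m k\<^esub> (Var ` X_vars k)" "t \<in> Poly_Mapping.keys p"
  shows "\<exists>i. Poly_Mapping.lookup t (XVar i) > 0"
proof -
  interpret P: cring "P_ring m k :: 'a mpoly ring" by (rule P_ring_cring)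
  let ?J = "{p :: 'a mpoly. p \<in> carrier (P_ring m k) \<and>
    (\<forall>t\<in>Poly_Mapping.keys p. \<exists>i. Poly_Mapping.lookup t (XVar i) > 0)}"
  have simps: "a \<oplus>\<^bsub>P_ring m k\<^esub> b = a + b" "a \<otimes>\<^bsub>P_ring m k\<^esub> b = a * b" "\<zero>\<^bsub>P_ring m k\<^esub> = 0"
    for a b :: "'a mpoly" by (simp_all add: P_ring_def mpoly_ring_def)
  have umin: "\<ominus>\<^bsub>P_ring m k\<^esub> a = - a" if "a \<in> carrier (P_ring m k)" for a :: "'a mpoly"
    by (rule P.minus_equality) (use that in \<open>auto simp: P_ring_def mpoly_ring_def mpoly_vars_uminus\<close>)
  have mul: "a * x \<in> ?J" if "a \<in> ?J" "x \<in> carrier (P_ring m k)" for a x :: "'a mpoly"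
  proof -
    have "\<exists>i. Poly_Mapping.lookup t (XVar i) > 0" if "t \<in> Poly_Mapping.keys (a * x)" for t
      using that \<open>a \<in> ?J\<close> keys_mult[of a x] by (fastforce simp: lookup_add)
    moreover have "a * x \<in> carrier (P_ring m k)" using that P.m_closed[of a x] by (simp add: simps)
    ultimately show ?thesis by simp
  qed
  have "ideal ?J (P_ring m k)"
  proof (rule idealI)
    show "subgroup ?J (add_monoid (P_ring m k))"
    proof (rule subgroup.intro)
      fix x y :: "'a mpoly" assume xy: "x \<in> ?J" "y \<in> ?J"
      then have "x + y \<in> carrier (P_ring m k)" using P.a_closed[of x y] by (simp add: simps)
      then show "x \<otimes>\<^bsub>add_monoid (P_ring m k)\<^esub> y \<in> ?J"
        using xy by (auto simp: simps dest!: subsetD[OF keys_add])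
    next
      fix x :: "'a mpoly" assume x: "x \<in> ?J"
      then have "\<ominus>\<^bsub>P_ring m k\<^esub> x \<in> ?J" using umin[of x] P.a_inv_closed[of x] by simp
      then show "inv\<^bsub>add_monoid (P_ring m k)\<^esub> x \<in> ?J" by (simp add: a_inv_def)
    qed (use P.zero_closed in \<open>auto simp: simps\<close>)
  next
    fix a x :: "'a mpoly" assume "a \<in> ?J" "x \<in> carrier (P_ring m k)"
    then show "x \<otimes>\<^bsub>P_ring m k\<^esub> a \<in> ?J" "a \<otimes>\<^bsub>P_ring m k\<^esub> x \<in> ?J"
      using mul[of a x] by (simp_all only: simps mult.commute)
  qed (rule P.ring_axioms)
  moreover have "Var ` X_vars k \<subseteq> ?J"
    using Var_X_in_P[of k m] by (auto simp: Var_def X_vars_def lookup_single when_def)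
  ultimately have "Idl\<^bsub>P_ring m k\<^esub> (Var ` X_vars k) \<subseteq> ?J" by (rule P.genideal_minimal)
  then show ?thesis using assms by blast
qed

lemma lin_coeff_X_square:
  assumes "g \<in> X_square m k"
  shows "lin_coeff j (g :: 'a::comm_ring_1 mpoly) = 0"
  using assms unfolding X_square_def
proof (induction rule: ideal_prod.induct)
  case (prod p q)
  have "Poly_Mapping.lookup (p * q) (t + Poly_Mapping.single (XVar j) 1) = 0"
    if t: "\<forall>i. Poly_Mapping.lookup t (XVar i) = 0" for t
  proof (rule ccontr)
    assume "\<not> ?thesis"
    then have "t + Poly_Mapping.single (XVar j) 1 \<in> Poly_Mapping.keys (p * q)" by (simp add: in_keys_iff)
    then obtain a b where ab: "t + Poly_Mapping.single (XVar j) 1 = a + b"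
      "a \<in> Poly_Mapping.keys p" "b \<in> Poly_Mapping.keys q" using keys_mult[of p q] by blast
    obtain i where i: "Poly_Mapping.lookup a (XVar i) > 0" using Idl_X_monomials prod(1) ab(2) by blast
    obtain l where l: "Poly_Mapping.lookup b (XVar l) > 0" using Idl_X_monomials prod(2) ab(3) by blast
    have eq: "(if e = j then 1 else 0) = Poly_Mapping.lookup a (XVar e) + Poly_Mapping.lookup b (XVar e)" for e
      using arg_cong[OF ab(1), of "\<lambda>s. Poly_Mapping.lookup s (XVar e)"] t
      by (auto simp: lookup_add lookup_single when_def split: if_splits)
    have "i = j" "l = j" using eq[of i] eq[of l] i l by (auto split: if_splits)
    then show False using eq[of j] i l by simp
  qed
  then have "lin_coeff j (p * q) = 0"
    by (intro poly_mapping_eqI) (simp add: lookup_lin_coeff)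
  then show ?case by (simp add: P_ring_def mpoly_ring_def)
next
  case (sum s1 s2)
  then show ?case by (simp add: P_ring_def mpoly_ring_def lin_coeff_add)
qed

lemma lin_coeff_unique:
  fixes f :: "'a::comm_ring_1 mpoly"
  assumes "f = f0 + (\<Sum>j<k. c j * Var (XVar j)) + g"
    and "f0 \<in> carrier (A_ring m)" "\<forall>j<k. c j \<in> carrier (A_ring m)" "g \<in> X_square m k" "j < k"
  shows "c j = lin_coeff j f"
proof -
  have "(\<Sum>i<k. lin_coeff j (c i * Var (XVar i))) = (\<Sum>i<k. if i = j then c i else 0)"
    by (intro sum.cong refl) (metis assms(3) lin_coeff_A_mult_Var lessThan_iff)
  then show ?thesis using assms lin_coeff_A[OF assms(2)] lin_coeff_X_square[OF assms(4)]
    by (simp add: lin_coeff_add lin_coeff_sum)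
qed

lemma lin_coeff_decomposition:
  fixes f :: "'a::comm_ring_1 mpoly"
  assumes "f \<in> carrier (P_ring m k)"
  shows "(\<forall>j. lin_coeff j f \<in> carrier (A_ring m)) \<and>
    (\<exists>f0 \<in> carrier (A_ring m). \<exists>g \<in> X_square m k.
      f = f0 + (\<Sum>j<k. lin_coeff j f * Var (XVar j)) + g)"
proof -
  interpret P: cring "P_ring m k :: 'a mpoly ring" by (rule P_ring_cring)
  interpret A: cring "A_ring m :: 'a mpoly ring" by (simp add: A_ring_def mpoly_ring_cring)
  let ?J = "Idl\<^bsub>P_ring m k\<^esub> (Var ` X_vars k) :: 'a mpoly set"
  have idl: "ideal ?J (P_ring m k)" by (rule P.genideal_ideal[OF Var_X_in_P])
  interpret S: ideal "X_square m k :: 'a mpoly set" "P_ring m k"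
    unfolding X_square_def using P.ideal_prod_is_ideal[OF idl idl] .
  have Psimps: "a \<oplus>\<^bsub>P_ring m k\<^esub> b = a + b" "a \<otimes>\<^bsub>P_ring m k\<^esub> b = a * b" "\<zero>\<^bsub>P_ring m k\<^esub> = 0"
    for a b :: "'a mpoly" by (simp_all add: P_ring_def mpoly_ring_def)
  have Asimps: "a \<oplus>\<^bsub>A_ring m\<^esub> b = a + b" "\<zero>\<^bsub>A_ring m\<^esub> = 0"
    for a b :: "'a mpoly" by (simp_all add: A_ring_def mpoly_ring_def)
  have A0: "(0 :: 'a mpoly) \<in> carrier (A_ring m)" using A.zero_closed by (simp add: Asimps)
  have S0: "(0 :: 'a mpoly) \<in> X_square m k" using S.zero_closed by (simp add: Psimps)
  have A_add: "a + b \<in> carrier (A_ring m)"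
    if "a \<in> carrier (A_ring m)" "b \<in> carrier (A_ring m)" for a b :: "'a mpoly"
    using A.a_closed[OF that] by (simp add: Asimps)
  have S_add: "a + b \<in> X_square m k" if "a \<in> X_square m k" "b \<in> X_square m k" for a b :: "'a mpoly"
    using S.a_closed[OF that] by (simp add: Psimps)
  have "mpoly_vars f \<subseteq> A_vars m \<union> X_vars k" using assms by (simp add: P_ring_def mpoly_ring_def)
  then show ?thesis
  proof (induction rule: mpoly_var_induct)
    case zero
    show ?case using A0 S0 by (intro conjI bexI[of _ 0]) simp_all
  next
    case (add p q)
    have sum_eq: "x + y = (x0 + y0) + (sx + sy) + (xg + yg)"
      if "x = x0 + sx + xg" "y = y0 + sy + yg" for x y x0 y0 sx sy xg yg :: "'a mpoly"
      using that by (simp add: add_ac)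
    from add obtain p0 q0 pg qg where
      "p0 \<in> carrier (A_ring m)" "q0 \<in> carrier (A_ring m)" "pg \<in> X_square m k" "qg \<in> X_square m k"
      "p = p0 + (\<Sum>j<k. lin_coeff j p * Var (XVar j)) + pg"
      "q = q0 + (\<Sum>j<k. lin_coeff j q * Var (XVar j)) + qg" by blast
    moreover from this(5,6) have "p + q = (p0 + q0) + (\<Sum>j<k. lin_coeff j (p + q) * Var (XVar j)) + (pg + qg)"
      unfolding lin_coeff_add distrib_right sum.distrib by (intro sum_eq)
    moreover have "lin_coeff j (p + q) \<in> carrier (A_ring m)" for j
      using add A_add[of "lin_coeff j p" "lin_coeff j q"] unfolding lin_coeff_add by blast
    ultimately show ?case using A_add[of p0 q0] S_add[of pg qg] by blast
  next
    case (single t c)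
    let ?f = "Poly_Mapping.single t c"
    have A_single: "Poly_Mapping.single u c \<in> carrier (A_ring m)" if "Poly_Mapping.keys u \<subseteq> A_vars m" for u
      using that by (cases "c = 0") (auto simp: A_ring_def mpoly_ring_def mpoly_vars_single)
    have split: "\<exists>i<k. t = (t - Poly_Mapping.single (XVar i) 1) + Poly_Mapping.single (XVar i) 1"
      if t: "Poly_Mapping.keys t \<subseteq> A_vars m \<union> X_vars k" "\<not> Poly_Mapping.keys t \<subseteq> A_vars m" for t :: monomial
    proof -
      obtain i where "i < k" "XVar i \<in> Poly_Mapping.keys t" using t by (auto simp: X_vars_def)
      moreover from this have "Poly_Mapping.lookup t (XVar i) - 1 + 1 = Poly_Mapping.lookup t (XVar i)"
        by (simp add: in_keys_iff)
      then have "t = (t - Poly_Mapping.single (XVar i) 1) + Poly_Mapping.single (XVar i) 1"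
        by (intro poly_mapping_eqI) (auto simp: lookup_add lookup_minus lookup_single when_def)
      ultimately show ?thesis by blast
    qed
    have sub: "Poly_Mapping.keys (t - s) \<subseteq> Poly_Mapping.keys t" for t s :: monomial
      by (auto simp: in_keys_iff lookup_minus)
    have single_Var: "Poly_Mapping.single (u + Poly_Mapping.single v 1) c = Poly_Mapping.single u c * Var v" for u v
      by (simp add: Var_def mult_single)
    show ?case
    proof (cases "Poly_Mapping.keys t \<subseteq> A_vars m")
      case True
      then have lin: "lin_coeff j ?f = 0" for j using lin_coeff_A[OF A_single] by blast
      show ?thesis
        using A0 S0 A_single[OF True] lin by (intro conjI bexI[of _ ?f] bexI[of _ 0]) simp_all
    next
      case False
      then obtain i where i: "i < k" "t = (t - Poly_Mapping.single (XVar i) 1) + Poly_Mapping.single (XVar i) 1"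
        using split[OF single] by blast
      define u where "u = t - Poly_Mapping.single (XVar i) 1"
      have f: "?f = Poly_Mapping.single u c * Var (XVar i)" using single_Var[of u "XVar i"] i(2) by (simp add: u_def)
      have u: "Poly_Mapping.keys u \<subseteq> A_vars m \<union> X_vars k" using sub single u_def by blast
      show ?thesis
      proof (cases "Poly_Mapping.keys u \<subseteq> A_vars m")
        case True
        have lin: "lin_coeff j ?f = (if i = j then Poly_Mapping.single u c else 0)" for j
          unfolding f using lin_coeff_A_mult_Var[OF A_single[OF True]] .
        have "(\<Sum>j<k. lin_coeff j ?f * Var (XVar j)) = (\<Sum>j<k. if i = j then ?f else 0)"
          by (intro sum.cong refl) (auto simp: lin f[symmetric])
        also have "\<dots> = ?f" using i by simp
        finally have "?f = 0 + (\<Sum>j<k. lin_coeff j ?f * Var (XVar j)) + 0" by simp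
        moreover have "lin_coeff j ?f \<in> carrier (A_ring m)" for j
          using A0 A_single[OF True] by (simp add: lin)
        ultimately show ?thesis using A0 S0 by blast
      next
        case False
        then obtain l where l: "l < k" "u = (u - Poly_Mapping.single (XVar l) 1) + Poly_Mapping.single (XVar l) 1"
          using split[OF u] by blast
        define v where "v = u - Poly_Mapping.single (XVar l) 1"
        have g: "Poly_Mapping.single u c = Poly_Mapping.single v c * Var (XVar l)"
          using single_Var[of v "XVar l"] l(2) by (simp add: v_def)
        have v: "Poly_Mapping.single v c \<in> carrier (P_ring m k)"
          using sub[of u] u unfolding v_def
          by (cases "c = 0") (auto simp: P_ring_def mpoly_ring_def mpoly_vars_single)
        have gen: "Var (XVar j) \<in> ?J" if "j < k" for j
          using P.genideal_self[OF Var_X_in_P] that by (auto simp: X_vars_def)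
        have "Poly_Mapping.single u c \<in> ?J"
          using ideal.I_l_closed[OF idl gen[OF l(1)] v] by (simp add: g Psimps)
        from ideal_prod.prod[OF this gen[OF i(1)], of "P_ring m k"]
        have S: "?f \<in> X_square m k" by (simp add: X_square_def f Psimps)
        then have lin: "lin_coeff j ?f = 0" for j by (rule lin_coeff_X_square)
        show ?thesis
          using A0 S lin by (intro conjI bexI[of _ 0] bexI[of _ ?f]) simp_all
      qed
    qed
  qed
qed

definition lin_coeff_mat :: "nat \<Rightarrow> 'a::comm_monoid_add mpoly list \<Rightarrow> 'a mpoly mat" where
  "lin_coeff_mat k G = mat (length G) k (\<lambda>(i, j). lin_coeff j (G ! i))"

text \<open>For \<open>p \<in> A\<close>, the value \<open>p(\<gamma>\<^sub>1, \<dots>, \<gamma>\<^sub>m)\<close>; the value given to the \<open>x\<^sub>j\<close> is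
  then irrelevant.\<close>

definition A_eval :: "'a::field vec \<Rightarrow> 'a mpoly \<Rightarrow> 'a" where
  "A_eval \<Gamma> = mpoly_eval id (\<lambda>v. case v of AVar i \<Rightarrow> \<Gamma> $ i | XVar j \<Rightarrow> 0)"

definition lin_coeff_mat_at :: "nat \<Rightarrow> 'a::field mpoly list \<Rightarrow> 'a vec \<Rightarrow> 'a mat" where
  "lin_coeff_mat_at k G \<Gamma> = map_mat (A_eval \<Gamma>) (lin_coeff_mat k G)"

end

theory Submission
  imports Defs
begin

text \<open>
  Both local rings of the statement are of the following kind: \<open>R = Q / J\<close> is a quotient of a
  polynomial ring \<open>Q\<close> over \<open>K\<close> in \<open>N\<close> indeterminates, localized at a point \<open>c\<close> with coordinates in
  \<open>K\<close> at which \<open>J\<close> vanishes. If \<open>M \<subseteq> Q\<close> is the ideal of the polynomials vanishing at \<open>c\<close>, then the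
  Taylor expansion at \<open>c\<close> identifies \<open>M / M\<^sup>2\<close> with \<open>K\<^sup>N\<close> by means of the gradient, so the cotangent
  space of \<open>R\<close> at \<open>c\<close> is \<open>K\<^sup>N\<close> modulo the gradients of the elements of \<open>J\<close>
  (\<open>cot_dim_plus_gradients\<close>). Localization does not change it (\<open>cot_dim_local\<close>): a denominator is a
  nonzero scalar modulo the maximal ideal. Because \<open>J\<close> vanishes at \<open>c\<close>, the gradients of its elements
  form the row space of the Jacobian matrix of its generators (\<open>gradients_row_space\<close>).

  As \<open>I\<close> is homogeneous and meets \<open>A\<close> only in zero, every monomial of an element of \<open>I\<close> contains some
  \<open>x\<^sub>j\<close> (\<open>I_monomial_has_X\<close>). At the zero point the partial derivatives along the \<open>a\<^sub>i\<close> therefore vanish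
  on \<open>I\<close>, and those along the \<open>x\<^sub>j\<close> are the values of the \<open>A\<close>-linear coefficients. Specialization
  preserves the latter. So the Jacobian matrix is \<open>L = \<L>\<^sub>K(G\<^sub>\<Gamma>)\<close> for the fiber and \<open>(0 | L)\<close> for the zero
  point, and the two cotangent spaces have the dimensions \<open>k - rk L\<close> and \<open>m + k - rk L\<close>. This is the
  equality in (a), and it turns the two conditions \<open>ecod > 0\<close> into \<open>rk L < k - d\<^sub>F\<close> and
  \<open>rk L < m + k - d\<^sub>0\<close>. Parts (b) and (c) follow, once it is known that \<open>rk L \<le> k - d\<^sub>F\<close>, that is, that
  \<open>d\<^sub>F\<close> is at most the dimension \<open>e\<close> of the cotangent space of the fiber.

  This inequality, an instance of Krull's height theorem, is elementary here because the fiber ring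
  \<open>K[X] / I\<^sub>\<Gamma>\<close> is positively graded (\<open>krull_dim_fiber_le\<close>). Let \<open>B\<close> be a set of \<open>e\<close> indeterminates
  whose classes form a basis of the cotangent space. Modulo \<open>I\<^sub>\<Gamma>\<close>, every \<open>x\<^sub>j\<close> is a linear combination
  of \<open>B\<close> plus an element of \<open>\<langle>X\<rangle>\<^sup>2\<close>. In the component of weight \<open>w\<^sub>j\<close> of that element only indeterminates of weight
  less than \<open>w\<^sub>j\<close> can occur, so induction on the weight shows that \<open>B\<close> generates the fiber ring as a
  \<open>K\<close>-algebra. It remains to see that a polynomial ring in \<open>e\<close> indeterminates has dimension at most
  \<open>e\<close> (\<open>krull_dim_mpoly_ring_le\<close>). In a chain \<open>p\<^sub>0 \<subset> \<dots> \<subset> p\<^sub>l\<close> of primes, any elements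
  \<open>f\<^sub>i \<in> p\<^bsub>i+1\<^esub> - p\<^sub>i\<close> are algebraically independent over \<open>K\<close>, whereas more than \<open>e\<close> polynomials in \<open>e\<close>
  indeterminates are algebraically dependent, as a count of monomials shows.
\<close>

section \<open>Evaluation and derivatives of polynomials\<close>

definition mono_val :: "(pvar \<Rightarrow> 'b::comm_ring_1) \<Rightarrow> monomial \<Rightarrow> 'b" where
  "mono_val \<sigma> t = (\<Prod>v \<in> Poly_Mapping.keys t. \<sigma> v ^ Poly_Mapping.lookup t v)"

lemma mono_val_superset:
  assumes "finite S" "Poly_Mapping.keys t \<subseteq> S"
  shows "mono_val \<sigma> t = (\<Prod>v \<in> S. \<sigma> v ^ Poly_Mapping.lookup t v)"
  unfolding mono_val_def using assms
  by (intro prod.mono_neutral_left) (auto simp: in_keys_iff)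

lemma mono_val_zero [simp]: "mono_val \<sigma> 0 = 1"
  by (simp add: mono_val_def)

lemma mono_val_add: "mono_val \<sigma> (s + t) = mono_val \<sigma> s * mono_val \<sigma> t"
proof -
  let ?S = "Poly_Mapping.keys s \<union> Poly_Mapping.keys t"
  have "mono_val \<sigma> (s + t) = (\<Prod>v \<in> ?S. \<sigma> v ^ Poly_Mapping.lookup (s + t) v)"
    by (rule mono_val_superset) (auto simp: keys_plus_nat)
  also have "\<dots> = mono_val \<sigma> s * mono_val \<sigma> t"
    by (simp add: mono_val_superset[of ?S s] mono_val_superset[of ?S t] lookup_add power_add prod.distrib)
  finally show ?thesis .
qed

lemma mono_val_single [simp]: "mono_val \<sigma> (Poly_Mapping.single v e) = \<sigma> v ^ e"
  by (simp add: mono_val_def)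

context comm_ring_hom
begin

lemma mpoly_eval_superset:
  assumes "finite T" "Poly_Mapping.keys p \<subseteq> T"
  shows "mpoly_eval hom \<sigma> p = (\<Sum>t \<in> T. hom (Poly_Mapping.lookup p t) * mono_val \<sigma> t)"
  unfolding mpoly_eval_def mono_val_def[symmetric] using assms
  by (intro sum.mono_neutral_left) (auto simp: in_keys_iff)

lemma mpoly_eval_single: "mpoly_eval hom \<sigma> (Poly_Mapping.single t c) = hom c * mono_val \<sigma> t"
  by (subst mpoly_eval_superset[of "{t}"]) auto

lemma mpoly_eval_add: "mpoly_eval hom \<sigma> (p + q) = mpoly_eval hom \<sigma> p + mpoly_eval hom \<sigma> q"
proof -
  let ?T = "Poly_Mapping.keys p \<union> Poly_Mapping.keys q"
  show ?thesis
    using keys_add[of p q]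
    by (simp add: mpoly_eval_superset[of ?T] lookup_add hom_add algebra_simps sum.distrib)
qed

lemma mpoly_eval_Const [simp]: "mpoly_eval hom \<sigma> (Const a) = hom a"
  by (simp add: Const_def mpoly_eval_single)

lemma mpoly_eval_Var [simp]: "mpoly_eval hom \<sigma> (Var v) = \<sigma> v"
  by (simp add: Var_def mpoly_eval_single)

lemma mpoly_eval_mult: "mpoly_eval hom \<sigma> (p * q) = mpoly_eval hom \<sigma> p * mpoly_eval hom \<sigma> q"
proof -
  have single: "mpoly_eval hom \<sigma> (Poly_Mapping.single s a * q) = hom a * mono_val \<sigma> s * mpoly_eval hom \<sigma> q"
    for s a and q :: "'a mpoly"
    by (induction q rule: mpoly_var_induct[OF subset_UNIV])
       (simp_all add: mult_single mpoly_eval_single mpoly_eval_add mono_val_add hom_mult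
         distrib_left algebra_simps mpoly_eval_def[of _ _ 0])
  show ?thesis
    by (induction p rule: mpoly_var_induct[OF subset_UNIV])
       (simp_all add: single mpoly_eval_single mpoly_eval_add distrib_right mpoly_eval_def[of _ _ 0])
qed

lemma mpoly_eval_hom: "comm_ring_hom (mpoly_eval hom \<sigma>)"
proof
  show "mpoly_eval hom \<sigma> 1 = 1" using mpoly_eval_Const[of \<sigma> 1] by (simp add: Const_def)
  show "mpoly_eval hom \<sigma> 0 = 0" by (simp add: mpoly_eval_def)
qed (simp_all add: mpoly_eval_add mpoly_eval_mult)

end

lemma Const_hom: "comm_ring_hom (Const :: 'a::comm_ring_1 \<Rightarrow> 'a mpoly)"
  by standard (simp_all add: Const_def single_add mult_single)

lemma coeff_poly_hom: "comm_ring_hom (\<lambda>a::'a::comm_ring_1. [:a:])"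
  by standard (simp_all add: one_pCons)

lemma id_hom: "comm_ring_hom (id :: 'a::comm_ring_1 \<Rightarrow> 'a)"
  by standard simp_all

interpretation Const: comm_ring_hom "Const :: 'a::comm_ring_1 \<Rightarrow> 'a mpoly" by (rule Const_hom)

text \<open>
  Two ring homomorphisms, or two derivations, that agree on constants and indeterminates agree on all
  polynomials. Most facts about evaluation, differentiation and specialization below are proved by this rule.
\<close>

lemma mpoly_algebra_induct [consumes 1, case_names Const Var add mult]:
  fixes p :: "'a::comm_ring_1 mpoly"
  assumes "mpoly_vars p \<subseteq> V"
    and C: "\<And>a. P (Const a)" and X: "\<And>v. v \<in> V \<Longrightarrow> P (Var v)"
    and add: "\<And>p q. mpoly_vars p \<subseteq> V \<Longrightarrow> mpoly_vars q \<subseteq> V \<Longrightarrow> P p \<Longrightarrow> P q \<Longrightarrow> P (p + q)"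
    and mult: "\<And>p q. mpoly_vars p \<subseteq> V \<Longrightarrow> mpoly_vars q \<subseteq> V \<Longrightarrow> P p \<Longrightarrow> P q \<Longrightarrow> P (p * q)"
  shows "P p"
proof -
  have Cv: "mpoly_vars (Const a :: 'a mpoly) \<subseteq> V" for a
    by (cases "a = 0") (simp_all add: Const_def mpoly_vars_single)
  have Vv: "v \<in> V \<Longrightarrow> mpoly_vars (Var v :: 'a mpoly) \<subseteq> V" for v
    by (simp add: Var_def mpoly_vars_single)
  have "P (Poly_Mapping.single t a) \<and> mpoly_vars (Poly_Mapping.single t a) \<subseteq> V"
    if "Poly_Mapping.keys t \<subseteq> V" for t a
    using that
  proof (induction "\<Sum>v\<in>Poly_Mapping.keys t. Poly_Mapping.lookup t v" arbitrary: t)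
    case 0
    then have "t = 0" by (auto simp: in_keys_iff intro!: poly_mapping_eqI)
    then show ?case using C Cv by (simp add: Const_def)
  next
    case (Suc n)
    then obtain v where v: "v \<in> Poly_Mapping.keys t" by fastforce
    define u where "u = t - Poly_Mapping.single v 1"
    have t: "t = u + Poly_Mapping.single v 1" using v unfolding u_def
      by (intro poly_mapping_eqI) (auto simp: lookup_add lookup_minus lookup_single when_def in_keys_iff)
    have ku: "Poly_Mapping.keys u \<subseteq> Poly_Mapping.keys t" unfolding u_def
      by (auto simp: in_keys_iff lookup_minus)
    have "(\<Sum>x\<in>Poly_Mapping.keys u. Poly_Mapping.lookup u x) = (\<Sum>x\<in>Poly_Mapping.keys t. Poly_Mapping.lookup u x)"
      by (rule sum.mono_neutral_left) (use ku in \<open>auto simp: in_keys_iff\<close>)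
    moreover have "(\<Sum>x\<in>Poly_Mapping.keys t. Poly_Mapping.lookup t x)
        = (\<Sum>x\<in>Poly_Mapping.keys t. Poly_Mapping.lookup u x) + 1"
      using v unfolding t by (simp add: lookup_add sum.distrib lookup_single when_def keys_plus_nat sum.delta')
    ultimately have "n = (\<Sum>x\<in>Poly_Mapping.keys u. Poly_Mapping.lookup u x)" using Suc.hyps(2) by simp
    then have "P (Poly_Mapping.single u a) \<and> mpoly_vars (Poly_Mapping.single u a) \<subseteq> V"
      using Suc.hyps(1)[of u] ku Suc.prems by auto
    moreover have "Poly_Mapping.single t a = Poly_Mapping.single u a * Var v"
      by (simp add: t Var_def mult_single)
    moreover have "v \<in> V" using v Suc.prems by auto
    ultimately show ?case using mult X Vv mpoly_vars_mult by metis
  qed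
  with assms(1) have "P p \<and> mpoly_vars p \<subseteq> V"
  proof (induction rule: mpoly_var_induct)
    case zero show ?case using C[of 0] by simp
  qed (use add mpoly_vars_add in blast)+
  then show ?thesis ..
qed

definition pt_eval :: "(pvar \<Rightarrow> 'a::comm_ring_1) \<Rightarrow> 'a mpoly \<Rightarrow> 'a" where
  "pt_eval c = mpoly_eval id c"

text \<open>
  The restriction of a polynomial to the line through \<open>c\<close> in direction \<open>v\<close>, as a polynomial in the
  parameter of the line. Its linear coefficient is the partial derivative at \<open>c\<close>, and the product rule
  becomes the formula for the coefficients of a product.
\<close>

definition dir_eval :: "(pvar \<Rightarrow> 'a::comm_ring_1) \<Rightarrow> pvar \<Rightarrow> 'a mpoly \<Rightarrow> 'a poly" where
  "dir_eval c v = mpoly_eval (\<lambda>a. [:a:]) (\<lambda>u. [:c u, if u = v then 1 else 0:])"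

definition deriv_at :: "(pvar \<Rightarrow> 'a::comm_ring_1) \<Rightarrow> pvar \<Rightarrow> 'a mpoly \<Rightarrow> 'a" where
  "deriv_at c v p = poly.coeff (dir_eval c v p) 1"

interpretation pt_eval: comm_ring_hom "pt_eval c :: 'a::comm_ring_1 mpoly \<Rightarrow> 'a" for c
  unfolding pt_eval_def by (rule comm_ring_hom.mpoly_eval_hom[OF id_hom])

interpretation dir_eval: comm_ring_hom "dir_eval c v :: 'a::comm_ring_1 mpoly \<Rightarrow> 'a poly" for c v
  unfolding dir_eval_def by (rule comm_ring_hom.mpoly_eval_hom[OF coeff_poly_hom])

lemma pt_eval_Const [simp]: "pt_eval c (Const a) = a"
  by (simp add: pt_eval_def comm_ring_hom.mpoly_eval_Const[OF id_hom])

lemma pt_eval_Var [simp]: "pt_eval c (Var v) = c v"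
  by (simp add: pt_eval_def comm_ring_hom.mpoly_eval_Var[OF id_hom])

lemma pt_eval_single: "pt_eval c (Poly_Mapping.single t a) = a * mono_val c t"
  by (simp add: pt_eval_def comm_ring_hom.mpoly_eval_single[OF id_hom])

lemma dir_eval_Const [simp]: "dir_eval c v (Const a) = [:a:]"
  by (simp add: dir_eval_def comm_ring_hom.mpoly_eval_Const[OF coeff_poly_hom])

lemma dir_eval_Var [simp]: "dir_eval c v (Var u) = [:c u, if u = v then 1 else 0:]"
  by (simp add: dir_eval_def comm_ring_hom.mpoly_eval_Var[OF coeff_poly_hom])

lemma coeff_0_dir_eval: "poly.coeff (dir_eval c v p) 0 = pt_eval c p"
  by (induction p rule: mpoly_algebra_induct[OF subset_UNIV])
     (simp_all add: hom_distribs coeff_mult)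

lemma deriv_at_Const [simp]: "deriv_at c v (Const a) = 0"
  by (simp add: deriv_at_def)

lemma deriv_at_Var [simp]: "deriv_at c v (Var u) = (if u = v then 1 else 0)"
  by (simp add: deriv_at_def)

lemma deriv_at_add: "deriv_at c v (p + q) = deriv_at c v p + deriv_at c v q"
  by (simp add: deriv_at_def hom_distribs)

lemma deriv_at_diff: "deriv_at c v (p - q) = deriv_at c v p - deriv_at c v q"
  by (simp add: deriv_at_def hom_distribs)

lemma deriv_at_mult: "deriv_at c v (p * q) = pt_eval c p * deriv_at c v q + deriv_at c v p * pt_eval c q"
  by (simp add: deriv_at_def hom_distribs coeff_mult coeff_0_dir_eval atMost_Suc)

lemma deriv_at_0 [simp]: "deriv_at c v 0 = 0"
  by (simp add: deriv_at_def)

lemma deriv_at_sum: "deriv_at c v (sum f S) = (\<Sum>i\<in>S. deriv_at c v (f i))"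
  by (induction S rule: infinite_finite_induct) (simp_all add: deriv_at_add)

section \<open>Row rank and column rank\<close>

lemma mult_mat_vec_linear_map:
  fixes A :: "'a::field mat"
  assumes A: "A \<in> carrier_mat s N"
  shows "linear_map class_ring (module_vec TYPE('a) N) (module_vec TYPE('a) s) (\<lambda>v. A *\<^sub>v v)"
proof -
  interpret V: vec_space "TYPE('a)" N .
  interpret W: vec_space "TYPE('a)" s .
  have "(\<lambda>v. A *\<^sub>v v) \<in> module_hom class_ring (module_vec TYPE('a) N) (module_vec TYPE('a) s)"
    using A unfolding module_hom_def
    by (auto simp: mult_add_distrib_mat_vec mult_mat_vec module_vec_simps)
  then show ?thesis
    unfolding linear_map_def mod_hom_def mod_hom_axioms_def
    using V.vectorspace_axioms W.vectorspace_axioms V.module_axioms W.module_axioms by blast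
qed

lemma rank_plus_kernel_dim:
  fixes A :: "'a::field mat"
  assumes A: "A \<in> carrier_mat s N"
  shows "vec_space.rank s A +
    vectorspace.dim class_ring (module_vec TYPE('a) N\<lparr>carrier := {v \<in> carrier_vec N. A *\<^sub>v v = 0\<^sub>v s}\<rparr>) = N"
proof -
  interpret V: vec_space "TYPE('a)" N .
  interpret W: vec_space "TYPE('a)" s .
  interpret T: linear_map class_ring "module_vec TYPE('a) N" "module_vec TYPE('a) s" "\<lambda>v. A *\<^sub>v v"
    by (rule mult_mat_vec_linear_map[OF A])
  have ker: "T.kerT = {v \<in> carrier_vec N. A *\<^sub>v v = 0\<^sub>v s}"
    by (auto simp: T.ker_def module_vec_simps)
  have im: "T.imT = W.span (set (cols A))"
    using A by (auto simp: T.im_def W.col_space_eq[unfolded W.col_space_def, OF A] module_vec_simps)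
  show ?thesis
    using T.rank_nullity[OF V.fin_dim] unfolding ker im W.rank_def V.dim_is_n .
qed

text \<open>
  The kernel of \<open>A\<close> depends only on a basis of its row space. Replacing \<open>A\<close> by the matrix \<open>B\<close> of such
  a basis therefore leaves the rank unchanged, by rank-nullity, and the rank of \<open>B\<close> is at most the number of
  its rows.
\<close>

lemma rank_le_rank_transpose:
  fixes A :: "'a::field mat"
  assumes A: "A \<in> carrier_mat s N"
  shows "vec_space.rank s A \<le> vec_space.rank N (transpose_mat A)"
proof -
  interpret V: vec_space "TYPE('a)" N .
  let ?S = "set (rows A)"
  have S: "?S \<subseteq> carrier_vec N" using A rows_carrier[of A] by auto
  have "V.lin_indpt {}" by (simp add: V.lin_dep_def)
  then obtain U where fin: "finite U" and U: "maximal U (\<lambda>T. T \<subseteq> ?S \<and> V.lin_indpt T)"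
    using maximal_exists_superset[of ?S "\<lambda>T. T \<subseteq> ?S \<and> V.lin_indpt T" "{}"] by auto
  have US: "U \<subseteq> ?S" and ind: "V.lin_indpt U" using U by (auto simp: maximal_def)
  have UV: "U \<subseteq> carrier_vec N" using US S by blast
  have rankT: "V.rank (transpose_mat A) = card U"
    using V.rank_card_indpt[of "transpose_mat A" s U] A U by (simp add: Matrix.cols_transpose)
  have span: "r \<in> V.span U" if r: "r \<in> ?S" for r
  proof (cases "r \<in> U")
    case True then show ?thesis using V.in_own_span[of U] UV by auto
  next
    case False
    have "\<not> V.lin_indpt (U \<union> {r})"
    proof
      assume "V.lin_indpt (U \<union> {r})"
      then have "U \<union> {r} = U" using U US r unfolding maximal_def by blast
      then show False using False by blast
    qed
    then show ?thesis using V.lin_dep_iff_in_span[of U r] UV ind False S r by auto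
  qed
  obtain bs where bs: "set bs = U" "distinct bs" using finite_distinct_list[OF fin] by blast
  define r where "r = length bs"
  interpret W: vec_space "TYPE('a)" r .
  define B where "B = mat_of_rows N bs"
  have B: "B \<in> carrier_mat r N" by (simp add: B_def r_def)
  have rows_B: "set (rows B) = U" using bs UV by (simp add: B_def)
  have kill: "M *\<^sub>v v = 0\<^sub>v l \<longleftrightarrow> (\<forall>x \<in> set (rows M). x \<bullet> v = 0)"
    if "M \<in> carrier_mat l N" for M :: "'a mat" and l v
    using that by (auto simp: vec_eq_iff rows_def)
  have "x \<bullet> v = 0" if x: "x \<in> ?S" and v: "v \<in> carrier_vec N" "\<forall>u\<in>U. u \<bullet> v = 0" for x v
  proof -
    obtain a where a: "x = V.lincomb a U"
      using V.finite_in_span[OF fin _ span[OF x]] UV by auto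
    have "x \<bullet> v = (\<Sum>u\<in>U. (a u \<cdot>\<^sub>v u) \<bullet> v)"
      unfolding a V.lincomb_def by (rule V.finsum_scalar_prod_sum) (use UV v in auto)
    also have "\<dots> = 0" using v UV by (intro sum.neutral) auto
    finally show ?thesis .
  qed
  then have ker: "{v \<in> carrier_vec N. A *\<^sub>v v = 0\<^sub>v s} = {v \<in> carrier_vec N. B *\<^sub>v v = 0\<^sub>v r}"
    unfolding kill[OF A] kill[OF B] rows_B using US by blast
  have "W.rank B \<le> r"
  proof -
    have c: "set (cols B) \<subseteq> carrier_vec r" using B cols_dim by blast
    have "W.rank B \<le> W.dim"
      unfolding W.rank_def
      by (rule W.subspace_dim[OF W.span_is_subspace W.fin_dim]) (use c W.fin_dim_span_cols[OF B] in auto)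
    then show ?thesis by (simp add: W.dim_is_n)
  qed
  moreover have "vec_space.rank s A = W.rank B"
    using rank_plus_kernel_dim[OF A] rank_plus_kernel_dim[OF B] unfolding ker by linarith
  moreover have "r = card U" using bs by (simp add: r_def distinct_card[symmetric])
  ultimately show ?thesis using rankT by simp
qed

lemma rank_transpose:
  fixes A :: "'a::field mat"
  assumes A: "A \<in> carrier_mat s N"
  shows "vec_space.rank N (transpose_mat A) = vec_space.rank s A"
  using rank_le_rank_transpose[OF A] rank_le_rank_transpose[of "transpose_mat A" N s] A by simp

lemma dim_row_space:
  fixes A :: "'a::field mat"
  assumes A: "A \<in> carrier_mat s N"
  shows "vectorspace.dim class_ring
    (module_vec TYPE('a) N\<lparr>carrier := {transpose_mat A *\<^sub>v y | y. y \<in> carrier_vec s}\<rparr>) = vec_space.rank s A"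
proof -
  interpret V: vec_space "TYPE('a)" N .
  have T: "transpose_mat A \<in> carrier_mat N s" using A by simp
  have "V.span (set (cols (transpose_mat A))) = {transpose_mat A *\<^sub>v y | y. y \<in> carrier_vec s}"
    unfolding V.col_space_eq[unfolded V.col_space_def, OF T] using T A by auto
  then show ?thesis using rank_transpose[OF A] by (simp add: V.rank_def)
qed

text \<open>
  The Jacobian matrices of \<open>I\<close> at a zero point and of the fiber through it differ by zero columns.
\<close>

lemma rank_zero_cols:
  fixes A :: "'a::field mat"
  assumes A: "A \<in> carrier_mat s N" and B: "B \<in> carrier_mat s M"
    and cols: "set (cols B) - {0\<^sub>v s} = set (cols A) - {0\<^sub>v s}"
  shows "vec_space.rank s B = vec_space.rank s A"
proof -
  interpret W: vec_space "TYPE('a)" s .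
  have cA: "set (cols A) \<subseteq> carrier_vec s" and cB: "set (cols B) \<subseteq> carrier_vec s" using A B cols_dim by blast+
  have sub: "W.span X \<subseteq> W.span Y"
    if XY: "X - {0\<^sub>v s} = Y - {0\<^sub>v s}" "X \<subseteq> carrier_vec s" "Y \<subseteq> carrier_vec s" for X Y :: "'a vec set"
  proof (rule W.span_is_subset)
    have s: "subspace class_ring (W.span Y) W.V" using W.span_is_subspace[of Y] XY by simp
    show "submodule class_ring (W.span Y) W.V" using s by (simp add: subspace_def)
    have "0\<^sub>v s \<in> W.span Y" using submodule.zero_closed[of class_ring "W.span Y" W.V] s
      by (simp add: subspace_def)
    moreover have "Y \<subseteq> W.span Y" using W.in_own_span[of Y] XY by simp
    ultimately show "X \<subseteq> W.span Y" using XY(1) by blast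
  qed
  have "W.span (set (cols B)) = W.span (set (cols A))"
    using sub[of "set (cols A)" "set (cols B)"] sub[of "set (cols B)" "set (cols A)"] cA cB cols by blast
  then show ?thesis by (simp add: W.rank_def)
qed

section \<open>Cotangent spaces\<close>

text \<open>
  All operations on \<open>m / m\<^sup>2\<close> are computed on representatives, since the projection \<open>S \<rightarrow> S / m\<^sup>2\<close> is a ring
  homomorphism.
\<close>

lemma cotangent_simps:
  defines "J m S \<equiv> ideal_prod S m m"
  assumes "cring S" "ideal m S" "ring_hom_cring class_ring S \<iota>"
  shows "carrier (cotangent_space \<iota> S m) = (\<lambda>x. J m S +>\<^bsub>S\<^esub> x) ` m"
    "zero (cotangent_space \<iota> S m) = J m S +>\<^bsub>S\<^esub> \<zero>\<^bsub>S\<^esub>"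
    "x \<in> m \<Longrightarrow> y \<in> m \<Longrightarrow>
      (J m S +>\<^bsub>S\<^esub> x) \<oplus>\<^bsub>cotangent_space \<iota> S m\<^esub> (J m S +>\<^bsub>S\<^esub> y) = J m S +>\<^bsub>S\<^esub> (x \<oplus>\<^bsub>S\<^esub> y)"
    "x \<in> m \<Longrightarrow> c \<odot>\<^bsub>cotangent_space \<iota> S m\<^esub> (J m S +>\<^bsub>S\<^esub> x) = J m S +>\<^bsub>S\<^esub> (\<iota> c \<otimes>\<^bsub>S\<^esub> x)"
proof -
  interpret S: cring S by fact
  interpret m: ideal m S by fact
  interpret J: ideal "J m S" S unfolding J_def by (rule S.ideal_prod_is_ideal[OF assms(3,3)])
  interpret h: ring_hom_cring S "S Quot J m S" "(+>\<^bsub>S\<^esub>) (J m S)"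
    by (rule J.rcos_ring_hom_cring[OF assms(2)])
  interpret i: ring_hom_cring class_ring S \<iota> by fact
  have \<iota>: "\<iota> c \<in> carrier S" for c using i.hom_closed[of c] by simp
  show "carrier (cotangent_space \<iota> S m) = (\<lambda>x. J m S +>\<^bsub>S\<^esub> x) ` m"
    by (simp add: cotangent_space_def Let_def J_def)
  show "zero (cotangent_space \<iota> S m) = J m S +>\<^bsub>S\<^esub> \<zero>\<^bsub>S\<^esub>"
    using h.hom_zero by (simp add: cotangent_space_def Let_def J_def)
  show "(J m S +>\<^bsub>S\<^esub> x) \<oplus>\<^bsub>cotangent_space \<iota> S m\<^esub> (J m S +>\<^bsub>S\<^esub> y) = J m S +>\<^bsub>S\<^esub> (x \<oplus>\<^bsub>S\<^esub> y)"
    if "x \<in> m" "y \<in> m" for x y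
    using h.hom_add[of x y] that m.a_subset by (auto simp: cotangent_space_def Let_def J_def)
  show "c \<odot>\<^bsub>cotangent_space \<iota> S m\<^esub> (J m S +>\<^bsub>S\<^esub> x) = J m S +>\<^bsub>S\<^esub> (\<iota> c \<otimes>\<^bsub>S\<^esub> x)"
    if "x \<in> m" for x
    using h.hom_mult[of "\<iota> c" x] that m.a_subset \<iota>[of c] by (auto simp: cotangent_space_def Let_def J_def)
qed

lemma cotangent_vectorspace:
  assumes S: "cring S" and m: "ideal m S" and \<iota>: "ring_hom_cring (class_ring :: 'k::field ring) S \<iota>"
  shows "vectorspace class_ring (cotangent_space \<iota> S m)"
proof -
  interpret S: cring S by fact
  interpret m: ideal m S by fact
  note simps = cotangent_simps[OF S m \<iota>]
  interpret i: ring_hom_cring class_ring S \<iota> by fact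
  have cl: "\<iota> c \<in> carrier S" for c using i.hom_closed[of c] by simp
  have add: "\<iota> (a + b) = \<iota> a \<oplus>\<^bsub>S\<^esub> \<iota> b" and mult: "\<iota> (a * b) = \<iota> a \<otimes>\<^bsub>S\<^esub> \<iota> b" and one: "\<iota> 1 = \<one>\<^bsub>S\<^esub>" for a b
    using i.hom_add[of a b] i.hom_mult[of a b] i.hom_one by simp_all
  have sm: "\<iota> c \<otimes>\<^bsub>S\<^esub> x \<in> m" if "x \<in> m" for c x using m.I_l_closed[OF that cl] .
  have m_S: "x \<in> m \<Longrightarrow> x \<in> carrier S" for x using m.a_subset by blast
  have zero: "\<zero>\<^bsub>S\<^esub> \<in> m" by simp
  show ?thesis
  proof (rule vs_criteria[OF class_field], goal_cases)
    case 1 then show ?case using zero by (simp add: simps)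
  next
    case 3
    have "\<exists>y\<in>m. ideal_prod S m m +>\<^bsub>S\<^esub> (x \<oplus>\<^bsub>S\<^esub> y) = ideal_prod S m m +>\<^bsub>S\<^esub> \<zero>\<^bsub>S\<^esub>" if "x \<in> m" for x
      using that m_S by (intro bexI[of _ "\<ominus>\<^bsub>S\<^esub> x"]) (auto simp: S.r_neg)
    then show ?case by (auto simp: simps)
  next
    case 11
    have "\<iota> a \<otimes>\<^bsub>S\<^esub> (x \<oplus>\<^bsub>S\<^esub> y) = \<iota> a \<otimes>\<^bsub>S\<^esub> x \<oplus>\<^bsub>S\<^esub> \<iota> a \<otimes>\<^bsub>S\<^esub> y"
      if "x \<in> m" "y \<in> m" for a x y
      by (rule S.r_distr) (use that m_S cl in auto)
    then show ?case by (auto simp: simps sm)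
  qed (auto simp: simps add mult one sm m_S cl S.a_ac S.m_assoc S.l_distr)
qed

text \<open>
  A linear map \<open>\<phi> : K\<^sup>N \<rightarrow> m\<close> that becomes surjective in \<open>m / m\<^sup>2\<close> computes the dimension of the cotangent
  space by rank-nullity. For a quotient of a polynomial ring, \<open>\<phi>\<close> sends a vector to the class of the linear form
  with these coefficients; the same \<open>\<phi>\<close> then serves for the localization, so that the two cotangent spaces have
  the same presentation and need not be compared directly.
\<close>

locale cotangent_cover =
  fixes \<iota> :: "'k::field \<Rightarrow> 'a" and S :: "('a, 'b) ring_scheme" and m :: "'a set"
    and N :: nat and \<phi> :: "'k vec \<Rightarrow> 'a"
  assumes S: "cring S" and m: "ideal m S" and \<iota>: "ring_hom_cring class_ring S \<iota>"
    and \<phi>_in: "v \<in> carrier_vec N \<Longrightarrow> \<phi> v \<in> m"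
    and \<phi>_add: "u \<in> carrier_vec N \<Longrightarrow> v \<in> carrier_vec N \<Longrightarrow> \<phi> (u + v) = \<phi> u \<oplus>\<^bsub>S\<^esub> \<phi> v"
    and \<phi>_smult: "v \<in> carrier_vec N \<Longrightarrow> \<phi> (c \<cdot>\<^sub>v v) = \<iota> c \<otimes>\<^bsub>S\<^esub> \<phi> v"
    and \<phi>_surj: "a \<in> m \<Longrightarrow> \<exists>v \<in> carrier_vec N. a \<ominus>\<^bsub>S\<^esub> \<phi> v \<in> ideal_prod S m m"
begin

interpretation S: cring S by (rule S)
interpretation m: ideal m S by (rule m)

lemma J_ideal: "ideal (ideal_prod S m m) S"
  by (rule S.ideal_prod_is_ideal[OF m m])

lemma coset_eq_iff:
  assumes "x \<in> carrier S" "y \<in> carrier S"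
  shows "ideal_prod S m m +>\<^bsub>S\<^esub> x = ideal_prod S m m +>\<^bsub>S\<^esub> y \<longleftrightarrow> x \<ominus>\<^bsub>S\<^esub> y \<in> ideal_prod S m m"
  using S.quotient_eq_iff_same_a_r_cos[OF J_ideal assms] by simp

lemma cot_dim_plus_relations:
  "cot_dim \<iota> S m + vectorspace.dim class_ring
     (module_vec TYPE('k) N\<lparr>carrier := {v \<in> carrier_vec N. \<phi> v \<in> ideal_prod S m m}\<rparr>) = N"
proof -
  let ?C = "cotangent_space \<iota> S m" and ?J = "ideal_prod S m m"
  let ?T = "\<lambda>v. ?J +>\<^bsub>S\<^esub> \<phi> v"
  interpret V: vec_space "TYPE('k)" N .
  interpret C: vectorspace class_ring ?C by (rule cotangent_vectorspace[OF S m \<iota>])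
  note simps = cotangent_simps[OF S m \<iota>]
  have "?T \<in> module_hom class_ring (module_vec TYPE('k) N) ?C"
    unfolding module_hom_def by (auto simp: simps \<phi>_in \<phi>_add \<phi>_smult module_vec_simps)
  then interpret T: linear_map class_ring "module_vec TYPE('k) N" ?C ?T
    unfolding linear_map_def mod_hom_def mod_hom_axioms_def
    using V.vectorspace_axioms C.vectorspace_axioms V.module_axioms C.module_axioms by blast
  have mc: "x \<in> m \<Longrightarrow> x \<in> carrier S" for x using m.a_subset by blast
  have im: "T.imT = carrier ?C"
  proof -
    have "?J +>\<^bsub>S\<^esub> a \<in> ?T ` carrier_vec N" if a: "a \<in> m" for a
      using \<phi>_surj[OF a] coset_eq_iff[OF mc[OF a]] mc \<phi>_in by blast
    then show ?thesis by (auto simp: T.im_def simps module_vec_simps \<phi>_in)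
  qed
  have "?T v = zero ?C \<longleftrightarrow> \<phi> v \<in> ?J" if "v \<in> carrier_vec N" for v
    unfolding simps using coset_eq_iff[of "\<phi> v" "\<zero>\<^bsub>S\<^esub>"] mc[OF \<phi>_in[OF that]] by (simp add: S.minus_eq)
  then have ker: "T.kerT = {v \<in> carrier_vec N. \<phi> v \<in> ?J}"
    by (auto simp: T.ker_def module_vec_simps)
  show ?thesis
    using T.rank_nullity[OF V.fin_dim] unfolding ker im V.dim_is_n cot_dim_def by simp
qed

interpretation J: ideal "ideal_prod S m m" S by (rule J_ideal)
interpretation i: ring_hom_cring class_ring S \<iota> by (rule \<iota>)

text \<open>
  The images of the unit vectors contain a basis. For a set \<open>B\<close> of coordinates that is minimal among those
  whose coordinate subspace still covers \<open>m / m\<^sup>2\<close>, the restriction of \<open>\<phi>\<close> to this subspace is again a cover. Its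
  relations are trivial: a relation that involves a coordinate \<open>b \<in> B\<close> could be used to eliminate \<open>b\<close>.
\<close>

lemma cotangent_basis_subset:
  "\<exists>B\<subseteq>{..<N}. card B = cot_dim \<iota> S m \<and>
    (\<forall>a\<in>m. \<exists>v\<in>carrier_vec N. (\<forall>i<N. i \<notin> B \<longrightarrow> v $ i = 0) \<and> a \<ominus>\<^bsub>S\<^esub> \<phi> v \<in> ideal_prod S m m)"
proof -
  let ?J = "ideal_prod S m m"
  define spans where "spans B \<longleftrightarrow> B \<subseteq> {..<N} \<and>
    (\<forall>a\<in>m. \<exists>v\<in>carrier_vec N. (\<forall>i<N. i \<notin> B \<longrightarrow> v $ i = 0) \<and> a \<ominus>\<^bsub>S\<^esub> \<phi> v \<in> ?J)" for B
  have "spans {..<N}" using \<phi>_surj by (auto simp: spans_def)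
  then obtain B where B: "spans B" and min: "\<And>B'. spans B' \<Longrightarrow> card B \<le> card B'"
    using ex_has_least_nat[of spans "{..<N}" card] by blast
  have BN: "B \<subseteq> {..<N}" and fin: "finite B" using B finite_subset by (auto simp: spans_def)
  define bs where "bs = sorted_list_of_set B"
  define r where "r = card B"
  have bs: "distinct bs" "set bs = B" "length bs = r" using fin by (simp_all add: bs_def r_def)
  interpret V: vec_space "TYPE('k)" r .
  (* E embeds K^r into K^N as the subspace of the coordinates in B. *)
  define E :: "'k mat" where "E = mat N r (\<lambda>(i, j). if bs ! j = i then 1 else 0)"
  have E: "E \<in> carrier_mat N r" by (simp add: E_def)
  have Eu: "E *\<^sub>v u \<in> carrier_vec N" if "u \<in> carrier_vec r" for u using E that by simp
  have E_index: "(E *\<^sub>v u) $ i = (\<Sum>j<r. if bs ! j = i then u $ j else 0)" if "u \<in> carrier_vec r" "i < N" for u i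
    using that by (auto simp: E_def scalar_prod_def row_def lessThan_atLeast0 intro!: sum.cong)
  have E_in: "(E *\<^sub>v u) $ (bs ! j) = u $ j" if "u \<in> carrier_vec r" "j < r" for u j
  proof -
    have "bs ! j \<in> B" using bs(2,3) nth_mem[of j bs] that by simp
    then have "bs ! j < N" using BN by blast
    then have "(E *\<^sub>v u) $ (bs ! j) = (\<Sum>l<r. if l = j then u $ l else 0)"
      unfolding E_index[OF that(1) \<open>bs ! j < N\<close>]
      by (intro sum.cong refl) (use bs that in \<open>auto simp: nth_eq_iff_index_eq\<close>)
    then show ?thesis using that by simp
  qed
  have E_out: "(E *\<^sub>v u) $ i = 0" if "u \<in> carrier_vec r" "i < N" "i \<notin> B" for u i
    unfolding E_index[OF that(1,2)] using bs that by (intro sum.neutral) auto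
  have E_onto: "v = E *\<^sub>v vec r (\<lambda>j. v $ (bs ! j))"
    if v: "v \<in> carrier_vec N" "\<forall>i<N. i \<notin> B \<longrightarrow> v $ i = 0" for v
  proof (rule eq_vecI)
    let ?u = "vec r (\<lambda>j. v $ (bs ! j))"
    show "dim_vec v = dim_vec (E *\<^sub>v ?u)" using v E by simp
    fix i assume "i < dim_vec (E *\<^sub>v ?u)"
    then have i: "i < N" using E by simp
    show "v $ i = (E *\<^sub>v ?u) $ i"
    proof (cases "i \<in> B")
      case True
      then obtain j where "j < r" "i = bs ! j" using bs(2,3) by (auto simp: in_set_conv_nth)
      then show ?thesis using E_in[of ?u j] by simp
    next
      case False then show ?thesis using E_out[of ?u i] v i by simp
    qed
  qed
  interpret C: cotangent_cover \<iota> S m r "\<lambda>u. \<phi> (E *\<^sub>v u)"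
  proof (rule cotangent_cover.intro[OF S m \<iota>])
    fix u v :: "'k vec" and c assume u: "u \<in> carrier_vec r"
    show "\<phi> (E *\<^sub>v u) \<in> m" using \<phi>_in Eu[OF u] .
    show "\<phi> (E *\<^sub>v (c \<cdot>\<^sub>v u)) = \<iota> c \<otimes>\<^bsub>S\<^esub> \<phi> (E *\<^sub>v u)"
      using \<phi>_smult[OF Eu[OF u]] mult_mat_vec[OF E u] by simp
    assume v: "v \<in> carrier_vec r"
    show "\<phi> (E *\<^sub>v (u + v)) = \<phi> (E *\<^sub>v u) \<oplus>\<^bsub>S\<^esub> \<phi> (E *\<^sub>v v)"
      using \<phi>_add[OF Eu[OF u] Eu[OF v]] mult_add_distrib_mat_vec[OF E u v] by simp
  next
    fix a assume "a \<in> m"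
    then obtain v where v: "v \<in> carrier_vec N" "\<forall>i<N. i \<notin> B \<longrightarrow> v $ i = 0" "a \<ominus>\<^bsub>S\<^esub> \<phi> v \<in> ?J"
      using B by (auto simp: spans_def)
    then show "\<exists>u\<in>carrier_vec r. a \<ominus>\<^bsub>S\<^esub> \<phi> (E *\<^sub>v u) \<in> ?J"
      using E_onto[OF v(1,2)] by (intro bexI[of _ "vec r (\<lambda>j. v $ (bs ! j))"]) auto
  qed
  have "{u \<in> carrier_vec r. \<phi> (E *\<^sub>v u) \<in> ?J} = {0\<^sub>v r}"
  proof (intro equalityI subsetI)
    fix u assume "u \<in> {u \<in> carrier_vec r. \<phi> (E *\<^sub>v u) \<in> ?J}"
    then have u: "u \<in> carrier_vec r" "\<phi> (E *\<^sub>v u) \<in> ?J" by auto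
    have "u $ j = 0" if j: "j < r" for j
    proof (rule ccontr)
      assume nz: "u $ j \<noteq> 0"
      let ?b = "bs ! j"
      have b: "?b \<in> B" using bs(2,3) j nth_mem[of j bs] by simp
      have "spans (B - {?b})"
        unfolding spans_def
      proof (intro conjI ballI)
        show "B - {?b} \<subseteq> {..<N}" using BN by blast
        fix a assume a: "a \<in> m"
        then obtain v where v: "v \<in> carrier_vec N" "\<forall>i<N. i \<notin> B \<longrightarrow> v $ i = 0" "a \<ominus>\<^bsub>S\<^esub> \<phi> v \<in> ?J"
          using B by (auto simp: spans_def)
        (* Adding this multiple of the relation E u makes the coordinate b of v vanish. *)
        define c where "c = - (v $ ?b / u $ j)"
        define v' where "v' = v + c \<cdot>\<^sub>v (E *\<^sub>v u)"
        have v': "v' \<in> carrier_vec N" using v Eu[OF u(1)] by (simp add: v'_def)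
        have zero: "v' $ i = 0" if i: "i < N" "i \<notin> B - {?b}" for i
        proof (cases "i = ?b")
          case True
          then show ?thesis using E_in[OF u(1) j] nz v(1) i(1) carrier_matD(1)[OF E] by (simp add: v'_def c_def)
        next
          case False
          then show ?thesis using E_out[OF u(1) i(1)] v(1,2) i carrier_matD(1)[OF E] by (simp add: v'_def)
        qed
        have "\<phi> v' = \<phi> v \<oplus>\<^bsub>S\<^esub> \<iota> c \<otimes>\<^bsub>S\<^esub> \<phi> (E *\<^sub>v u)"
          unfolding v'_def using \<phi>_add[OF v(1), of "c \<cdot>\<^sub>v (E *\<^sub>v u)"] \<phi>_smult[OF Eu[OF u(1)]] Eu[OF u(1)] by simp
        moreover have cl: "\<phi> v \<in> carrier S" "a \<in> carrier S" "\<phi> (E *\<^sub>v u) \<in> carrier S" "\<iota> c \<in> carrier S"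
          using \<phi>_in[OF v(1)] \<phi>_in[OF Eu[OF u(1)]] a m.a_subset i.hom_closed[of c] by auto
        then have "\<iota> c \<otimes>\<^bsub>S\<^esub> \<phi> (E *\<^sub>v u) \<in> carrier S" by simp
        ultimately have "a \<ominus>\<^bsub>S\<^esub> \<phi> v' = (a \<ominus>\<^bsub>S\<^esub> \<phi> v) \<oplus>\<^bsub>S\<^esub> \<ominus>\<^bsub>S\<^esub> (\<iota> c \<otimes>\<^bsub>S\<^esub> \<phi> (E *\<^sub>v u))"
          using cl by (simp add: S.minus_eq S.minus_add S.a_assoc)
        also have "\<dots> \<in> ?J"
          using v(3) J.I_l_closed[OF u(2) cl(4)] by (intro J.a_closed J.a_inv_closed)
        finally show "\<exists>v\<in>carrier_vec N. (\<forall>i<N. i \<notin> B - {?b} \<longrightarrow> v $ i = 0) \<and> a \<ominus>\<^bsub>S\<^esub> \<phi> v \<in> ?J"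
          using v' zero by blast
      qed
      from min[OF this] show False using b fin card_gt_0_iff[of B] by auto
    qed
    then show "u \<in> {0\<^sub>v r}" using u(1) by (auto intro!: eq_vecI)
  next
    fix u :: "'k vec" assume "u \<in> {0\<^sub>v r}"
    then have u: "u = 0 \<cdot>\<^sub>v (0\<^sub>v r)" "u \<in> carrier_vec r" by auto
    have z: "\<iota> 0 = \<zero>\<^bsub>S\<^esub>" using i.hom_zero by simp
    have "\<phi> (E *\<^sub>v u) = \<iota> 0 \<otimes>\<^bsub>S\<^esub> \<phi> (E *\<^sub>v 0\<^sub>v r)"
      unfolding u(1) by (rule C.\<phi>_smult) simp
    also have "\<dots> = \<zero>\<^bsub>S\<^esub>" unfolding z using C.\<phi>_in[of "0\<^sub>v r"] m.a_subset by auto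
    finally show "u \<in> {u \<in> carrier_vec r. \<phi> (E *\<^sub>v u) \<in> ?J}" using u by simp
  qed
  moreover have "V.span {} = {0\<^sub>v r}" using V.span_empty by simp
  ultimately have "cot_dim \<iota> S m = r" using C.cot_dim_plus_relations V.dim_zero_vs by simp
  then show ?thesis using B by (auto simp: spans_def r_def)
qed

end

section \<open>Localization\<close>

text \<open>
  The operations of the localization are unions over all representatives; they are well defined as soon as all
  representatives give the same fraction.
\<close>

lemma UN2_constant:
  assumes X: "z \<in> X" and Y: "y \<in> Y"
    and C: "\<And>a s b t. (a, s) \<in> X \<Longrightarrow> (b, t) \<in> Y \<Longrightarrow> F a s b t = C"
  shows "(\<Union>(a, s)\<in>X. \<Union>(b, t)\<in>Y. F a s b t) = C"
proof -
  have "(\<Union>(a, s)\<in>X. \<Union>(b, t)\<in>Y. F a s b t) = (\<Union>z\<in>X. \<Union>y\<in>Y. C)"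
    by (intro SUP_cong refl) (auto simp: C split: prod.splits)
  also have "\<dots> = C" using X Y by blast
  finally show ?thesis .
qed

locale mult_set = cring R for R (structure) +
  fixes S
  assumes S_sub: "S \<subseteq> carrier R" and S_one: "\<one> \<in> S"
    and S_mult: "s \<in> S \<Longrightarrow> t \<in> S \<Longrightarrow> s \<otimes> t \<in> S"
begin

lemma S_carrier: "s \<in> S \<Longrightarrow> s \<in> carrier R" using S_sub by blast

declare S_one [simp] S_mult [simp]

abbreviation frac where "frac \<equiv> loc_frac R S"
abbreviation L where "L \<equiv> localization R S"

lemma frac_mem:
  "(b, t) \<in> frac a s \<longleftrightarrow> b \<in> carrier R \<and> t \<in> S \<and> (\<exists>u\<in>S. u \<otimes> (t \<otimes> a) = u \<otimes> (s \<otimes> b))"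
  unfolding loc_frac_def by simp

lemma frac_self: "a \<in> carrier R \<Longrightarrow> s \<in> S \<Longrightarrow> (a, s) \<in> frac a s"
  unfolding frac_mem using S_one by blast

lemma frac_subset:
  assumes [simp]: "a \<in> carrier R" "s \<in> S" "b \<in> carrier R" "t \<in> S" "u \<in> S"
    and u: "u \<otimes> (t \<otimes> a) = u \<otimes> (s \<otimes> b)"
  shows "frac a s \<subseteq> frac b t"
proof
  fix z assume "z \<in> frac a s"
  then obtain c r where z: "z = (c, r)" and "(c, r) \<in> frac a s" by (cases z) blast
  then obtain v where [simp]: "c \<in> carrier R" "r \<in> S" "v \<in> S"
    and v: "v \<otimes> (r \<otimes> a) = v \<otimes> (s \<otimes> c)" unfolding frac_mem by blast
  have [simp]: "s \<in> carrier R" "t \<in> carrier R" "u \<in> carrier R" "v \<in> carrier R" "r \<in> carrier R"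
    by (simp_all add: S_carrier)
  have "(u \<otimes> v \<otimes> s) \<otimes> (r \<otimes> b) = (v \<otimes> r) \<otimes> (u \<otimes> (s \<otimes> b))"
    by (simp add: m_ac)
  also have "\<dots> = (v \<otimes> r) \<otimes> (u \<otimes> (t \<otimes> a))" by (simp only: u)
  also have "\<dots> = (u \<otimes> t) \<otimes> (v \<otimes> (r \<otimes> a))" by (simp add: m_ac)
  also have "\<dots> = (u \<otimes> t) \<otimes> (v \<otimes> (s \<otimes> c))" by (simp only: v)
  also have "\<dots> = (u \<otimes> v \<otimes> s) \<otimes> (t \<otimes> c)" by (simp add: m_ac)
  finally have "(u \<otimes> v \<otimes> s) \<otimes> (r \<otimes> b) = (u \<otimes> v \<otimes> s) \<otimes> (t \<otimes> c)" .
  moreover have "u \<otimes> v \<otimes> s \<in> S" by simp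
  ultimately show "z \<in> frac b t" unfolding z frac_mem
    using \<open>c \<in> carrier R\<close> \<open>r \<in> S\<close> by blast
qed

lemma frac_eq_iff:
  assumes a: "a \<in> carrier R" "s \<in> S" and b: "b \<in> carrier R" "t \<in> S"
  shows "frac a s = frac b t \<longleftrightarrow> (\<exists>u\<in>S. u \<otimes> (t \<otimes> a) = u \<otimes> (s \<otimes> b))"
proof
  assume "frac a s = frac b t"
  then have "(b, t) \<in> frac a s" using frac_self[OF b] by simp
  then show "\<exists>u\<in>S. u \<otimes> (t \<otimes> a) = u \<otimes> (s \<otimes> b)" unfolding frac_mem by blast
next
  assume "\<exists>u\<in>S. u \<otimes> (t \<otimes> a) = u \<otimes> (s \<otimes> b)"
  then obtain u where u: "u \<in> S" "u \<otimes> (t \<otimes> a) = u \<otimes> (s \<otimes> b)" by blast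
  show "frac a s = frac b t"
    using frac_subset[OF a b u] frac_subset[OF b a u(1) u(2)[symmetric]] by (rule subset_antisym)
qed

lemma frac_eqI':
  assumes "u \<otimes> (t \<otimes> a) = u \<otimes> (s \<otimes> b)" "u \<in> S"
    "a \<in> carrier R" "s \<in> S" "b \<in> carrier R" "t \<in> S"
  shows "frac a s = frac b t"
  using assms(1,2) frac_eq_iff[OF assms(3-6)] by blast

lemma frac_eqI:
  assumes "a \<in> carrier R" "s \<in> S" "b \<in> carrier R" "t \<in> S" "t \<otimes> a = s \<otimes> b"
  shows "frac a s = frac b t"
  using assms frac_eq_iff[OF assms(1-4)] S_one by auto

lemma L_carrier: "carrier L = {frac a s | a s. a \<in> carrier R \<and> s \<in> S}"
  by (simp add: localization_def)

lemma frac_closed [simp]: "a \<in> carrier R \<Longrightarrow> s \<in> S \<Longrightarrow> frac a s \<in> carrier L"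
  by (auto simp: L_carrier)

lemma L_zero: "\<zero>\<^bsub>L\<^esub> = frac \<zero> \<one>" and L_one: "\<one>\<^bsub>L\<^esub> = frac \<one> \<one>"
  by (simp_all add: localization_def)

lemma L_mult: "X \<otimes>\<^bsub>L\<^esub> Y = (\<Union>(a, s)\<in>X. \<Union>(b, t)\<in>Y. frac (a \<otimes> b) (s \<otimes> t))"
  unfolding localization_def by (simp only: ring.simps monoid.simps)

lemma L_add: "X \<oplus>\<^bsub>L\<^esub> Y = (\<Union>(a, s)\<in>X. \<Union>(b, t)\<in>Y. frac ((t \<otimes> a) \<oplus> (s \<otimes> b)) (s \<otimes> t))"
  unfolding localization_def by (simp only: ring.simps monoid.simps)

lemma frac_mult:
  assumes a: "a \<in> carrier R" "s \<in> S" and b: "b \<in> carrier R" "t \<in> S"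
  shows "frac a s \<otimes>\<^bsub>L\<^esub> frac b t = frac (a \<otimes> b) (s \<otimes> t)"
proof -
  have "frac (a' \<otimes> b') (s' \<otimes> t') = frac (a \<otimes> b) (s \<otimes> t)"
    if a': "(a', s') \<in> frac a s" and b': "(b', t') \<in> frac b t" for a' s' b' t'
  proof -
    obtain u v where uv[simp]: "u \<in> S" "v \<in> S" "a' \<in> carrier R" "s' \<in> S" "b' \<in> carrier R" "t' \<in> S"
      and u: "u \<otimes> (s' \<otimes> a) = u \<otimes> (s \<otimes> a')" and v: "v \<otimes> (t' \<otimes> b) = v \<otimes> (t \<otimes> b')"
      using a' b' unfolding frac_mem by blast
    have [simp]: "s \<in> carrier R" "t \<in> carrier R" "u \<in> carrier R" "v \<in> carrier R" "s' \<in> carrier R" "t' \<in> carrier R"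
      by (simp_all add: S_carrier a b)
    note [simp] = a b
    have "(u \<otimes> v) \<otimes> ((s \<otimes> t) \<otimes> (a' \<otimes> b')) = (u \<otimes> (s \<otimes> a')) \<otimes> (v \<otimes> (t \<otimes> b'))"
      by (simp add: m_ac)
    also have "\<dots> = (u \<otimes> v) \<otimes> ((s' \<otimes> t') \<otimes> (a \<otimes> b))" unfolding u[symmetric] v[symmetric]
      by (simp add: m_ac)
    finally show ?thesis
      by (rule frac_eqI') simp_all
  qed
  from UN2_constant[OF frac_self[OF a] frac_self[OF b] this]
  show ?thesis unfolding L_mult .
qed

lemma frac_add:
  assumes a: "a \<in> carrier R" "s \<in> S" and b: "b \<in> carrier R" "t \<in> S"
  shows "frac a s \<oplus>\<^bsub>L\<^esub> frac b t = frac ((t \<otimes> a) \<oplus> (s \<otimes> b)) (s \<otimes> t)"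
proof -
  have "frac ((t' \<otimes> a') \<oplus> (s' \<otimes> b')) (s' \<otimes> t') = frac ((t \<otimes> a) \<oplus> (s \<otimes> b)) (s \<otimes> t)"
    if a': "(a', s') \<in> frac a s" and b': "(b', t') \<in> frac b t" for a' s' b' t'
  proof -
    obtain u v where uv[simp]: "u \<in> S" "v \<in> S" "a' \<in> carrier R" "s' \<in> S" "b' \<in> carrier R" "t' \<in> S"
      and u: "u \<otimes> (s' \<otimes> a) = u \<otimes> (s \<otimes> a')" and v: "v \<otimes> (t' \<otimes> b) = v \<otimes> (t \<otimes> b')"
      using a' b' unfolding frac_mem by blast
    have [simp]: "s \<in> carrier R" "t \<in> carrier R" "u \<in> carrier R" "v \<in> carrier R" "s' \<in> carrier R" "t' \<in> carrier R"
      by (simp_all add: S_carrier a b)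
    note [simp] = a b
    have "(u \<otimes> v) \<otimes> ((s \<otimes> t) \<otimes> ((t' \<otimes> a') \<oplus> (s' \<otimes> b')))
        = (v \<otimes> t \<otimes> t') \<otimes> (u \<otimes> (s \<otimes> a')) \<oplus> (u \<otimes> s \<otimes> s') \<otimes> (v \<otimes> (t \<otimes> b'))"
      by (simp add: m_ac r_distr)
    also have "\<dots> = (u \<otimes> v) \<otimes> ((s' \<otimes> t') \<otimes> ((t \<otimes> a) \<oplus> (s \<otimes> b)))" unfolding u[symmetric] v[symmetric]
      by (simp add: m_ac r_distr)
    finally show ?thesis
      by (rule frac_eqI') simp_all
  qed
  from UN2_constant[OF frac_self[OF a] frac_self[OF b] this]
  show ?thesis unfolding L_add .
qed

lemma L_elem:
  assumes "x \<in> carrier L"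
  obtains a s where "a \<in> carrier R" "s \<in> S" "s \<in> carrier R" "x = frac a s"
  using assms S_sub unfolding L_carrier by blast

lemma localization_cring: "cring L"
proof (rule cringI)
  show "abelian_group L"
  proof (rule abelian_groupI)
    fix x assume "x \<in> carrier L"
    then obtain a s where [simp]: "a \<in> carrier R" "s \<in> S" "s \<in> carrier R" and x: "x = frac a s" by (rule L_elem)
    show "\<zero>\<^bsub>L\<^esub> \<oplus>\<^bsub>L\<^esub> x = x" by (simp add: x L_zero frac_add)
    have "frac (\<ominus> a) s \<oplus>\<^bsub>L\<^esub> x = \<zero>\<^bsub>L\<^esub>"
      unfolding x L_zero by (simp add: frac_add) (rule frac_eqI, auto simp: r_minus l_neg)
    then show "\<exists>y\<in>carrier L. y \<oplus>\<^bsub>L\<^esub> x = \<zero>\<^bsub>L\<^esub>" by (intro bexI[of _ "frac (\<ominus> a) s"]) auto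
    fix y assume "y \<in> carrier L"
    then obtain b t where [simp]: "b \<in> carrier R" "t \<in> S" "t \<in> carrier R" and y: "y = frac b t" by (rule L_elem)
    show "x \<oplus>\<^bsub>L\<^esub> y \<in> carrier L" by (simp add: x y frac_add)
    show "x \<oplus>\<^bsub>L\<^esub> y = y \<oplus>\<^bsub>L\<^esub> x" by (simp add: x y frac_add a_comm m_comm)
    fix z assume "z \<in> carrier L"
    then obtain c r where [simp]: "c \<in> carrier R" "r \<in> S" "r \<in> carrier R" and z: "z = frac c r" by (rule L_elem)
    show "x \<oplus>\<^bsub>L\<^esub> y \<oplus>\<^bsub>L\<^esub> z = x \<oplus>\<^bsub>L\<^esub> (y \<oplus>\<^bsub>L\<^esub> z)"
      by (simp add: x y z frac_add r_distr m_ac a_ac)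
  qed (simp add: L_zero)
  show "Group.comm_monoid L"
  proof (rule comm_monoidI)
    fix x assume "x \<in> carrier L"
    then obtain a s where [simp]: "a \<in> carrier R" "s \<in> S" "s \<in> carrier R" and x: "x = frac a s" by (rule L_elem)
    show "\<one>\<^bsub>L\<^esub> \<otimes>\<^bsub>L\<^esub> x = x" by (simp add: x L_one frac_mult)
    fix y assume "y \<in> carrier L"
    then obtain b t where [simp]: "b \<in> carrier R" "t \<in> S" "t \<in> carrier R" and y: "y = frac b t" by (rule L_elem)
    show "x \<otimes>\<^bsub>L\<^esub> y \<in> carrier L" by (simp add: x y frac_mult)
    show "x \<otimes>\<^bsub>L\<^esub> y = y \<otimes>\<^bsub>L\<^esub> x" by (simp add: x y frac_mult m_comm)
    fix z assume "z \<in> carrier L"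
    then obtain c r where [simp]: "c \<in> carrier R" "r \<in> S" "r \<in> carrier R" and z: "z = frac c r" by (rule L_elem)
    show "x \<otimes>\<^bsub>L\<^esub> y \<otimes>\<^bsub>L\<^esub> z = x \<otimes>\<^bsub>L\<^esub> (y \<otimes>\<^bsub>L\<^esub> z)"
      by (simp add: x y z frac_mult m_assoc)
  qed (simp add: L_one)
  fix x y z assume "x \<in> carrier L" "y \<in> carrier L" "z \<in> carrier L"
  then obtain a s b t c r where [simp]: "a \<in> carrier R" "s \<in> S" "b \<in> carrier R" "t \<in> S" "c \<in> carrier R" "r \<in> S" "s \<in> carrier R" "t \<in> carrier R" "r \<in> carrier R"
    and x: "x = frac a s" "y = frac b t" "z = frac c r" by (metis L_elem)
  show "(x \<oplus>\<^bsub>L\<^esub> y) \<otimes>\<^bsub>L\<^esub> z = x \<otimes>\<^bsub>L\<^esub> z \<oplus>\<^bsub>L\<^esub> y \<otimes>\<^bsub>L\<^esub> z"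
    unfolding x by (simp add: frac_mult frac_add) (rule frac_eqI, auto simp: l_distr r_distr m_ac)
qed

lemma frac_hom: "ring_hom_cring R L (\<lambda>a. frac a \<one>)"
proof -
  interpret L: cring L by (rule localization_cring)
  show ?thesis
    by unfold_locales (auto simp: Ring.ring_hom_def frac_add frac_mult L_one)
qed

text \<open>
  Fractions \<open>a / s\<close> and \<open>a / 1\<close> differ by a unit. Hence an ideal of the localization is determined by its
  contraction.
\<close>

lemma frac_in_ideal_iff:
  assumes "ideal P L" "a \<in> carrier R" "s \<in> S"
  shows "frac a s \<in> P \<longleftrightarrow> frac a \<one> \<in> P"
proof -
  interpret P: ideal P L by fact
  have 1: "frac a s = frac \<one> s \<otimes>\<^bsub>L\<^esub> frac a \<one>"
    using assms(2,3) S_carrier[OF assms(3)] frac_mult[of \<one> s a \<one>] by simp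
  have "frac s \<one> \<otimes>\<^bsub>L\<^esub> frac a s = frac (s \<otimes> a) (\<one> \<otimes> s)"
    by (rule frac_mult) (use assms(2,3) S_carrier[OF assms(3)] in auto)
  also have "\<dots> = frac a \<one>" by (rule frac_eqI) (use assms(2,3) S_carrier[OF assms(3)] in auto)
  finally have 2: "frac a \<one> = frac s \<one> \<otimes>\<^bsub>L\<^esub> frac a s" ..
  show ?thesis
  proof
    assume "frac a s \<in> P"
    then show "frac a \<one> \<in> P" unfolding 2 by (rule P.I_l_closed) (use assms(3) S_carrier[OF assms(3)] in simp)
  next
    assume "frac a \<one> \<in> P"
    then show "frac a s \<in> P" unfolding 1 by (rule P.I_l_closed) (use assms(3) S_carrier[OF assms(3)] in simp)
  qed
qed

end

section \<open>Krull dimension and ring homomorphisms\<close>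

text \<open>
  Contraction maps chains of primes to chains of primes. Strictness of the inclusions is preserved if, as for
  surjective maps and for localizations, every element of \<open>S\<close> lies in the same ideals as some element of the
  image.
\<close>

lemma krull_dim_le_hom:
  assumes "ring_hom_cring R S h"
    and surj: "\<And>y. y \<in> carrier S \<Longrightarrow> \<exists>x\<in>carrier R. \<forall>P. ideal P S \<longrightarrow> (y \<in> P \<longleftrightarrow> h x \<in> P)"
  shows "krull_dim S \<le> krull_dim R"
proof -
  interpret h: ring_hom_cring R S h by fact
  have hr: "ring_hom_ring R S h" by (rule ring_hom_ringI2[OF h.R.ring_axioms h.S.ring_axioms h.homh])
  have "\<exists>p. (\<forall>i\<le>l. primeideal (p i) R) \<and> (\<forall>i<l. p i \<subset> p (Suc i))"
    if p: "\<forall>i\<le>l. primeideal (p i) S" "\<forall>i<l. p i \<subset> p (Suc i)" for l :: nat and p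
  proof (intro exI conjI allI impI)
    let ?q = "\<lambda>i. {r \<in> carrier R. h r \<in> p i}"
    show "primeideal (?q i) R" if "i \<le> l" for i
      using ring_hom_ring.primeideal_vimage[OF hr h.R.is_cring, of "p i"] p that by blast
    show "?q i \<subset> ?q (Suc i)" if i: "i < l" for i
    proof -
      have id: "ideal (p i) S" "ideal (p (Suc i)) S" using p(1) i by (auto intro: primeideal.axioms(1))
      obtain y where y: "y \<in> p (Suc i)" "y \<notin> p i" using p(2) i by blast
      then have "y \<in> carrier S" using ideal.Icarr[OF id(2)] by blast
      then obtain x where x: "x \<in> carrier R" "\<forall>P. ideal P S \<longrightarrow> (y \<in> P \<longleftrightarrow> h x \<in> P)" using surj by blast
      then have "x \<in> ?q (Suc i)" "x \<notin> ?q i" using y id by auto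
      then show ?thesis using p(2) i by blast
    qed
  qed
  then show ?thesis unfolding krull_dim_def by (intro Sup_subset_mono) auto
qed

lemma krull_dim_quot_le:
  assumes "ring_hom_cring R S h" "h ` carrier R = carrier S"
  shows "krull_dim S \<le> krull_dim R"
proof (rule krull_dim_le_hom[OF assms(1)])
  fix y assume "y \<in> carrier S"
  then obtain x where "x \<in> carrier R" "y = h x" using assms(2) by blast
  then show "\<exists>x\<in>carrier R. \<forall>P. ideal P S \<longrightarrow> (y \<in> P \<longleftrightarrow> h x \<in> P)" by auto
qed

lemma (in mult_set) krull_dim_localization_le: "krull_dim L \<le> krull_dim R"
  
proof (rule krull_dim_le_hom[OF frac_hom])
  fix y assume "y \<in> carrier L"
  then obtain a s where "a \<in> carrier R" "s \<in> S" "y = frac a s" by (rule L_elem)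
  then show "\<exists>x\<in>carrier R. \<forall>P. ideal P L \<longrightarrow> (y \<in> P \<longleftrightarrow> frac x \<one> \<in> P)"
    using frac_in_ideal_iff by blast
qed

lemma (in primeideal) mult_set_complement: "mult_set R (carrier R - I)"
  by unfold_locales (use I_prime I_notcarr one_imp_carrier in auto)

section \<open>Cotangent space of a localization\<close>

text \<open>
  A point with residue field \<open>K\<close>: modulo the prime ideal \<open>p\<close>, every element is a scalar.
\<close>

locale rational_point = cotangent_cover \<iota> R p N \<phi> + primeideal p R
  for \<iota> :: "'k::field \<Rightarrow> 'a" and R :: "('a, 'b) ring_scheme" (structure) and p N \<phi> +
  assumes residue: "r \<in> carrier R \<Longrightarrow> \<exists>c. r \<ominus> \<iota> c \<in> p"
begin

sublocale M: mult_set R "carrier R - p" by (rule mult_set_complement)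

lemma i_hom: "ring_hom_cring class_ring R \<iota>" by (rule \<iota>)

interpretation i: ring_hom_cring class_ring R \<iota> by (rule \<iota>)

interpretation L: cring M.L by (rule M.localization_cring)

interpretation J: ideal "ideal_prod R p p" R by (rule J_ideal)

abbreviation mL where "mL \<equiv> local_max_ideal R p"

lemma mL_def: "mL = {M.frac a s | a s. a \<in> p \<and> s \<in> carrier R - p}"
  by (simp add: local_max_ideal_def)

lemma i_carrier [simp]: "\<iota> c \<in> carrier R" using i.hom_closed[of c] by simp

lemma scalar_inverse: "c \<noteq> 0 \<Longrightarrow> \<iota> (inverse c) \<otimes> \<iota> c = \<one>"
  using i.hom_mult[of "inverse c" c] i.hom_one by simp

lemma frac_mem_mL: 
  assumes "a \<in> carrier R" "s \<in> carrier R - p"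
  shows "M.frac a s \<in> mL \<longleftrightarrow> a \<in> p"
proof
  assume "M.frac a s \<in> mL"
  then obtain b t where b: "b \<in> p" "t \<in> carrier R - p" "M.frac a s = M.frac b t" by (auto simp: mL_def)
  then obtain u where u: "u \<in> carrier R - p" "u \<otimes> (t \<otimes> a) = u \<otimes> (s \<otimes> b)"
    using M.frac_eq_iff[of a s b t] assms a_subset by blast
  have "u \<otimes> (s \<otimes> b) \<in> p" using u(1) b assms by (auto intro!: I_l_closed)
  then have "u \<otimes> (t \<otimes> a) \<in> p" using u by simp
  then show "a \<in> p" using u b assms by (metis DiffD1 DiffD2 I_prime m_closed)
qed (use assms in \<open>auto simp: mL_def\<close>)

lemma p_carrier: "x \<in> p \<Longrightarrow> x \<in> carrier R"
  using a_subset by blast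

lemma mL_elem:
  assumes "x \<in> mL"
  obtains a s where "x = M.frac a s" "a \<in> p" "a \<in> carrier R" "s \<in> carrier R - p"
  using assms p_carrier unfolding mL_def by blast

lemma frac_in_mL: "a \<in> p \<Longrightarrow> s \<in> carrier R - p \<Longrightarrow> M.frac a s \<in> mL"
  unfolding mL_def by blast

lemma mL_ideal: "ideal mL M.L"
proof (rule idealI)
  show "Ring.ring M.L" by (rule L.ring_axioms)
  show "subgroup mL (add_monoid M.L)"
  proof (rule L.add.subgroupI)
    show "mL \<subseteq> carrier M.L"
    proof
      fix x assume "x \<in> mL"
      then show "x \<in> carrier M.L" by (rule mL_elem) (simp only: M.frac_closed)
    qed
    show "mL \<noteq> {}" using frac_in_mL[of \<zero> \<one>] M.S_one by auto
  next
    fix x assume "x \<in> mL"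
    then obtain a s where x: "x = M.frac a s" "a \<in> p" "a \<in> carrier R" "s \<in> carrier R - p" by (rule mL_elem)
    have "M.frac (\<ominus> a) s \<oplus>\<^bsub>M.L\<^esub> x = M.frac (s \<otimes> \<ominus> a \<oplus> s \<otimes> a) (s \<otimes> s)"
      unfolding x(1) by (rule M.frac_add) (use x in auto)
    also have "\<dots> = \<zero>\<^bsub>M.L\<^esub>"
      unfolding M.L_zero by (rule M.frac_eqI) (use x M.S_one M.S_mult[of s s] in \<open>auto simp: r_minus l_neg\<close>)
    finally have "\<ominus>\<^bsub>M.L\<^esub> x = M.frac (\<ominus> a) s"
      using x M.frac_closed by (intro L.minus_equality) auto
    then show "\<ominus>\<^bsub>M.L\<^esub> x \<in> mL"
      using x frac_in_mL[of "\<ominus> a" s] by auto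
  next
    fix x y assume "x \<in> mL" "y \<in> mL"
    then obtain a s b t where x: "x = M.frac a s" "a \<in> p" "a \<in> carrier R" "s \<in> carrier R - p"
      "y = M.frac b t" "b \<in> p" "b \<in> carrier R" "t \<in> carrier R - p" by (metis mL_elem)
    have "(t \<otimes> a) \<oplus> (s \<otimes> b) \<in> p" using x I_l_closed by auto
    moreover have "x \<oplus>\<^bsub>M.L\<^esub> y = M.frac ((t \<otimes> a) \<oplus> (s \<otimes> b)) (s \<otimes> t)"
      unfolding x(1,5) by (rule M.frac_add) (use x in auto)
    ultimately show "x \<oplus>\<^bsub>M.L\<^esub> y \<in> mL"
      using frac_in_mL M.S_mult x by simp
  qed
next
  fix x y assume "x \<in> mL" "y \<in> carrier M.L"
  then obtain a s b t where x: "x = M.frac a s" "a \<in> p" "s \<in> carrier R - p"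
    "y = M.frac b t" "b \<in> carrier R" "t \<in> carrier R - p" by (auto simp: mL_def M.L_carrier)
  have 1: "b \<otimes> a \<in> p" using x I_l_closed by auto
  show 2: "y \<otimes>\<^bsub>M.L\<^esub> x \<in> mL"
    using x 1 a_subset M.S_mult[of t s] by (auto simp: M.frac_mult frac_mem_mL subset_iff)
  show "x \<otimes>\<^bsub>M.L\<^esub> y \<in> mL"
    using 2 x a_subset L.m_comm[of x y] by (auto simp: subset_iff)
qed

lemma mL_square:
  assumes "x \<in> ideal_prod M.L mL mL"
  shows "\<exists>a\<in>ideal_prod R p p. \<exists>s\<in>carrier R - p. x = M.frac a s"
  using assms
proof (induction rule: ideal_prod.induct)
  case (prod i j)
  then obtain a s b t where x: "i = M.frac a s" "a \<in> p" "s \<in> carrier R - p"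
      "j = M.frac b t" "b \<in> p" "t \<in> carrier R - p" by (auto simp: mL_def)
  then have "i \<otimes>\<^bsub>M.L\<^esub> j = M.frac (a \<otimes> b) (s \<otimes> t)" using a_subset by (subst x, subst x, intro M.frac_mult) auto
  then show ?case using ideal_prod.prod[of a p b p R] x M.S_mult[of s t] by blast
next
  case (sum x y)
  then obtain a s b t where x: "x = M.frac a s" "a \<in> ideal_prod R p p" "s \<in> carrier R - p"
      "y = M.frac b t" "b \<in> ideal_prod R p p" "t \<in> carrier R - p" by blast
  then have "x \<oplus>\<^bsub>M.L\<^esub> y = M.frac ((t \<otimes> a) \<oplus> (s \<otimes> b)) (s \<otimes> t)"
    using J.a_subset by (subst x, subst x, intro M.frac_add) auto
  moreover have "(t \<otimes> a) \<oplus> (s \<otimes> b) \<in> ideal_prod R p p" using x J.I_l_closed by auto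
  ultimately show ?case using x M.S_mult[of s t] by blast
qed

text \<open>
  If \<open>u\<close> is congruent to the scalar \<open>c\<close> modulo \<open>p\<close>, then \<open>u a\<close> and \<open>c a\<close> are congruent modulo \<open>p\<^sup>2\<close>, and \<open>c\<close> is
  invertible. So elements outside \<open>p\<close> can be cancelled modulo \<open>p\<^sup>2\<close>.
\<close>

lemma p_square_saturated:
  assumes a: "a \<in> p" and u: "u \<in> carrier R - p" and ua: "u \<otimes> a \<in> ideal_prod R p p"
  shows "a \<in> ideal_prod R p p"
proof -
  have ac: "a \<in> carrier R" using a a_subset by blast
  obtain c where c: "u \<ominus> \<iota> c \<in> p" using residue[of u] u by blast
  have "c \<noteq> 0" using c u i.hom_zero by (auto simp: minus_eq)
  have "(u \<ominus> \<iota> c) \<otimes> a \<in> ideal_prod R p p" using ideal_prod.prod[OF c a] .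
  moreover have "\<iota> c \<otimes> a = u \<otimes> a \<ominus> (u \<ominus> \<iota> c) \<otimes> a" using u ac
    by (simp add: minus_eq l_distr l_minus minus_add minus_minus a_assoc[symmetric] r_neg)
  moreover have "x \<ominus> y \<in> ideal_prod R p p" if "x \<in> ideal_prod R p p" "y \<in> ideal_prod R p p" for x y
    unfolding minus_eq using that by auto
  ultimately have "\<iota> c \<otimes> a \<in> ideal_prod R p p" using ua by auto
  then have "\<iota> (inverse c) \<otimes> (\<iota> c \<otimes> a) \<in> ideal_prod R p p" by (rule J.I_l_closed) simp
  then show ?thesis using scalar_inverse[OF \<open>c \<noteq> 0\<close>] ac by (simp add: m_assoc[symmetric])
qed

lemma frac_mem_mL_square:
  assumes "a \<in> p"
  shows "M.frac a \<one> \<in> ideal_prod M.L mL mL \<longleftrightarrow> a \<in> ideal_prod R p p"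
proof
  have ac: "a \<in> carrier R" using assms a_subset by blast
  assume "M.frac a \<one> \<in> ideal_prod M.L mL mL"
  then obtain b s where b: "b \<in> ideal_prod R p p" "s \<in> carrier R - p" "M.frac a \<one> = M.frac b s"
    using mL_square by blast
  then obtain u where u: "u \<in> carrier R - p" "u \<otimes> (s \<otimes> a) = u \<otimes> (\<one> \<otimes> b)"
    using M.frac_eq_iff[of a \<one> b s] ac M.S_one J.a_subset by blast
  have "u \<otimes> b \<in> ideal_prod R p p" using b u by (intro J.I_l_closed) auto
  then have "(u \<otimes> s) \<otimes> a \<in> ideal_prod R p p" using u b ac J.a_subset by (auto simp: m_assoc)
  then show "a \<in> ideal_prod R p p" using p_square_saturated[OF assms, of "u \<otimes> s"] u b M.S_mult by blast
next
  assume "a \<in> ideal_prod R p p"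
  then show "M.frac a \<one> \<in> ideal_prod M.L mL mL"
  proof (induction rule: ideal_prod.induct)
    case (prod x y)
    then have "M.frac (x \<otimes> y) \<one> = M.frac x \<one> \<otimes>\<^bsub>M.L\<^esub> M.frac y \<one>"
      using a_subset M.S_one by (subst M.frac_mult) auto
    moreover have "M.frac x \<one> \<in> mL" "M.frac y \<one> \<in> mL" using prod M.S_one by (auto simp: mL_def)
    ultimately show ?case using ideal_prod.prod by metis
  next
    case (sum x y)
    then have "M.frac (x \<oplus> y) \<one> = M.frac x \<one> \<oplus>\<^bsub>M.L\<^esub> M.frac y \<one>"
      using J.a_subset M.S_one by (subst M.frac_add) auto
    then show ?case using ideal_prod.sum sum by metis
  qed
qed

text \<open>
  Every \<open>a / s\<close> in the maximal ideal is congruent to \<open>b = a / c\<close> modulo its square, where \<open>c\<close> is the scalar to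
  which \<open>s\<close> is congruent. So the fractions with denominator \<open>1\<close> already cover the cotangent space.
\<close>

lemma cotangent_cover_local:
  "cotangent_cover (local_scalar \<iota> R p) (local_ring_at R p) mL N (\<lambda>v. M.frac (\<phi> v) \<one>)"
proof -
  have pc: "x \<in> p \<Longrightarrow> x \<in> carrier R" for x using a_subset by blast
  interpret f: ring_hom_cring R M.L "\<lambda>a. M.frac a \<one>" by (rule M.frac_hom)
  interpret mL: ideal mL M.L by (rule mL_ideal)
  have f1: "M.frac (x \<oplus> y) \<one> = M.frac x \<one> \<oplus>\<^bsub>M.L\<^esub> M.frac y \<one>"
    and f2: "M.frac (x \<otimes> y) \<one> = M.frac x \<one> \<otimes>\<^bsub>M.L\<^esub> M.frac y \<one>"
    if "x \<in> carrier R" "y \<in> carrier R" for x y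
    using f.hom_add[OF that] f.hom_mult[OF that] .
  have "local_scalar \<iota> R p \<in> Ring.ring_hom class_ring M.L"
  proof (rule ring_hom_memI)
    fix a b :: 'k
    show "local_scalar \<iota> R p a \<in> carrier M.L" using M.S_one by (simp add: local_scalar_def)
    show "local_scalar \<iota> R p (a \<otimes>\<^bsub>class_ring\<^esub> b) = local_scalar \<iota> R p a \<otimes>\<^bsub>M.L\<^esub> local_scalar \<iota> R p b"
      using i.hom_mult[of a b] f2 by (simp add: local_scalar_def)
    show "local_scalar \<iota> R p (a \<oplus>\<^bsub>class_ring\<^esub> b) = local_scalar \<iota> R p a \<oplus>\<^bsub>M.L\<^esub> local_scalar \<iota> R p b"
      using i.hom_add[of a b] f1 by (simp add: local_scalar_def)
    show "local_scalar \<iota> R p \<one>\<^bsub>class_ring\<^esub> = \<one>\<^bsub>M.L\<^esub>"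
      unfolding local_scalar_def M.L_one i.hom_one ..
  qed
  then have i': "ring_hom_cring class_ring M.L (local_scalar \<iota> R p)"
    by (intro ring_hom_cring.intro[OF ring_hom_cring.axioms(1)[OF i_hom] L.cring_axioms]
        ring_hom_cring_axioms.intro) 
  have surj: "\<exists>v\<in>carrier_vec N. x \<ominus>\<^bsub>M.L\<^esub> M.frac (\<phi> v) \<one> \<in> ideal_prod M.L mL mL" if x: "x \<in> mL" for x
  proof -
    obtain a s where as: "x = M.frac a s" "a \<in> p" "s \<in> carrier R - p" using x by (rule mL_elem)
    obtain c where c: "s \<ominus> \<iota> c \<in> p" using residue[of s] as by blast
    have "c \<noteq> 0" using c as(3) i.hom_zero by (auto simp: minus_eq)
    define b where "b = \<iota> (inverse c) \<otimes> a"
    have b: "b \<in> p" using as I_l_closed by (simp add: b_def)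
    obtain v where v: "v \<in> carrier_vec N" "b \<ominus> \<phi> v \<in> ideal_prod R p p" using \<phi>_surj[OF b] by blast
    have ac: "a \<in> carrier R" and bc: "b \<in> carrier R" and vc: "\<phi> v \<in> carrier R" and sc: "s \<in> carrier R"
      and cc: "\<iota> c \<in> carrier R"
      using as b pc \<phi>_in[OF v(1)] by auto
    have "\<iota> c \<otimes> b = (\<iota> (inverse c) \<otimes> \<iota> c) \<otimes> a"
      unfolding b_def using ac by (simp only: m_lcomm[OF cc i_carrier ac] m_assoc[OF i_carrier cc ac])
    then have cb: "\<iota> c \<otimes> b = a" using scalar_inverse[OF \<open>c \<noteq> 0\<close>] ac by simp
    (* The numerator of a / s - \<phi> v; it lies in p^2 because a = c b with s congruent to c
       modulo p and b congruent to \<phi> v modulo p^2. *)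
    define q where "q = a \<ominus> s \<otimes> \<phi> v"
    have "q = \<ominus> ((s \<ominus> \<iota> c) \<otimes> b) \<oplus> s \<otimes> (b \<ominus> \<phi> v)"
      unfolding q_def cb[symmetric] using bc vc sc cc by algebra
    also have "\<dots> \<in> ideal_prod R p p"
      using ideal_prod.prod[OF c b] J.I_l_closed[OF v(2) sc] by auto
    finally have q: "q \<in> ideal_prod R p p" .
    then have qp: "q \<in> p" using ideal_prod_inter[OF is_ideal is_ideal] by blast
    have qc: "q \<in> carrier R" using pc[OF qp] .
    have one: "\<one> \<in> carrier R - p" by (rule M.S_one)
    note closed [simp] = M.frac_closed[OF qc as(3)] M.frac_closed[OF vc one] M.frac_closed[OF qc one]
      M.frac_closed[OF one_closed as(3)]
    have qa: "q \<oplus> s \<otimes> \<phi> v = a" unfolding q_def using ac vc sc by algebra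
    have "M.frac q s \<oplus>\<^bsub>M.L\<^esub> M.frac (\<phi> v) \<one> = M.frac (\<one> \<otimes> q \<oplus> s \<otimes> \<phi> v) (s \<otimes> \<one>)"
      by (rule M.frac_add[OF qc as(3) vc one])
    then have "x = M.frac q s \<oplus>\<^bsub>M.L\<^esub> M.frac (\<phi> v) \<one>"
      using qc sc qa as(1) by simp
    moreover have "(X \<oplus>\<^bsub>M.L\<^esub> Y) \<ominus>\<^bsub>M.L\<^esub> Y = X" if "X \<in> carrier M.L" "Y \<in> carrier M.L" for X Y
      using that by (simp add: L.minus_eq L.a_assoc L.r_neg)
    ultimately have "x \<ominus>\<^bsub>M.L\<^esub> M.frac (\<phi> v) \<one> = M.frac q s"
      using closed(1,2) by (simp only:)
    also have "\<dots> = M.frac \<one> s \<otimes>\<^bsub>M.L\<^esub> M.frac q \<one>"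
      using M.frac_mult[OF one_closed as(3) qc one] qc sc by simp
    also have "\<dots> \<in> ideal_prod M.L mL mL"
      by (rule ideal.I_l_closed[OF L.ideal_prod_is_ideal[OF mL_ideal mL_ideal]])
         (use frac_mem_mL_square[OF qp] q in simp_all)
    finally show ?thesis using v(1) by blast
  qed
  show ?thesis unfolding local_ring_at_def
  proof (rule cotangent_cover.intro)
    show "cring M.L" by (rule L.cring_axioms)
    show "ideal mL M.L" by (rule mL_ideal)
    show "ring_hom_cring class_ring M.L (local_scalar \<iota> R p)" by (rule i')
    fix v :: "'k vec" and c assume v: "v \<in> carrier_vec N"
    show "M.frac (\<phi> v) \<one> \<in> mL" using frac_in_mL[OF \<phi>_in[OF v]] M.S_one by blast
    show "M.frac (\<phi> (c \<cdot>\<^sub>v v)) \<one> = local_scalar \<iota> R p c \<otimes>\<^bsub>M.L\<^esub> M.frac (\<phi> v) \<one>"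
      using f2[of "\<iota> c" "\<phi> v"] \<phi>_smult[OF v] pc[OF \<phi>_in[OF v]] by (simp add: local_scalar_def)
    fix u :: "'k vec" assume u: "u \<in> carrier_vec N"
    show "M.frac (\<phi> (u + v)) \<one> = M.frac (\<phi> u) \<one> \<oplus>\<^bsub>M.L\<^esub> M.frac (\<phi> v) \<one>"
      using f1[of "\<phi> u" "\<phi> v"] \<phi>_add[OF u v] pc[OF \<phi>_in[OF v]] pc[OF \<phi>_in[OF u]] by simp
  qed (rule surj)
qed

text \<open>
  The cotangent spaces of \<open>R\<close> and of its local ring have covers by the same \<open>K\<^sup>N\<close> with the same relations.
\<close>

proposition cot_dim_local: "cot_dim (local_scalar \<iota> R p) (local_ring_at R p) mL = cot_dim \<iota> R p"
proof -
  interpret L: cotangent_cover "local_scalar \<iota> R p" "local_ring_at R p" mL N "\<lambda>v. M.frac (\<phi> v) \<one>"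
    by (rule cotangent_cover_local)
  have eq: "{v \<in> carrier_vec N. M.frac (\<phi> v) \<one> \<in> ideal_prod (local_ring_at R p) mL mL}
      = {v \<in> carrier_vec N. \<phi> v \<in> ideal_prod R p p}"
    using frac_mem_mL_square[OF \<phi>_in] unfolding local_ring_at_def by blast
  show ?thesis
    using L.cot_dim_plus_relations[unfolded eq] cot_dim_plus_relations by linarith
qed

end

section \<open>Ideals of polynomial rings\<close>

lemma carrier_mpoly_ring: "f \<in> carrier (mpoly_ring V) \<longleftrightarrow> mpoly_vars f \<subseteq> V"
  by (simp add: mpoly_ring_def)

lemma mpoly_ring_simps [simp]:
  "f \<otimes>\<^bsub>mpoly_ring V\<^esub> g = f * g" "f \<oplus>\<^bsub>mpoly_ring V\<^esub> g = f + g"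
  "\<zero>\<^bsub>mpoly_ring V\<^esub> = 0" "\<one>\<^bsub>mpoly_ring V\<^esub> = 1"
  by (simp_all add: mpoly_ring_def)

lemma mpoly_ring_closed [simp]:
  "0 \<in> carrier (mpoly_ring V)" "1 \<in> carrier (mpoly_ring V)" "Const a \<in> carrier (mpoly_ring V)"
  "f \<in> carrier (mpoly_ring V) \<Longrightarrow> g \<in> carrier (mpoly_ring V) \<Longrightarrow> f + g \<in> carrier (mpoly_ring V)"
  "f \<in> carrier (mpoly_ring V) \<Longrightarrow> g \<in> carrier (mpoly_ring V) \<Longrightarrow> f * g \<in> carrier (mpoly_ring V)"
  "f \<in> carrier (mpoly_ring V) \<Longrightarrow> - f \<in> carrier (mpoly_ring V)"
  "f \<in> carrier (mpoly_ring V) \<Longrightarrow> g \<in> carrier (mpoly_ring V) \<Longrightarrow> f - g \<in> carrier (mpoly_ring V)"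
  "f \<in> carrier (mpoly_ring V) \<Longrightarrow> f ^ n \<in> carrier (mpoly_ring V)"
  for f g :: "'a::comm_ring_1 mpoly"
proof -
  show c: "Const a \<in> carrier (mpoly_ring V)"
    by (cases "a = 0") (simp_all add: Const_def carrier_mpoly_ring mpoly_vars_single)
  show "0 \<in> carrier (mpoly_ring V)" "1 \<in> carrier (mpoly_ring V)" by (simp_all add: carrier_mpoly_ring)
  assume f: "f \<in> carrier (mpoly_ring V)"
  then show m: "- f \<in> carrier (mpoly_ring V)" by (simp add: carrier_mpoly_ring mpoly_vars_uminus)
  show "f ^ n \<in> carrier (mpoly_ring V)"
    using f by (induction n) (simp_all add: carrier_mpoly_ring mpoly_vars_mult)
  assume "g \<in> carrier (mpoly_ring V)"
  then show "f + g \<in> carrier (mpoly_ring V)" "f * g \<in> carrier (mpoly_ring V)" "f - g \<in> carrier (mpoly_ring V)"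
    using f mpoly_vars_add[of f V "- g"]
    by (simp_all add: carrier_mpoly_ring mpoly_vars_add mpoly_vars_mult mpoly_vars_uminus)
qed

lemma mpoly_ring_sum_closed [simp]:
  fixes f :: "'i \<Rightarrow> 'a::comm_ring_1 mpoly"
  assumes "\<And>i. i \<in> S \<Longrightarrow> f i \<in> carrier (mpoly_ring V)"
  shows "sum f S \<in> carrier (mpoly_ring V)"
  using assms by (induction S rule: infinite_finite_induct) auto

lemma mpoly_ring_a_inv [simp]:
  fixes f :: "'a::comm_ring_1 mpoly"
  assumes "f \<in> carrier (mpoly_ring V)"
  shows "\<ominus>\<^bsub>mpoly_ring V\<^esub> f = - f"
proof -
  interpret cring "mpoly_ring V :: 'a mpoly ring" by (rule mpoly_ring_cring)
  show ?thesis using assms by (intro minus_equality) auto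
qed

lemma mpoly_ring_minus [simp]:
  fixes f :: "'a::comm_ring_1 mpoly"
  assumes "g \<in> carrier (mpoly_ring V)"
  shows "f \<ominus>\<^bsub>mpoly_ring V\<^esub> g = f - g"
  using assms by (simp add: a_minus_def)

lemma mpoly_idealD:
  fixes J :: "'a::comm_ring_1 mpoly set"
  assumes "ideal J (mpoly_ring V)"
  shows "f \<in> J \<Longrightarrow> f \<in> carrier (mpoly_ring V)" "0 \<in> J"
    "f \<in> J \<Longrightarrow> g \<in> J \<Longrightarrow> f + g \<in> J" "f \<in> J \<Longrightarrow> g \<in> J \<Longrightarrow> f - g \<in> J"
    "f \<in> J \<Longrightarrow> h \<in> carrier (mpoly_ring V) \<Longrightarrow> h * f \<in> J"
proof -
  interpret J: ideal J "mpoly_ring V" by fact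
  show c: "f \<in> J \<Longrightarrow> f \<in> carrier (mpoly_ring V)" for f by (rule J.Icarr)
  have sub: "additive_subgroup J (mpoly_ring V)" by (rule ideal.axioms(1)[OF assms])
  show "0 \<in> J" using additive_subgroup.zero_closed[OF sub] by simp
  show add: "f \<in> J \<Longrightarrow> g \<in> J \<Longrightarrow> f + g \<in> J" for f g
    using additive_subgroup.a_closed[OF sub, of f g] by simp
  show mult: "f \<in> J \<Longrightarrow> h \<in> carrier (mpoly_ring V) \<Longrightarrow> h * f \<in> J" for f h
    using J.I_l_closed[of f h] by simp
  show "f \<in> J \<Longrightarrow> g \<in> J \<Longrightarrow> f - g \<in> J"
    using add[of f "- 1 * g"] mult[of g "- 1"] by simp
qed

lemma mpoly_idealI:
  fixes J :: "'a::comm_ring_1 mpoly set"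
  assumes "J \<subseteq> carrier (mpoly_ring V)" "0 \<in> J" "\<And>f g. f \<in> J \<Longrightarrow> g \<in> J \<Longrightarrow> f + g \<in> J"
    "\<And>f h. f \<in> J \<Longrightarrow> h \<in> carrier (mpoly_ring V) \<Longrightarrow> h * f \<in> J"
  shows "ideal J (mpoly_ring V)"
proof -
  interpret cring "mpoly_ring V :: 'a mpoly ring" by (rule mpoly_ring_cring)
  have um: "- f \<in> J" if "f \<in> J" for f using assms(4)[OF that, of "- 1"] by simp
  show ?thesis
  proof (rule idealI)
    show "subgroup J (add_monoid (mpoly_ring V))"
    proof (rule add.subgroupI)
      show "J \<noteq> {}" using assms(2) by blast
      show "\<ominus>\<^bsub>mpoly_ring V\<^esub> f \<in> J" if "f \<in> J" for f
        using um[OF that] that assms(1) mpoly_ring_a_inv[of f V] by auto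
    qed (use assms in auto)
    show "x \<otimes>\<^bsub>mpoly_ring V\<^esub> a \<in> J" if "a \<in> J" "x \<in> carrier (mpoly_ring V)" for a x
      using assms(4)[OF that] by simp
    show "a \<otimes>\<^bsub>mpoly_ring V\<^esub> x \<in> J" if "a \<in> J" "x \<in> carrier (mpoly_ring V)" for a x
      using assms(4)[OF that] by (simp add: mult.commute)
  qed (rule ring_axioms)
qed

lemma mpoly_primeD:
  fixes p :: "'a::comm_ring_1 mpoly set"
  assumes "primeideal p (mpoly_ring V)"
  shows "1 \<notin> p" "f \<in> carrier (mpoly_ring V) \<Longrightarrow> g \<in> carrier (mpoly_ring V) \<Longrightarrow> f * g \<in> p \<Longrightarrow> f \<in> p \<or> g \<in> p"
proof -
  interpret p: primeideal p "mpoly_ring V" by fact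
  show "1 \<notin> p" using p.one_imp_carrier p.I_notcarr by auto
  show "f \<in> carrier (mpoly_ring V) \<Longrightarrow> g \<in> carrier (mpoly_ring V) \<Longrightarrow> f * g \<in> p \<Longrightarrow> f \<in> p \<or> g \<in> p"
    using p.I_prime[of f g] by simp
qed

lemma mpoly_ring_mono: "V \<subseteq> W \<Longrightarrow> carrier (mpoly_ring V) \<subseteq> carrier (mpoly_ring W)"
  by (rule subsetI) (simp add: carrier_mpoly_ring)

lemma mpoly_ring_hom_restrict:
  assumes h: "ring_hom_cring (mpoly_ring W :: 'a::comm_ring_1 mpoly ring) R h" and VW: "V \<subseteq> W"
  shows "ring_hom_cring (mpoly_ring V) R h"
proof -
  interpret h: ring_hom_cring "mpoly_ring W :: 'a mpoly ring" R h by (rule h)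
  have W: "f \<in> carrier (mpoly_ring W)" if "f \<in> carrier (mpoly_ring V)" for f :: "'a mpoly"
    using subsetD[OF mpoly_ring_mono[OF VW] that] .
  have "h \<in> Ring.ring_hom (mpoly_ring V) R"
  proof (rule ring_hom_memI)
    fix f g :: "'a mpoly"
    assume f: "f \<in> carrier (mpoly_ring V)"
    show "h f \<in> carrier R" by (rule h.hom_closed[OF W[OF f]])
    assume g: "g \<in> carrier (mpoly_ring V)"
    show "h (f \<otimes>\<^bsub>mpoly_ring V\<^esub> g) = h f \<otimes>\<^bsub>R\<^esub> h g"
      using h.hom_mult[OF W[OF f] W[OF g]] by (simp only: mpoly_ring_simps)
    show "h (f \<oplus>\<^bsub>mpoly_ring V\<^esub> g) = h f \<oplus>\<^bsub>R\<^esub> h g"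
      using h.hom_add[OF W[OF f] W[OF g]] by (simp only: mpoly_ring_simps)
  next
    show "h \<one>\<^bsub>mpoly_ring V\<^esub> = \<one>\<^bsub>R\<^esub>" using h.hom_one by (simp only: mpoly_ring_simps)
  qed
  then show ?thesis
    by (intro ring_hom_cring.intro ring_hom_cring_axioms.intro mpoly_ring_cring h.S.cring_axioms)
qed

section \<open>Krull dimension of polynomial rings\<close>

text \<open>
  Elimination of one coordinate at a time. The vectors form a family, not a set, because distinct power products
  may be equal as polynomials.
\<close>

lemma linear_dependence:
  fixes v :: "'i \<Rightarrow> 't \<Rightarrow> 'a::field"
  assumes "finite T" "finite A" "card T < card A"
  shows "\<exists>c. (\<exists>\<alpha>\<in>A. c \<alpha> \<noteq> 0) \<and> (\<forall>t\<in>T. (\<Sum>\<alpha>\<in>A. c \<alpha> * v \<alpha> t) = 0)"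
  using assms
proof (induction T arbitrary: A v rule: finite_induct)
  case empty
  then obtain \<alpha> where "\<alpha> \<in> A" by fastforce
  then show ?case by (intro exI[of _ "\<lambda>_. 1"]) auto
next
  case (insert t T)
  show ?case
  proof (cases "\<forall>\<alpha>\<in>A. v \<alpha> t = 0")
    case True
    have "card T < card A" using insert by simp
    from insert.IH[OF insert.prems(1) this, of v] obtain c
      where c: "\<exists>\<alpha>\<in>A. c \<alpha> \<noteq> 0" "\<forall>s\<in>T. (\<Sum>\<alpha>\<in>A. c \<alpha> * v \<alpha> s) = 0" by blast
    then show ?thesis using True by (intro exI[of _ c]) auto
  next
    case False
    then obtain \<beta> where \<beta>: "\<beta> \<in> A" "v \<beta> t \<noteq> 0" by blast
    let ?u = "\<lambda>\<alpha> s. v \<alpha> s - v \<alpha> t / v \<beta> t * v \<beta> s"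
    have "card T < card (A - {\<beta>})" using insert \<beta> by simp
    from insert.IH[OF _ this, of ?u] insert.prems(1) obtain c
      where c: "\<exists>\<alpha>\<in>A - {\<beta>}. c \<alpha> \<noteq> 0" "\<forall>s\<in>T. (\<Sum>\<alpha>\<in>A - {\<beta>}. c \<alpha> * ?u \<alpha> s) = 0" by blast
    define k where "k = (\<Sum>\<alpha>\<in>A - {\<beta>}. c \<alpha> * (v \<alpha> t / v \<beta> t))"
    define d where "d \<alpha> = (if \<alpha> = \<beta> then - k else c \<alpha>)" for \<alpha>
    have sum: "(\<Sum>\<alpha>\<in>A. d \<alpha> * v \<alpha> s) = (\<Sum>\<alpha>\<in>A - {\<beta>}. c \<alpha> * ?u \<alpha> s)" for s
    proof -
      have "(\<Sum>\<alpha>\<in>A. d \<alpha> * v \<alpha> s) = d \<beta> * v \<beta> s + (\<Sum>\<alpha>\<in>A - {\<beta>}. d \<alpha> * v \<alpha> s)"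
        using insert.prems(1) \<beta>(1) by (rule sum.remove)
      also have "(\<Sum>\<alpha>\<in>A - {\<beta>}. d \<alpha> * v \<alpha> s) = (\<Sum>\<alpha>\<in>A - {\<beta>}. c \<alpha> * v \<alpha> s)"
        by (intro sum.cong) (auto simp: d_def)
      finally show ?thesis
        by (simp add: d_def k_def right_diff_distrib sum_subtractf sum_distrib_right mult.assoc)
    qed
    have "(\<Sum>\<alpha>\<in>A - {\<beta>}. c \<alpha> * ?u \<alpha> t) = 0" using \<beta> by (intro sum.neutral) auto
    then have "\<forall>s\<in>insert t T. (\<Sum>\<alpha>\<in>A. d \<alpha> * v \<alpha> s) = 0" using c(2) sum by auto
    moreover have "\<exists>\<alpha>\<in>A. d \<alpha> \<noteq> 0" using c(1) by (auto simp: d_def)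
    ultimately show ?thesis by blast
  qed
qed

text \<open>
  The factors form a list so that the passage from \<open>l\<close> to \<open>l + 1\<close> factors is a structural recursion. In the
  sums below both lists have the same length, so there the last equation serves two empty lists.
\<close>

fun power_product :: "'b::comm_ring_1 list \<Rightarrow> nat list \<Rightarrow> 'b" where
  "power_product (x # xs) (j # e) = x ^ j * power_product xs e"
| "power_product _ _ = 1"

definition exponents :: "nat \<Rightarrow> nat \<Rightarrow> nat list set" where
  "exponents l N = {e. set e \<subseteq> {..<N} \<and> length e = l}"

lemma finite_exponents: "finite (exponents l N)"
  unfolding exponents_def by (rule finite_lists_length_eq) simp

lemma card_exponents: "card (exponents l N) = N ^ l"
  unfolding exponents_def by (subst card_lists_length_eq) simp_all

lemma exponents_0: "exponents 0 N = {[]}"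
  by (auto simp: exponents_def)

lemma sum_exponents_Suc:
  fixes F :: "nat list \<Rightarrow> 'b::comm_monoid_add"
  shows "(\<Sum>e\<in>exponents (Suc l) N. F e) = (\<Sum>j<N. \<Sum>e\<in>exponents l N. F (j # e))"
proof -
  have eq: "exponents (Suc l) N = (\<lambda>(j, e). j # e) ` ({..<N} \<times> exponents l N)"
    by (auto simp: exponents_def length_Suc_conv image_iff)
  have "(\<Sum>e\<in>exponents (Suc l) N. F e) = (\<Sum>(j, e)\<in>{..<N} \<times> exponents l N. F (j # e))"
    unfolding eq by (subst sum.reindex) (auto simp: inj_on_def case_prod_beta intro!: sum.cong)
  then show ?thesis by (simp add: sum.cartesian_product)
qed

lemma power_product_closed:
  fixes xs :: "'a::comm_ring_1 mpoly list"
  assumes "set xs \<subseteq> carrier (mpoly_ring V)"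
  shows "power_product xs e \<in> carrier (mpoly_ring V)"
  using assms by (induction xs e rule: power_product.induct) auto

text \<open>
  Write the given combination as \<open>\<Sum>\<^sub>j x\<^sub>1\<^sup>j q\<^sub>j\<close>, with \<open>q\<^sub>j\<close> a combination of power products of the remaining
  elements, and let \<open>j\<close> be the least index for which \<open>q\<^sub>j\<close> has a nonzero coefficient. As \<open>x\<^sub>1 \<notin> p\<^sub>0\<close>, the factor
  \<open>x\<^sub>1\<^sup>j\<close> can be cancelled modulo \<open>p\<^sub>0\<close>, and as \<open>x\<^sub>1 \<in> p\<^sub>1\<close> this leaves \<open>q\<^sub>j \<in> p\<^sub>1\<close>. By induction along the chain,
  all coefficients of \<open>q\<^sub>j\<close> vanish, a contradiction.
\<close>

lemma prime_chain_independent: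
  fixes p :: "nat \<Rightarrow> 'a::field mpoly set"
  assumes "\<forall>i\<le>length xs. primeideal (p i) (mpoly_ring V)"
    and "\<forall>i<length xs. p i \<subseteq> p (Suc i) \<and> xs ! i \<in> p (Suc i) - p i"
    and "(\<Sum>e\<in>exponents (length xs) N. Const (c e) * power_product xs e) \<in> p 0"
    and "e \<in> exponents (length xs) N"
  shows "c e = 0"
  using assms
proof (induction xs arbitrary: p c e)
  case Nil
  have prime: "primeideal (p 0) (mpoly_ring V)" using Nil by simp
  have "Const (c []) \<in> p 0" using Nil.prems(3) by (simp add: exponents_0)
  then have "Const (inverse (c [])) * Const (c []) \<in> p 0"
    by (rule mpoly_idealD(5)[OF primeideal.axioms(1)[OF prime]]) simp
  then have "c [] \<noteq> 0 \<Longrightarrow> 1 \<in> p 0" by (simp flip: Const.hom_mult)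
  then show ?case using mpoly_primeD(1)[OF prime] Nil.prems(4) by (auto simp: exponents_0)
next
  case (Cons x xs)
  let ?C = "carrier (mpoly_ring V)" and ?l = "length xs"
  have prime: "primeideal (p i) (mpoly_ring V)" if "i \<le> Suc ?l" for i using Cons.prems(1) that by simp
  have ideal: "ideal (p i) (mpoly_ring V)" if "i \<le> Suc ?l" for i
    using primeideal.axioms(1)[OF prime[OF that]] .
  have step: "p i \<subseteq> p (Suc i)" "(x # xs) ! i \<in> p (Suc i)" "(x # xs) ! i \<notin> p i" if "i < Suc ?l" for i
    using Cons.prems(2) that by auto
  have x: "x \<in> p 1" "x \<notin> p 0" "p 0 \<subseteq> p 1" using step[of 0] by simp_all
  have xC: "x \<in> ?C" using mpoly_idealD(1)[OF ideal x(1)] by simp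
  have xsC: "set xs \<subseteq> ?C"
  proof
    fix y assume "y \<in> set xs"
    then obtain i where "i < ?l" "y = (x # xs) ! Suc i" by (auto simp: in_set_conv_nth)
    then show "y \<in> ?C" using step(2)[of "Suc i"] mpoly_idealD(1)[OF ideal[of "Suc (Suc i)"]] by auto
  qed
  define q where "q j = (\<Sum>e\<in>exponents ?l N. Const (c (j # e)) * power_product xs e)" for j
  have qC: "q j \<in> ?C" for j unfolding q_def using power_product_closed[OF xsC] by auto
  have sum_q: "(\<Sum>j<N. x ^ j * q j) \<in> p 0"
    using Cons.prems(3) by (simp add: sum_exponents_Suc q_def sum_distrib_left mult.left_commute)
  have zero: "c (j # e) = 0" if "j < N" "e \<in> exponents ?l N" for j e
    using that
  proof (induction j arbitrary: e rule: less_induct)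
    case (less j)
    have q0: "q i = 0" if "i < j" for i unfolding q_def
      by (intro sum.neutral) (use less.IH[OF that] that less.prems(1) in auto)
    define r where "r = (\<Sum>i\<in>{Suc j..<N}. x ^ (i - Suc j) * q i)"
    have rC: "r \<in> ?C" unfolding r_def using qC xC by auto
    have "(\<Sum>i<N. x ^ i * q i) = (\<Sum>i\<in>{j..<N}. x ^ i * q i)"
      by (rule sum.mono_neutral_right) (use q0 in \<open>auto simp: not_le\<close>)
    also have "\<dots> = x ^ j * q j + (\<Sum>i\<in>{Suc j..<N}. x ^ i * q i)"
      using less.prems(1) by (rule sum.atLeast_Suc_lessThan)
    also have "(\<Sum>i\<in>{Suc j..<N}. x ^ i * q i) = x ^ Suc j * r"
      unfolding r_def sum_distrib_left
    proof (intro sum.cong refl)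
      fix i assume "i \<in> {Suc j..<N}"
      then have "x ^ i = x ^ Suc j * x ^ (i - Suc j)"
        by (simp only: power_add[symmetric] le_add_diff_inverse atLeastLessThan_iff)
      then show "x ^ i * q i = x ^ Suc j * (x ^ (i - Suc j) * q i)" by (simp only: mult.assoc)
    qed
    finally have "x ^ j * (q j + x * r) \<in> p 0" using sum_q by (simp add: algebra_simps)
    moreover have "x ^ j \<notin> p 0"
    proof (induction j)
      case 0 then show ?case using mpoly_primeD(1)[OF prime] by simp
    next
      case (Suc j) then show ?case using mpoly_primeD(2)[OF prime, of 0 x "x ^ j"] x(2) xC by auto
    qed
    ultimately have "q j + x * r \<in> p 0"
      using mpoly_primeD(2)[OF prime, of 0 "x ^ j" "q j + x * r"] xC rC qC by auto
    then have "q j + x * r \<in> p 1" using x(3) by blast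
    moreover have "x * r \<in> p 1" using mpoly_idealD(5)[OF ideal[of 1] x(1) rC] by (simp add: mult.commute)
    ultimately have "q j + x * r - x * r \<in> p 1" by (intro mpoly_idealD(4)[OF ideal[of 1]]) auto
    then have "q j \<in> p (Suc 0)" by simp
    from Cons.IH[where p = "\<lambda>i. p (Suc i)" and c = "\<lambda>e. c (j # e)", OF _ _ this[unfolded q_def] less.prems(2)]
    show ?case using prime step(1)[of "Suc _"] step(2)[of "Suc _"] step(3)[of "Suc _"] by auto
  qed
  obtain j e' where "e = j # e'" "j < N" "e' \<in> exponents ?l N"
    using Cons.prems(4) by (cases e) (auto simp: exponents_def)
  then show ?case using zero by simp
qed

definition exponent_bound :: "nat \<Rightarrow> 'a::zero mpoly \<Rightarrow> bool" where
  "exponent_bound D f \<longleftrightarrow> (\<forall>t\<in>Poly_Mapping.keys f. \<forall>v. Poly_Mapping.lookup t v \<le> D)"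

lemma exponent_bound_mono: "exponent_bound D f \<Longrightarrow> D \<le> D' \<Longrightarrow> exponent_bound D' f"
  unfolding exponent_bound_def using le_trans by blast

lemma exponent_bound_exists: "\<exists>D. exponent_bound D (f :: 'a::zero mpoly)"
proof -
  let ?S = "\<Union>t\<in>Poly_Mapping.keys f. Poly_Mapping.lookup t ` Poly_Mapping.keys t"
  have fin: "finite ?S" by simp
  have "Poly_Mapping.lookup t v \<le> Max (insert 0 ?S)" if "t \<in> Poly_Mapping.keys f" for t v
    using fin that by (cases "v \<in> Poly_Mapping.keys t") (auto intro!: Max_ge simp: in_keys_iff)
  then show ?thesis unfolding exponent_bound_def by blast
qed

lemma exponent_bound_mult:
  fixes f g :: "'a::comm_ring_1 mpoly"
  assumes "exponent_bound D f" "exponent_bound E g"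
  shows "exponent_bound (D + E) (f * g)"
  unfolding exponent_bound_def
proof (intro ballI allI)
  fix t v assume "t \<in> Poly_Mapping.keys (f * g)"
  then obtain a b where "t = a + b" "a \<in> Poly_Mapping.keys f" "b \<in> Poly_Mapping.keys g"
    using keys_mult[of f g] by blast
  then show "Poly_Mapping.lookup t v \<le> D + E"
    using assms unfolding exponent_bound_def by (auto simp: lookup_add intro!: add_mono)
qed

lemma exponent_bound_one: "exponent_bound 0 (1 :: 'a::comm_ring_1 mpoly)"
  by (simp add: exponent_bound_def)

lemma exponent_bound_power:
  fixes f :: "'a::comm_ring_1 mpoly"
  shows "exponent_bound D f \<Longrightarrow> exponent_bound (j * D) (f ^ j)"
  by (induction j) (auto simp: exponent_bound_one exponent_bound_mult)

lemma exponent_bound_power_product: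
  fixes xs :: "'a::comm_ring_1 mpoly list"
  assumes "\<forall>x\<in>set xs. exponent_bound D x" "set e \<subseteq> {..<N}"
  shows "exponent_bound (length xs * (N * D)) (power_product xs e)"
  using assms
proof (induction xs e rule: power_product.induct)
  case (1 x xs j e)
  have "exponent_bound (N * D) (x ^ j)"
    using exponent_bound_mono[OF exponent_bound_power[of D x j], of "N * D"] 1 by simp
  moreover have "exponent_bound (length xs * (N * D)) (power_product xs e)" using 1 by simp
  ultimately show ?case using exponent_bound_mult by fastforce
qed (auto intro: exponent_bound_mono[OF exponent_bound_one])

lemma card_bounded_monomials:
  fixes V :: "pvar set" and M :: nat
  assumes "finite V"
  defines "T \<equiv> {t :: monomial. Poly_Mapping.keys t \<subseteq> V \<and> (\<forall>v. Poly_Mapping.lookup t v \<le> M)}"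
  shows "finite T" "card T \<le> Suc M ^ card V"
proof -
  let ?f = "\<lambda>t :: monomial. restrict (Poly_Mapping.lookup t) V"
  have inj: "inj_on ?f T"
  proof (rule inj_onI)
    fix s t assume st: "s \<in> T" "t \<in> T" "?f s = ?f t"
    show "s = t"
    proof (rule poly_mapping_eqI)
      fix v
      show "Poly_Mapping.lookup s v = Poly_Mapping.lookup t v"
      proof (cases "v \<in> V")
        case True then show ?thesis using fun_cong[OF st(3), of v] by simp
      next
        case False
        then have "v \<notin> Poly_Mapping.keys s" "v \<notin> Poly_Mapping.keys t" using st by (auto simp: T_def)
        then show ?thesis by (simp add: in_keys_iff)
      qed
    qed
  qed
  have sub: "?f ` T \<subseteq> V \<rightarrow>\<^sub>E {..M}" by (auto simp: T_def)
  have fin: "finite (V \<rightarrow>\<^sub>E {..M})" using assms(1) by (intro finite_PiE) auto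
  show "finite T" using finite_imageD[OF finite_subset[OF sub fin] inj] .
  have "card T = card (?f ` T)" using card_image[OF inj] by simp
  also have "\<dots> \<le> card (V \<rightarrow>\<^sub>E {..M})" by (rule card_mono[OF fin sub])
  finally show "card T \<le> Suc M ^ card V" using assms(1) by (simp add: card_PiE)
qed

lemma lookup_Const_mult:
  fixes f :: "'a::comm_ring_1 mpoly"
  shows "Poly_Mapping.lookup (Const a * f) t = a * Poly_Mapping.lookup f t"
  by (induction f rule: mpoly_var_induct[OF subset_UNIV])
     (simp_all add: Const_def mult_single lookup_single when_def distrib_left lookup_add)

text \<open>
  With exponents below \<open>N\<close> there are \<open>N\<close> to the power \<open>card V + 1\<close> power products, but the exponents of the
  monomials in them grow only linearly with \<open>N\<close>, so these monomials number only \<open>O(N\<^sup>c)\<close> with \<open>c = card V\<close>.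
\<close>

lemma algebraic_dependence:
  fixes xs :: "'a::field mpoly list"
  assumes V: "finite V" and xs: "set xs \<subseteq> carrier (mpoly_ring V)" and len: "length xs = Suc (card V)"
  shows "\<exists>N c. (\<exists>e\<in>exponents (length xs) N. c e \<noteq> 0) \<and>
    (\<Sum>e\<in>exponents (length xs) N. Const (c e) * power_product xs e) = 0"
proof -
  let ?l = "length xs" and ?k = "card V"
  obtain b where b: "exponent_bound (b x) x" for x :: "'a mpoly" using exponent_bound_exists by metis
  define D where "D = Max (b ` set xs)"
  have D: "\<forall>x\<in>set xs. exponent_bound D x"
    using exponent_bound_mono[OF b] by (simp add: D_def)
  (* There are at most (l N D + 1)^k \<le> N^k (l D + 1)^k monomials; the last factor must be less than N. *)
  define N where "N = Suc ((?l * D + 1) ^ ?k)"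
  define M where "M = ?l * (N * D)"
  define T where "T = {t :: monomial. Poly_Mapping.keys t \<subseteq> V \<and> (\<forall>v. Poly_Mapping.lookup t v \<le> M)}"
  have "Suc M \<le> N * (?l * D + 1)" by (simp add: M_def N_def algebra_simps)
  then have "Suc M ^ ?k \<le> N ^ ?k * (?l * D + 1) ^ ?k"
    unfolding power_mult_distrib[symmetric] by (rule power_mono) simp
  also have "\<dots> < N ^ ?k * N" by (rule mult_strict_left_mono) (simp_all add: N_def)
  finally have "Suc M ^ ?k < N ^ ?l" using len by (simp add: mult.commute)
  then have card: "card T < card (exponents ?l N)"
    using card_bounded_monomials(2)[OF V, of M] by (simp add: T_def card_exponents)
  have "finite T" using card_bounded_monomials(1)[OF V, of M] by (simp add: T_def)
  from linear_dependence[OF this finite_exponents card, of "\<lambda>e. Poly_Mapping.lookup (power_product xs e)"]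
  obtain c where c: "\<exists>e\<in>exponents ?l N. c e \<noteq> 0"
    and rel: "\<forall>t\<in>T. (\<Sum>e\<in>exponents ?l N. c e * Poly_Mapping.lookup (power_product xs e) t) = 0" by blast
  have "(\<Sum>e\<in>exponents ?l N. Const (c e) * power_product xs e) = 0"
  proof (rule poly_mapping_eqI)
    fix t
    show "Poly_Mapping.lookup (\<Sum>e\<in>exponents ?l N. Const (c e) * power_product xs e) t = Poly_Mapping.lookup 0 t"
    proof (cases "t \<in> T")
      case True then show ?thesis using rel by (simp add: lookup_sum lookup_Const_mult)
    next
      case False
      have "Poly_Mapping.lookup (power_product xs e) t = 0" if "e \<in> exponents ?l N" for e
      proof (rule ccontr)
        assume "Poly_Mapping.lookup (power_product xs e) t \<noteq> 0"
        then have t: "t \<in> Poly_Mapping.keys (power_product xs e)" by (simp add: in_keys_iff)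
        have "Poly_Mapping.keys t \<subseteq> V"
          using power_product_closed[OF xs, of e] t by (auto simp: carrier_mpoly_ring mpoly_vars_def)
        moreover have "\<forall>v. Poly_Mapping.lookup t v \<le> M"
          using exponent_bound_power_product[OF D, of e N] that t
          by (auto simp: exponent_bound_def exponents_def M_def)
        ultimately show False using False by (simp add: T_def)
      qed
      then show ?thesis by (simp add: lookup_sum lookup_Const_mult)
    qed
  qed
  then show ?thesis using c by blast
qed

proposition krull_dim_mpoly_ring_le:
  assumes V: "finite V"
  shows "krull_dim (mpoly_ring V :: 'a::field mpoly ring) \<le> ereal (real (card V))"
  unfolding krull_dim_def
proof (rule Sup_least, clarify)
  fix l and p :: "nat \<Rightarrow> 'a mpoly set"
  assume p: "\<forall>i\<le>l. primeideal (p i) (mpoly_ring V)" "\<forall>i<l. p i \<subset> p (Suc i)"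
  have "l \<le> card V"
  proof (rule ccontr)
    assume "\<not> l \<le> card V"
    then have l: "Suc (card V) \<le> l" by simp
    define f where "f i = (SOME x. x \<in> p (Suc i) - p i)" for i
    have f: "f i \<in> p (Suc i) - p i" if "i < l" for i
      unfolding f_def by (rule someI_ex) (use p(2) that in blast)
    define xs where "xs = map f [0..<Suc (card V)]"
    have len: "length xs = Suc (card V)" by (simp add: xs_def)
    have nth: "xs ! i = f i" if "i < length xs" for i using that by (simp add: xs_def del: upt_Suc)
    have "set xs \<subseteq> carrier (mpoly_ring V)"
    proof
      fix x assume "x \<in> set xs"
      then obtain i where "i < Suc (card V)" "x = f i" by (auto simp: xs_def simp del: upt_Suc)
      then show "x \<in> carrier (mpoly_ring V)"
        using mpoly_idealD(1)[OF primeideal.axioms(1), of "p (Suc i)" V x] f[of i] l p(1) by simp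
    qed
    from algebraic_dependence[OF V this len] obtain N c where
      c: "\<exists>e\<in>exponents (length xs) N. c e \<noteq> 0"
      and rel: "(\<Sum>e\<in>exponents (length xs) N. Const (c e) * power_product xs e) = 0"
      by (elim exE conjE)
    obtain e where e: "e \<in> exponents (length xs) N" "c e \<noteq> 0" using c by (elim bexE)
    have "primeideal (p 0) (mpoly_ring V)" using p(1) by simp
    then have "0 \<in> p 0" by (intro mpoly_idealD(2)[OF primeideal.axioms(1)])
    then have "(\<Sum>e\<in>exponents (length xs) N. Const (c e) * power_product xs e) \<in> p 0" by (simp only: rel)
    moreover have "\<forall>i\<le>length xs. primeideal (p i) (mpoly_ring V)" using p(1) l len by simp
    moreover have "\<forall>i<length xs. p i \<subseteq> p (Suc i) \<and> xs ! i \<in> p (Suc i) - p i"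
    proof (intro allI impI)
      fix i assume i: "i < length xs"
      then have "i < l" using l len by simp
      then show "p i \<subseteq> p (Suc i) \<and> xs ! i \<in> p (Suc i) - p i"
        using f[of i] p(2) unfolding nth[OF i] by blast
    qed
    ultimately have "c e = 0" by (intro prime_chain_independent[OF _ _ _ e(1)])
    then show False using e(2) by simp
  qed
  then show "ereal (real l) \<le> ereal (real (card V))" by simp
qed

section \<open>Cotangent spaces at rational points\<close>

definition point_ideal :: "pvar set \<Rightarrow> (pvar \<Rightarrow> 'a::comm_ring_1) \<Rightarrow> 'a mpoly set" where
  "point_ideal V c = {f \<in> carrier (mpoly_ring V). pt_eval c f = 0}"

lemma point_ideal_ideal: "ideal (point_ideal V c) (mpoly_ring V)"
  by (rule mpoly_idealI) (auto simp: point_ideal_def hom_distribs)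

lemma point_ideal_carrier: "f \<in> point_ideal V c \<Longrightarrow> f \<in> carrier (mpoly_ring V)"
  by (simp add: point_ideal_def)

lemma Var_carrier [simp]: "(Var v :: 'a::comm_ring_1 mpoly) \<in> carrier (mpoly_ring V) \<longleftrightarrow> v \<in> V"
  by (simp add: carrier_mpoly_ring Var_def mpoly_vars_single)

text \<open>
  By the factor theorem in several variables: \<open>f - f(c)\<close> lies in the ideal generated by the \<open>x\<^sub>v - c\<^sub>v\<close>.
\<close>

lemma point_ideal_generated:
  fixes c :: "pvar \<Rightarrow> 'a::comm_ring_1"
  shows "Idl\<^bsub>mpoly_ring V\<^esub> ((\<lambda>v. Var v - Const (c v)) ` V) = point_ideal V c"
proof -
  interpret Q: cring "mpoly_ring V :: 'a mpoly ring" by (rule mpoly_ring_cring)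
  let ?G = "(\<lambda>v. Var v - Const (c v) :: 'a mpoly) ` V" and ?C = "carrier (mpoly_ring V) :: 'a mpoly set"
  have G: "?G \<subseteq> ?C" by auto
  note I = mpoly_idealD[OF Q.genideal_ideal[OF G]]
  have "f - Const (pt_eval c f) \<in> Idl\<^bsub>mpoly_ring V\<^esub> ?G" if "mpoly_vars f \<subseteq> V" for f
    using that
  proof (induction rule: mpoly_algebra_induct)
    case (Var v) then show ?case using Q.genideal_self[OF G] by auto
  next
    case (add f g)
    have eq: "f + g - Const (pt_eval c (f + g)) = (f - Const (pt_eval c f)) + (g - Const (pt_eval c g))"
      by (simp add: hom_distribs)
    show ?case unfolding eq by (rule I(3)[OF add.IH])
  next
    case (mult f g)
    have "f * g - Const (pt_eval c (f * g))
        = g * (f - Const (pt_eval c f)) + Const (pt_eval c f) * (g - Const (pt_eval c g))"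
      by (simp add: hom_distribs algebra_simps)
    moreover have "g \<in> ?C" using mult.hyps by (simp add: carrier_mpoly_ring)
    ultimately show ?case using I(3)[OF I(5)[OF mult.IH(1)] I(5)[OF mult.IH(2)]] by simp
  qed (use I(2) in simp)
  then have "point_ideal V c \<subseteq> Idl\<^bsub>mpoly_ring V\<^esub> ?G"
    by (force simp: point_ideal_def carrier_mpoly_ring)
  moreover have "Idl\<^bsub>mpoly_ring V\<^esub> ?G \<subseteq> point_ideal V c"
    by (rule Q.genideal_minimal[OF point_ideal_ideal]) (auto simp: point_ideal_def hom_distribs)
  ultimately show ?thesis by blast
qed

abbreviation point_ideal_square :: "pvar set \<Rightarrow> (pvar \<Rightarrow> 'a::comm_ring_1) \<Rightarrow> 'a mpoly set" where
  "point_ideal_square V c \<equiv> ideal_prod (mpoly_ring V) (point_ideal V c) (point_ideal V c)"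

lemma point_ideal_square_ideal: "ideal (point_ideal_square V c) (mpoly_ring V)"
proof -
  interpret Q: cring "mpoly_ring V" by (rule mpoly_ring_cring)
  show ?thesis by (rule Q.ideal_prod_is_ideal[OF point_ideal_ideal point_ideal_ideal])
qed

lemma deriv_at_point_ideal_square:
  assumes "f \<in> point_ideal_square V c"
  shows "deriv_at c v f = 0"
  using assms
  by (induction rule: ideal_prod.induct) (auto simp: point_ideal_def deriv_at_mult deriv_at_add)

definition linear_form :: "pvar list \<Rightarrow> (pvar \<Rightarrow> 'a::comm_ring_1) \<Rightarrow> 'a vec \<Rightarrow> 'a mpoly" where
  "linear_form vs c v = (\<Sum>i<length vs. Const (v $ i) * (Var (vs ! i) - Const (c (vs ! i))))"

definition gradient :: "pvar list \<Rightarrow> (pvar \<Rightarrow> 'a::comm_ring_1) \<Rightarrow> 'a mpoly \<Rightarrow> 'a vec" where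
  "gradient vs c f = vec (length vs) (\<lambda>i. deriv_at c (vs ! i) f)"

lemma gradient_carrier [simp]: "gradient vs c f \<in> carrier_vec (length vs)"
  by (simp add: gradient_def)

lemma linear_form_in_point_ideal:
  assumes "set vs \<subseteq> V"
  shows "linear_form vs c v \<in> point_ideal V c"
proof -
  have "linear_form vs c v \<in> carrier (mpoly_ring V)"
    unfolding linear_form_def
  proof (intro mpoly_ring_sum_closed)
    fix i assume "i \<in> {..<length vs}"
    then have "vs ! i \<in> V" using assms nth_mem by blast
    then show "Const (v $ i) * (Var (vs ! i) - Const (c (vs ! i))) \<in> carrier (mpoly_ring V)" by simp
  qed
  then show ?thesis by (simp add: point_ideal_def linear_form_def hom_distribs)
qed

text \<open>
  The first order expansion holds for constants and indeterminates, and it is preserved by sums and products.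
\<close>

lemma taylor_expansion:
  fixes f :: "'a::comm_ring_1 mpoly"
  assumes vs: "distinct vs" "set vs = V" and f: "f \<in> carrier (mpoly_ring V)"
  shows "f - Const (pt_eval c f) - linear_form vs c (gradient vs c f) \<in> point_ideal_square V c"
proof -
  note M = mpoly_idealD[OF point_ideal_ideal[of V c]]
  note M2 = mpoly_idealD[OF point_ideal_square_ideal[of V c]]
  let ?l = "\<lambda>f. linear_form vs c (gradient vs c f)"
  have lf: "?l f = (\<Sum>i<length vs. Const (deriv_at c (vs ! i) f) * (Var (vs ! i) - Const (c (vs ! i))))" for f
    unfolding linear_form_def gradient_def by (intro sum.cong) auto
  have "mpoly_vars f \<subseteq> V" using f by (simp add: carrier_mpoly_ring)
  then show ?thesis
  proof (induction rule: mpoly_algebra_induct)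
    case (Const a) then show ?case using M2(2) by (simp add: lf)
  next
    case (Var v)
    then obtain k where k: "k < length vs" "v = vs ! k" using vs(2) by (auto simp: in_set_conv_nth)
    have "?l (Var v) = (\<Sum>i<length vs. if i = k then Var (vs ! i) - Const (c (vs ! i)) else 0)"
      unfolding lf by (intro sum.cong refl) (use vs(1) k in \<open>auto simp: nth_eq_iff_index_eq\<close>)
    then show ?case using k M2(2) by simp
  next
    case (add f g)
    have "?l (f + g) = ?l f + ?l g"
      unfolding lf sum.distrib[symmetric]
      by (intro sum.cong refl) (simp add: deriv_at_add hom_distribs distrib_right)
    then have eq: "f + g - Const (pt_eval c (f + g)) - ?l (f + g)
        = (f - Const (pt_eval c f) - ?l f) + (g - Const (pt_eval c g) - ?l g)"
      by (simp add: hom_distribs)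
    show ?case unfolding eq by (rule M2(3)[OF add.IH])
  next
    case (mult f g)
    let ?f = "Const (pt_eval c f)" and ?g = "Const (pt_eval c g)"
    have "?l (f * g) = ?f * ?l g + ?g * ?l f"
      unfolding lf sum_distrib_left sum.distrib[symmetric]
      by (intro sum.cong refl) (simp add: deriv_at_mult hom_distribs algebra_simps)
    then have eq: "f * g - Const (pt_eval c (f * g)) - ?l (f * g)
        = (f - ?f) * (g - ?g) + (?f * (g - ?g - ?l g) + ?g * (f - ?f - ?l f))"
      by (simp add: hom_distribs algebra_simps)
    have "f - ?f \<in> point_ideal V c" "g - ?g \<in> point_ideal V c"
      using mult.hyps by (simp_all add: point_ideal_def carrier_mpoly_ring[symmetric] hom_distribs)
    from ideal_prod.prod[OF this, of "mpoly_ring V"] have "(f - ?f) * (g - ?g) \<in> point_ideal_square V c" by simp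
    then show ?case
      unfolding eq by (rule M2(3)[OF _ M2(3)[OF M2(5)[OF mult.IH(2)] M2(5)[OF mult.IH(1)]]]) simp_all
  qed
qed

lemma ideal_prod_hom_image:
  assumes h: "ring_hom_cring R S h" and M: "M \<subseteq> carrier R" "ideal M R"
  shows "ideal_prod S (h ` M) (h ` M) = h ` ideal_prod R M M"
proof -
  interpret h: ring_hom_cring R S h by (rule h)
  interpret J: ideal "ideal_prod R M M" R by (rule h.R.ideal_prod_is_ideal[OF M(2) M(2)])
  show ?thesis
  proof (intro equalityI subsetI)
    fix y assume "y \<in> ideal_prod S (h ` M) (h ` M)"
    then show "y \<in> h ` ideal_prod R M M"
    proof (induction rule: ideal_prod.induct)
      case (prod i j)
      then obtain a b where ab: "a \<in> M" "b \<in> M" "i = h a" "j = h b" by blast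
      have "h (a \<otimes>\<^bsub>R\<^esub> b) = i \<otimes>\<^bsub>S\<^esub> j" using ab M(1) by (simp add: subset_iff)
      moreover have "a \<otimes>\<^bsub>R\<^esub> b \<in> ideal_prod R M M" by (rule ideal_prod.prod[OF ab(1,2)])
      ultimately show ?case by (metis imageI)
    next
      case (sum x y)
      then obtain a b where ab: "a \<in> ideal_prod R M M" "b \<in> ideal_prod R M M" "x = h a" "y = h b" by blast
      have "h (a \<oplus>\<^bsub>R\<^esub> b) = x \<oplus>\<^bsub>S\<^esub> y" using ab J.a_subset by (simp add: subset_iff)
      moreover have "a \<oplus>\<^bsub>R\<^esub> b \<in> ideal_prod R M M" by (rule ideal_prod.sum[OF ab(1,2)])
      ultimately show ?case by (metis imageI)
    qed
  next
    fix y assume "y \<in> h ` ideal_prod R M M"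
    then obtain x where x: "x \<in> ideal_prod R M M" "y = h x" by blast
    from x(1) have "h x \<in> ideal_prod S (h ` M) (h ` M)"
    proof (induction rule: ideal_prod.induct)
      case (prod i j)
      have "h (i \<otimes>\<^bsub>R\<^esub> j) = h i \<otimes>\<^bsub>S\<^esub> h j" using prod M(1) by (simp add: subset_iff)
      then show ?case using ideal_prod.prod[of "h i" "h ` M" "h j" "h ` M" S] prod by simp
    next
      case (sum x y)
      have "h (x \<oplus>\<^bsub>R\<^esub> y) = h x \<oplus>\<^bsub>S\<^esub> h y" using sum J.a_subset by (simp add: subset_iff)
      then show ?case using ideal_prod.sum sum.IH by simp
    qed
    then show "y \<in> ideal_prod S (h ` M) (h ` M)" using x(2) by simp
  qed
qed

text \<open>
  The coordinate ring \<open>Q / J\<close> of an affine scheme through the \<open>K\<close>-rational point \<open>c\<close>. The list \<open>vs\<close> orders the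
  indeterminates, so that gradients are vectors.
\<close>

locale affine_point =
  fixes vs :: "pvar list" and V :: "pvar set" and c :: "pvar \<Rightarrow> 'a::field" and J :: "'a mpoly set"
  assumes distinct: "distinct vs" and set_vs: "set vs = V"
    and J: "ideal J (mpoly_ring V)" and J_sub: "J \<subseteq> point_ideal V c"
begin

abbreviation Q where "Q \<equiv> mpoly_ring V :: 'a mpoly ring"
abbreviation R where "R \<equiv> Q Quot J"
abbreviation cls where "cls \<equiv> (+>\<^bsub>Q\<^esub>) J"
abbreviation M where "M \<equiv> point_ideal V c"
abbreviation scalar where "scalar \<equiv> \<lambda>a. cls (Const a)"

lemma Q_cring: "cring Q" by (rule mpoly_ring_cring)

lemma cls_hom: "ring_hom_cring Q R cls"
  by (rule ideal.rcos_ring_hom_cring[OF J Q_cring])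

interpretation Q: cring Q by (rule Q_cring)
interpretation J: ideal J Q by (rule J)
interpretation cls: ring_hom_cring Q R cls by (rule cls_hom)

lemma cls_eq_iff:
  assumes "f \<in> carrier Q" "g \<in> carrier Q"
  shows "cls f = cls g \<longleftrightarrow> f - g \<in> J"
  using Q.quotient_eq_iff_same_a_r_cos[OF J assms] assms by simp

lemma cls_carrier: "carrier R = cls ` carrier Q"
  by (auto simp: FactRing_def A_RCOSETS_def')

lemma cls_in_M_iff:
  assumes "f \<in> carrier Q"
  shows "cls f \<in> cls ` M \<longleftrightarrow> f \<in> M"
proof
  assume "cls f \<in> cls ` M"
  then obtain g where g: "g \<in> M" "f - g \<in> J"
    using cls_eq_iff[OF assms point_ideal_carrier] by blast
  then have "f - g + g \<in> M" using J_sub mpoly_idealD(3)[OF point_ideal_ideal] by blast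
  then show "f \<in> M" by simp
qed blast

lemma cls_add: "f \<in> carrier Q \<Longrightarrow> g \<in> carrier Q \<Longrightarrow> cls f \<oplus>\<^bsub>R\<^esub> cls g = cls (f + g)"
  using cls.hom_add[of f g] by simp

lemma cls_mult: "f \<in> carrier Q \<Longrightarrow> g \<in> carrier Q \<Longrightarrow> cls f \<otimes>\<^bsub>R\<^esub> cls g = cls (f * g)"
  using cls.hom_mult[of f g] by simp

lemma cls_minus:
  assumes "f \<in> carrier Q" "g \<in> carrier Q"
  shows "cls f \<ominus>\<^bsub>R\<^esub> cls g = cls (f - g)"
proof -
  have "cls (f \<ominus>\<^bsub>Q\<^esub> g) = cls f \<ominus>\<^bsub>R\<^esub> cls g"
    using assms cls.hom_add[of f "\<ominus>\<^bsub>Q\<^esub> g"] cls.hom_a_inv[of g] by (simp only: a_minus_def Q.a_inv_closed)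
  then show ?thesis using assms by simp
qed

lemma max_ideal: "ideal (cls ` M) R"
proof (rule idealI)
  show "Ring.ring R" by (rule cls.S.ring_axioms)
  note MI = mpoly_idealD[OF point_ideal_ideal[of V c]]
  show "subgroup (cls ` M) (add_monoid R)"
  proof (rule cls.S.add.subgroupI)
    show "cls ` M \<subseteq> carrier R" using point_ideal_carrier cls_carrier by blast
    show "cls ` M \<noteq> {}" using MI(2) by blast
    show "\<ominus>\<^bsub>R\<^esub> x \<in> cls ` M" if x: "x \<in> cls ` M" for x
    proof -
      obtain f where f: "f \<in> M" "x = cls f" using x by blast
      have "- f \<in> M" using MI(5)[OF f(1), of "- 1"] by simp
      moreover have "\<ominus>\<^bsub>R\<^esub> x = cls (- f)"
        unfolding f(2) using cls.hom_a_inv[of f] MI(1)[OF f(1)] by simp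
      ultimately show ?thesis by blast
    qed
    show "x \<oplus>\<^bsub>R\<^esub> y \<in> cls ` M" if xy: "x \<in> cls ` M" "y \<in> cls ` M" for x y
    proof -
      obtain f g where "f \<in> M" "x = cls f" "g \<in> M" "y = cls g" using xy by blast
      then show ?thesis using cls_add[OF MI(1) MI(1), of f g] MI(3)[of f g] by auto
    qed
  qed
  fix x y assume "x \<in> cls ` M" "y \<in> carrier R"
  then obtain f g where fg: "f \<in> M" "x = cls f" "g \<in> carrier Q" "y = cls g"
    unfolding cls_carrier by (elim imageE)
  then have 1: "cls (g * f) \<in> cls ` M" using MI(5)[of f g] by blast
  show "y \<otimes>\<^bsub>R\<^esub> x \<in> cls ` M" using 1 cls_mult[OF fg(3) MI(1)[OF fg(1)]] fg by simp
  show "x \<otimes>\<^bsub>R\<^esub> y \<in> cls ` M" using 1 cls_mult[OF MI(1)[OF fg(1)] fg(3)] fg by (simp add: mult.commute)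
qed

lemma square_of_max_ideal: "ideal_prod R (cls ` M) (cls ` M) = cls ` point_ideal_square V c"
  by (rule ideal_prod_hom_image[OF cls_hom _ point_ideal_ideal]) (use point_ideal_carrier in blast)

lemma scalar_hom: "ring_hom_cring class_ring R scalar"
proof (intro ring_hom_cring.intro ring_hom_cring_axioms.intro)
  show "cring (class_ring :: 'a ring)" by (rule fieldE(1)[OF class_field])
  show "cring R" by (rule cls.S.cring_axioms)
  show "scalar \<in> Ring.ring_hom class_ring R"
  proof (rule ring_hom_memI)
    fix a b :: 'a
    show "scalar a \<in> carrier R" using cls.hom_closed[of "Const a"] by simp
    show "scalar (a \<otimes>\<^bsub>class_ring\<^esub> b) = scalar a \<otimes>\<^bsub>R\<^esub> scalar b"
      by (simp add: cls_mult Const.hom_mult)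
    show "scalar (a \<oplus>\<^bsub>class_ring\<^esub> b) = scalar a \<oplus>\<^bsub>R\<^esub> scalar b"
      by (simp add: cls_add Const.hom_add)
    show "scalar \<one>\<^bsub>class_ring\<^esub> = \<one>\<^bsub>R\<^esub>"
      using cls.hom_one by (simp add: Const.hom_one)
  qed
qed

abbreviation lin where "lin v \<equiv> cls (linear_form vs c v)"

lemma linear_form_M: "linear_form vs c v \<in> M"
  using linear_form_in_point_ideal[of vs V c v] set_vs by simp

lemma linear_form_Q: "linear_form vs c v \<in> carrier Q"
  using point_ideal_carrier[OF linear_form_M] .

lemma cover: "cotangent_cover scalar R (cls ` M) (length vs) lin"
proof (rule cotangent_cover.intro[OF cls.S.cring_axioms max_ideal scalar_hom])
  fix u v :: "'a vec" and a assume v: "v \<in> carrier_vec (length vs)"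
  show "lin v \<in> cls ` M" using linear_form_M by blast
  have "linear_form vs c (a \<cdot>\<^sub>v v) = Const a * linear_form vs c v"
    unfolding linear_form_def sum_distrib_left using v
    by (intro sum.cong refl) (simp add: Const.hom_mult mult.assoc)
  then show "lin (a \<cdot>\<^sub>v v) = scalar a \<otimes>\<^bsub>R\<^esub> lin v"
    using cls_mult[of "Const a" "linear_form vs c v"] linear_form_Q by simp
  assume u: "u \<in> carrier_vec (length vs)"
  have "linear_form vs c (u + v) = linear_form vs c u + linear_form vs c v"
    unfolding linear_form_def sum.distrib[symmetric] using u v
    by (intro sum.cong refl) (simp add: Const.hom_add distrib_right)
  then show "lin (u + v) = lin u \<oplus>\<^bsub>R\<^esub> lin v"
    using cls_add[OF linear_form_Q linear_form_Q] by simp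
next
  fix x assume "x \<in> cls ` M"
  then obtain f where f: "f \<in> M" "x = cls f" by blast
  have fQ: "f \<in> carrier Q" and f0: "pt_eval c f = 0" using f(1) by (simp_all add: point_ideal_def)
  have "f - linear_form vs c (gradient vs c f) \<in> point_ideal_square V c"
    using taylor_expansion[OF distinct set_vs fQ, of c] f0 by simp
  then have "x \<ominus>\<^bsub>R\<^esub> lin (gradient vs c f) \<in> ideal_prod R (cls ` M) (cls ` M)"
    unfolding square_of_max_ideal f(2) cls_minus[OF fQ linear_form_Q] by blast
  then show "\<exists>v\<in>carrier_vec (length vs). x \<ominus>\<^bsub>R\<^esub> lin v \<in> ideal_prod R (cls ` M) (cls ` M)"
    by (rule bexI) (rule gradient_carrier)
qed

lemma cls_elem:
  assumes "x \<in> carrier R"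
  obtains f where "f \<in> carrier Q" "x = cls f"
  using assms unfolding cls_carrier by (rule imageE)

lemma rational: "rational_point scalar R (cls ` M) (length vs) lin"
proof (intro rational_point.intro rational_point_axioms.intro)
  show "cotangent_cover scalar R (cls ` M) (length vs) lin" by (rule cover)
  show "primeideal (cls ` M) R"
  proof (rule primeidealI[OF max_ideal cls.S.cring_axioms])
    have "1 \<notin> M" by (simp add: point_ideal_def)
    then have 1: "cls 1 \<notin> cls ` M" using cls_in_M_iff[of 1] by simp
    have 2: "cls 1 \<in> carrier R" by (rule cls.hom_closed) simp
    show "carrier R \<noteq> cls ` M"
    proof
      assume "carrier R = cls ` M"
      from 2[unfolded this] 1 show False by (rule notE[rotated])
    qed
    fix x y assume x: "x \<in> carrier R" and y: "y \<in> carrier R" and xy: "x \<otimes>\<^bsub>R\<^esub> y \<in> cls ` M"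
    obtain f where f: "f \<in> carrier Q" "x = cls f" using x by (rule cls_elem)
    obtain g where g: "g \<in> carrier Q" "y = cls g" using y by (rule cls_elem)
    note fg = f g
    have "cls (f * g) \<in> cls ` M" using xy unfolding fg(2,4) cls_mult[OF fg(1,3)] .
    then have "f * g \<in> M" using cls_in_M_iff[of "f * g"] fg by simp
    then have "f \<in> M \<or> g \<in> M" using fg by (simp add: point_ideal_def hom_distribs)
    then show "x \<in> cls ` M \<or> y \<in> cls ` M" using fg by blast
  qed
  fix x assume "x \<in> carrier R"
  then obtain f where f: "f \<in> carrier Q" "x = cls f" by (rule cls_elem)
  have "f - Const (pt_eval c f) \<in> M" using f by (simp add: point_ideal_def hom_distribs)
  then show "\<exists>a. x \<ominus>\<^bsub>R\<^esub> scalar a \<in> cls ` M"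
    using cls_minus[OF f(1), of "Const (pt_eval c f)"] f(2) by auto
qed

text \<open>
  A linear form lies in \<open>M\<^sup>2 + J\<close> if and only if it is the linear part of an element of \<open>J\<close>; and the linear part
  is given by the gradient.
\<close>

lemma relations_eq_gradients:
  "{v \<in> carrier_vec (length vs). lin v \<in> ideal_prod R (cls ` M) (cls ` M)} = gradient vs c ` J"
proof (intro equalityI subsetI)
  fix v assume "v \<in> {v \<in> carrier_vec (length vs). lin v \<in> ideal_prod R (cls ` M) (cls ` M)}"
  then have v: "v \<in> carrier_vec (length vs)" "lin v \<in> cls ` point_ideal_square V c"
    unfolding square_of_max_ideal by auto
  then obtain r where r: "r \<in> point_ideal_square V c" "lin v = cls r" by blast
  have rQ: "r \<in> carrier Q" using mpoly_idealD(1)[OF point_ideal_square_ideal r(1)] .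
  have J: "linear_form vs c v - r \<in> J" using r(2) cls_eq_iff[OF linear_form_Q rQ] by simp
  have "gradient vs c (linear_form vs c v - r) = v"
  proof (rule eq_vecI)
    fix k assume k: "k < dim_vec v"
    then have k': "k < length vs" using v by simp
    have "deriv_at c (vs ! k) (linear_form vs c v) = (\<Sum>i<length vs. if i = k then v $ i else 0)"
      unfolding linear_form_def deriv_at_sum
      by (intro sum.cong refl) (use distinct k' in \<open>auto simp: deriv_at_mult deriv_at_diff nth_eq_iff_index_eq\<close>)
    then show "gradient vs c (linear_form vs c v - r) $ k = v $ k"
      using k' deriv_at_point_ideal_square[OF r(1)] by (simp add: gradient_def deriv_at_diff)
  qed (use v in \<open>simp add: gradient_def\<close>)
  then show "v \<in> gradient vs c ` J" using J by (metis imageI)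
next
  fix v assume "v \<in> gradient vs c ` J"
  then obtain f where f: "f \<in> J" "v = gradient vs c f" by blast
  have fQ: "f \<in> carrier Q" using mpoly_idealD(1)[OF J f(1)] .
  have "pt_eval c f = 0" using f(1) J_sub by (auto simp: point_ideal_def)
  then have t: "f - linear_form vs c v \<in> point_ideal_square V c"
    using taylor_expansion[OF distinct set_vs fQ, of c] f(2) by simp
  have "(- 1) * (f - linear_form vs c v) \<in> point_ideal_square V c"
    using mpoly_idealD(5)[OF point_ideal_square_ideal t, of "- 1"] by simp
  then have r: "linear_form vs c v - f \<in> point_ideal_square V c" by simp
  have "lin v = cls (linear_form vs c v - f)"
    using cls_eq_iff[OF linear_form_Q, of "linear_form vs c v - f"] f(1) fQ linear_form_Q by simp
  then have "lin v \<in> cls ` point_ideal_square V c" using r by blast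
  then show "v \<in> {v \<in> carrier_vec (length vs). lin v \<in> ideal_prod R (cls ` M) (cls ` M)}"
    unfolding square_of_max_ideal using f(2) by simp
qed

proposition cot_dim_plus_gradients:
  "cot_dim scalar R (cls ` M) +
     vectorspace.dim class_ring (module_vec TYPE('a) (length vs)\<lparr>carrier := gradient vs c ` J\<rparr>) = length vs"
  using cotangent_cover.cot_dim_plus_relations[OF cover] unfolding relations_eq_gradients .

proposition cot_dim_local_eq:
  "cot_dim (local_scalar scalar R (cls ` M)) (local_ring_at R (cls ` M)) (local_max_ideal R (cls ` M))
    = cot_dim scalar R (cls ` M)"
  by (rule rational_point.cot_dim_local[OF rational])

proposition krull_dim_local_le: "krull_dim (local_ring_at R (cls ` M)) \<le> krull_dim R"
proof -
  interpret p: rational_point scalar R "cls ` M" "length vs" lin by (rule rational)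
  show ?thesis unfolding local_ring_at_def by (rule p.M.krull_dim_localization_le)
qed

end

text \<open>
  At a common zero \<open>c\<close> of the generators, the gradient of \<open>\<Sum>\<^sub>i h\<^sub>i g\<^sub>i\<close> is \<open>\<Sum>\<^sub>i h\<^sub>i(c) \<nabla>g\<^sub>i(c)\<close>, because the terms
  that contain derivatives of the \<open>h\<^sub>i\<close> carry a factor \<open>g\<^sub>i(c) = 0\<close>.
\<close>

lemma gradients_row_space:
  fixes G :: "'a::field mpoly list" and us :: "pvar list" and c :: "pvar \<Rightarrow> 'a"
  assumes J: "J = Idl\<^bsub>mpoly_ring V\<^esub> (set G)" and G: "set G \<subseteq> point_ideal V c"
  defines "A \<equiv> mat (length G) (length us) (\<lambda>(i, j). deriv_at c (us ! j) (G ! i))"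
  shows "gradient us c ` J = {transpose_mat A *\<^sub>v y | y. y \<in> carrier_vec (length G)}"
proof -
  interpret Q: cring "mpoly_ring V :: 'a mpoly ring" by (rule mpoly_ring_cring)
  let ?s = "length G" and ?N = "length us"
  have GC: "set G \<subseteq> carrier (mpoly_ring V)" using G point_ideal_carrier by blast
  have A: "A \<in> carrier_mat ?s ?N" by (simp add: A_def)
  have entry: "(transpose_mat A *\<^sub>v y) $ j = (\<Sum>i<?s. deriv_at c (us ! j) (G ! i) * y $ i)"
    if "y \<in> carrier_vec ?s" "j < ?N" for y j
    using that A by (auto simp: A_def scalar_prod_def lessThan_atLeast0 intro!: sum.cong)
  let ?D = "{transpose_mat A *\<^sub>v y | y. y \<in> carrier_vec ?s}"
  (* ?S is an ideal that contains the generators, hence contains J. *)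
  let ?S = "{f \<in> point_ideal V c. gradient us c f \<in> ?D}"
  have eqD: "v \<in> ?D \<longleftrightarrow> (\<exists>y\<in>carrier_vec ?s. \<forall>j<?N. v $ j = (\<Sum>i<?s. deriv_at c (us ! j) (G ! i) * y $ i))"
    if v: "v \<in> carrier_vec ?N" for v
  proof -
    have "v = transpose_mat A *\<^sub>v y \<longleftrightarrow> (\<forall>j<?N. v $ j = (\<Sum>i<?s. deriv_at c (us ! j) (G ! i) * y $ i))"
      if y: "y \<in> carrier_vec ?s" for y
      using v A entry[OF y] by (auto simp: vec_eq_iff)
    then show ?thesis by auto
  qed
  have inS: "f \<in> ?S \<longleftrightarrow> f \<in> point_ideal V c \<and>
      (\<exists>y. \<forall>j<?N. deriv_at c (us ! j) f = (\<Sum>i<?s. deriv_at c (us ! j) (G ! i) * y i))" for f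
  proof -
    have "gradient us c f \<in> ?D \<longleftrightarrow>
        (\<exists>y. \<forall>j<?N. deriv_at c (us ! j) f = (\<Sum>i<?s. deriv_at c (us ! j) (G ! i) * y i))" (is "_ = ?r")
      unfolding eqD[OF gradient_carrier]
    proof
      assume ?r
      then obtain y where "\<forall>j<?N. deriv_at c (us ! j) f = (\<Sum>i<?s. deriv_at c (us ! j) (G ! i) * y i)" by blast
      then show "\<exists>y\<in>carrier_vec ?s. \<forall>j<?N. gradient us c f $ j = (\<Sum>i<?s. deriv_at c (us ! j) (G ! i) * y $ i)"
        by (intro bexI[of _ "vec ?s y"]) (auto simp: gradient_def)
    qed (auto simp: gradient_def)
    then show ?thesis by simp
  qed
  have "ideal ?S (mpoly_ring V)"
  proof (rule mpoly_idealI)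
    note M = mpoly_idealD[OF point_ideal_ideal[of V c]]
    show "?S \<subseteq> carrier (mpoly_ring V)" using point_ideal_carrier by blast
    show "0 \<in> ?S" unfolding inS using M(2) by (intro conjI exI[of _ "\<lambda>_. 0"]) auto
    fix f h assume "f \<in> ?S"
    then obtain y where f: "f \<in> point_ideal V c"
      and y: "\<forall>j<?N. deriv_at c (us ! j) f = (\<Sum>i<?s. deriv_at c (us ! j) (G ! i) * y i)" unfolding inS by blast
    have f0: "pt_eval c f = 0" using f by (simp add: point_ideal_def)
    show "h * f \<in> ?S" if h: "h \<in> carrier (mpoly_ring V)"
      unfolding inS using y M(5)[OF f h] f0
      by (intro conjI exI[of _ "\<lambda>i. pt_eval c h * y i"])
         (auto simp: deriv_at_mult sum_distrib_left mult.left_commute)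
    assume "h \<in> ?S"
    then obtain z where h: "h \<in> point_ideal V c"
      and z: "\<forall>j<?N. deriv_at c (us ! j) h = (\<Sum>i<?s. deriv_at c (us ! j) (G ! i) * z i)" unfolding inS by blast
    show "f + h \<in> ?S" unfolding inS using M(3)[OF f h] y z
      by (intro conjI exI[of _ "\<lambda>i. y i + z i"]) (auto simp: deriv_at_add distrib_left sum.distrib)
  qed
  moreover have "set G \<subseteq> ?S"
  proof
    fix g assume g: "g \<in> set G"
    then obtain k where k: "k < ?s" "g = G ! k" by (auto simp: in_set_conv_nth)
    show "g \<in> ?S" unfolding inS using g G k
      by (intro conjI exI[of _ "\<lambda>i. if i = k then 1 else 0"])
         (auto simp: if_distrib[of "(*) _"] cong: if_cong)
  qed
  ultimately have "J \<subseteq> ?S" unfolding J by (rule Q.genideal_minimal)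
  then have "gradient us c ` J \<subseteq> ?D" by blast
  moreover have "?D \<subseteq> gradient us c ` J"
  proof
    fix v assume "v \<in> ?D"
    then obtain y where y: "y \<in> carrier_vec ?s" "v = transpose_mat A *\<^sub>v y" by blast
    define f where "f = (\<Sum>i<?s. Const (y $ i) * G ! i)"
    note JI = mpoly_idealD[OF Q.genideal_ideal[OF GC, folded J]]
    have GJ: "G ! i \<in> J" if "i < ?s" for i
      using Q.genideal_self[OF GC] J nth_mem[OF that] by blast
    have sum_J: "sum h S \<in> J" if "\<And>i. i \<in> S \<Longrightarrow> h i \<in> J" for h and S :: "nat set"
      using that by (induction S rule: infinite_finite_induct) (auto intro: JI(2,3))
    have "f \<in> J" unfolding f_def by (rule sum_J) (use GJ JI(5) in auto)
    moreover have "gradient us c f = v"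
    proof (rule eq_vecI)
      fix j assume "j < dim_vec v"
      then have j: "j < ?N" using y A by simp
      have "pt_eval c (G ! i) = 0" if "i < ?s" for i
        using G nth_mem[OF that] by (auto simp: point_ideal_def)
      then show "gradient us c f $ j = v $ j"
        unfolding y(2) entry[OF y(1) j] using j
        by (auto simp: gradient_def f_def deriv_at_sum deriv_at_mult mult.commute intro!: sum.cong)
    qed (use y A in \<open>simp add: gradient_def\<close>)
    ultimately show "v \<in> gradient us c ` J" by blast
  qed
  ultimately show ?thesis by blast
qed

section \<open>Weights and homogeneous components\<close>

lemma lookup_W_component:
  "Poly_Mapping.lookup (W_component w e f) t = (if W_degree w t = e then Poly_Mapping.lookup f t else 0)"
proof -
  let ?T = "{u. u \<in> Poly_Mapping.keys f \<and> W_degree w u = e}"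
  have fin: "finite ?T" by simp
  have "Poly_Mapping.lookup (W_component w e f) t = (\<Sum>u\<in>?T. if u = t then Poly_Mapping.lookup f u else 0)"
    unfolding W_component_def lookup_sum by (intro sum.cong refl) (simp add: lookup_single when_def)
  also have "\<dots> = (if t \<in> ?T then Poly_Mapping.lookup f t else 0)" by (simp add: sum.delta[OF fin])
  finally show ?thesis by (auto simp: in_keys_iff)
qed

lemma W_component_add: "W_component w e (f + g) = W_component w e f + W_component w e g"
  by (rule poly_mapping_eqI) (simp add: lookup_W_component lookup_add)

lemma W_component_diff:
  fixes f g :: "'a::ab_group_add mpoly"
  shows "W_component w e (f - g) = W_component w e f - W_component w e g"
  by (rule poly_mapping_eqI) (simp add: lookup_W_component lookup_minus)

lemma W_component_keys: "Poly_Mapping.keys (W_component w e f) = {t \<in> Poly_Mapping.keys f. W_degree w t = e}"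
  by (auto simp: in_keys_iff lookup_W_component split: if_splits)

lemma W_component_closed: "f \<in> carrier (mpoly_ring V) \<Longrightarrow> W_component w e f \<in> carrier (mpoly_ring V)"
  by (auto simp: carrier_mpoly_ring mpoly_vars_def W_component_keys)

lemma W_degree_add: "W_degree w (s + t) = W_degree w s + W_degree w t"
proof -
  let ?S = "Poly_Mapping.keys s \<union> Poly_Mapping.keys t"
  have ext: "W_degree w u = (\<Sum>v\<in>?S. var_weight w v * Poly_Mapping.lookup u v)"
    if "Poly_Mapping.keys u \<subseteq> ?S" for u
    unfolding W_degree_def using that by (intro sum.mono_neutral_left) (auto simp: in_keys_iff)
  show ?thesis
    by (simp add: ext keys_plus_nat lookup_add distrib_left sum.distrib)
qed

definition pure_degree :: "(nat \<Rightarrow> nat) \<Rightarrow> nat \<Rightarrow> 'a::zero mpoly \<Rightarrow> bool" where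
  "pure_degree w d f \<longleftrightarrow> (\<forall>t\<in>Poly_Mapping.keys f. W_degree w t = d)"

lemma W_component_pure:
  "pure_degree w d f \<Longrightarrow> W_component w e f = (if d = e then f else 0)"
  by (rule poly_mapping_eqI) (auto simp: lookup_W_component pure_degree_def in_keys_iff)

lemma pure_degree_mult:
  fixes f g :: "'a::comm_ring_1 mpoly"
  assumes "pure_degree w d f" "pure_degree w e g"
  shows "pure_degree w (d + e) (f * g)"
  using assms keys_mult[of f g] by (fastforce simp: pure_degree_def W_degree_add)

lemma pure_degree_Const: "pure_degree w 0 (Const a)"
  by (simp add: pure_degree_def Const_def W_degree_def)

lemma pure_degree_Var: "pure_degree w (var_weight w v) (Var v :: 'a::zero_neq_one mpoly)"
  by (simp add: pure_degree_def Var_def W_degree_def)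

lemma pure_degree_one: "pure_degree w 0 (1 :: 'a::comm_ring_1 mpoly)"
  using pure_degree_Const[of w "1 :: 'a"] by (simp add: Const.hom_one)

lemma pure_degree_power:
  fixes f :: "'a::comm_ring_1 mpoly"
  shows "pure_degree w d f \<Longrightarrow> pure_degree w (d * n) (f ^ n)"
  by (induction n) (auto simp: pure_degree_one pure_degree_mult)

lemma pure_degree_mono_val:
  fixes \<sigma> :: "pvar \<Rightarrow> 'a::comm_ring_1 mpoly"
  assumes "\<And>v. pure_degree w (var_weight w v) (\<sigma> v)"
  shows "pure_degree w (W_degree w t) (mono_val \<sigma> t)"
proof -
  have "pure_degree w (\<Sum>v\<in>S. var_weight w v * Poly_Mapping.lookup t v) (\<Prod>v\<in>S. \<sigma> v ^ Poly_Mapping.lookup t v)"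
    for S
    by (induction S rule: infinite_finite_induct)
       (simp_all add: pure_degree_one pure_degree_mult pure_degree_power assms)
  then show ?thesis unfolding W_degree_def mono_val_def .
qed

section \<open>Specialization to a fiber\<close>

interpretation specialize: comm_ring_hom "specialize \<Gamma> :: 'a::field mpoly \<Rightarrow> 'a mpoly" for \<Gamma>
  unfolding specialize_def by (rule Const.mpoly_eval_hom)

lemma specialize_Const [simp]: "specialize \<Gamma> (Const a) = Const a"
  by (simp add: specialize_def)

lemma specialize_Var: "specialize \<Gamma> (Var v) = (case v of AVar i \<Rightarrow> Const (\<Gamma> $ i) | XVar j \<Rightarrow> Var (XVar j))"
  by (simp add: specialize_def)

definition zero_pt :: "'a::field vec \<Rightarrow> pvar \<Rightarrow> 'a" where
  "zero_pt \<Gamma> v = (case v of AVar i \<Rightarrow> \<Gamma> $ i | XVar j \<Rightarrow> 0)"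

lemma A_eval_eq_pt_eval: "A_eval \<Gamma> = pt_eval (zero_pt \<Gamma>)"
  by (simp add: A_eval_def pt_eval_def zero_pt_def[abs_def])

text \<open>
  Both sides are ring homomorphisms in \<open>f\<close> with the same values on constants and indeterminates: a line in
  direction \<open>x\<^sub>j\<close> through the zero point stays within the fiber.
\<close>

lemma dir_eval_specialize:
  "dir_eval (\<lambda>_. 0) (XVar j) (specialize \<Gamma> f) = dir_eval (zero_pt \<Gamma>) (XVar j) f"
  by (induction f rule: mpoly_algebra_induct[OF subset_UNIV])
     (auto simp: hom_distribs specialize_Var zero_pt_def split: pvar.splits)

lemma deriv_at_specialize:
  "deriv_at (\<lambda>_. 0) (XVar j) (specialize \<Gamma> f) = deriv_at (zero_pt \<Gamma>) (XVar j) f"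
  by (simp add: deriv_at_def dir_eval_specialize)

lemma pt_eval_specialize: "pt_eval (\<lambda>_. 0) (specialize \<Gamma> f) = pt_eval (zero_pt \<Gamma>) f"
  using arg_cong[OF dir_eval_specialize[of 0 \<Gamma> f], of "\<lambda>p. poly.coeff p 0"] by (simp add: coeff_0_dir_eval)

lemma specialize_closed:
  assumes "f \<in> carrier (mpoly_ring (A_vars m \<union> X_vars k))"
  shows "specialize \<Gamma> f \<in> carrier (mpoly_ring (X_vars k))"
proof -
  have "mpoly_vars f \<subseteq> A_vars m \<union> X_vars k" using assms by (simp add: carrier_mpoly_ring)
  then show ?thesis
    by (induction rule: mpoly_algebra_induct)
       (auto simp: hom_distribs specialize_Var A_vars_def X_vars_def)
qed

lemma specialize_ident:
  assumes "f \<in> carrier (mpoly_ring (X_vars k))"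
  shows "specialize \<Gamma> f = f"
proof -
  have "mpoly_vars f \<subseteq> X_vars k" using assms by (simp add: carrier_mpoly_ring)
  then show ?thesis
    by (induction rule: mpoly_algebra_induct) (auto simp: hom_distribs specialize_Var X_vars_def)
qed

text \<open>
  The indeterminates that are specialized have weight zero, so specialization preserves the grading. Hence
  \<open>I\<^sub>\<Gamma>\<close> is again a homogeneous ideal.
\<close>

lemma W_component_specialize:
  "W_component w e (specialize \<Gamma> f) = specialize \<Gamma> (W_component w e f)"
proof (induction f rule: mpoly_var_induct[OF subset_UNIV])
  case 1 then show ?case by (simp add: W_component_def)
next
  case (2 t a)
  define \<sigma> where "\<sigma> = (\<lambda>v. case v of AVar i \<Rightarrow> Const (\<Gamma> $ i) | XVar j \<Rightarrow> Var (XVar j))"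
  have \<sigma>: "pure_degree w (var_weight w v) (\<sigma> v)" for v
    using pure_degree_Const[of w] pure_degree_Var[of w v] by (cases v) (simp_all add: \<sigma>_def)
  have "specialize \<Gamma> (Poly_Mapping.single t a) = Const a * mono_val \<sigma> t"
    by (simp add: specialize_def \<sigma>_def Const.mpoly_eval_single)
  then have "pure_degree w (W_degree w t) (specialize \<Gamma> (Poly_Mapping.single t a))"
    using pure_degree_mult[OF pure_degree_Const pure_degree_mono_val[OF \<sigma>]] by simp
  moreover have "pure_degree w (W_degree w t) (Poly_Mapping.single t a)"
    by (simp add: pure_degree_def)
  ultimately show ?case by (simp add: W_component_pure)
next
  case (3 f g) then show ?case by (simp add: W_component_add hom_distribs)
qed

section \<open>Linear coefficients\<close>

lemma zero_point_ideal_eq: "zero_point_ideal m k \<Gamma> = point_ideal (A_vars m \<union> X_vars k) (zero_pt \<Gamma>)"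
proof -
  have "(\<lambda>v. Var v - Const (zero_pt \<Gamma> v)) ` (A_vars m \<union> X_vars k)
      = (\<lambda>i. Var (AVar i) - Const (\<Gamma> $ i)) ` {..<m} \<union> Var ` X_vars k"
    by (auto simp: image_Un A_vars_def X_vars_def image_image zero_pt_def)
  then show ?thesis
    unfolding zero_point_ideal_def P_ring_def point_ideal_generated[symmetric] by simp
qed

lemma origin_ideal_eq: "Idl\<^bsub>mpoly_ring V\<^esub> (Var ` V) = point_ideal V (\<lambda>_. 0)"
  using point_ideal_generated[of V "\<lambda>_. 0"] by simp

lemma X_ideal_sub: "Idl\<^bsub>P_ring m k\<^esub> (Var ` X_vars k) \<subseteq> point_ideal (A_vars m \<union> X_vars k) (zero_pt \<Gamma>)"
proof -
  interpret P: cring "P_ring m k :: 'a mpoly ring" by (rule P_ring_cring)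
  show ?thesis
    by (rule P.genideal_minimal) (auto simp: P_ring_def point_ideal_ideal, auto simp: point_ideal_def X_vars_def zero_pt_def)
qed

text \<open>
  In \<open>f = f\<^sub>0 + \<Sum>\<^sub>j f\<^sub>j x\<^sub>j + g\<close>, the derivative along \<open>x\<^sub>j\<close> at the zero point kills \<open>f\<^sub>0\<close>, which does not involve
  \<open>x\<^sub>j\<close>, and \<open>g\<close>, which is of order two along the zero section.
\<close>

lemma deriv_at_lin_coeff:
  fixes f :: "'a::field mpoly"
  assumes "f \<in> carrier (mpoly_ring (A_vars m \<union> X_vars k))" "j < k"
  shows "deriv_at (zero_pt \<Gamma>) (XVar j) f = A_eval \<Gamma> (lin_coeff j f)"
proof -
  obtain f0 g where f: "f0 \<in> carrier (A_ring m)" "g \<in> X_square m k"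
    "f = f0 + (\<Sum>j<k. lin_coeff j f * Var (XVar j)) + g"
    using lin_coeff_decomposition[of f m k] assms(1) by (auto simp: P_ring_def)
  have "mpoly_vars f0 \<subseteq> A_vars m" using f(1) by (simp add: A_ring_def carrier_mpoly_ring)
  then have 1: "deriv_at (zero_pt \<Gamma>) (XVar j) f0 = 0"
    by (induction rule: mpoly_algebra_induct) (auto simp: deriv_at_add deriv_at_mult A_vars_def)
  have 2: "deriv_at (zero_pt \<Gamma>) (XVar j) g = 0"
    using f(2) unfolding X_square_def
  proof (induction rule: ideal_prod.induct)
    case (prod a b)
    then have "pt_eval (zero_pt \<Gamma>) a = 0" "pt_eval (zero_pt \<Gamma>) b = 0"
      using X_ideal_sub[of m k \<Gamma>] by (auto simp: point_ideal_def)
    then show ?case by (simp add: P_ring_def deriv_at_mult)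
  next
    case (sum a b) then show ?case by (simp add: P_ring_def deriv_at_add)
  qed
  have "deriv_at (zero_pt \<Gamma>) (XVar j) (\<Sum>i<k. lin_coeff i f * Var (XVar i))
      = (\<Sum>i<k. if i = j then pt_eval (zero_pt \<Gamma>) (lin_coeff i f) else 0)"
    unfolding deriv_at_sum
    by (intro sum.cong refl) (simp add: deriv_at_mult zero_pt_def)
  then have "deriv_at (zero_pt \<Gamma>) (XVar j) (\<Sum>i<k. lin_coeff i f * Var (XVar i))
      = pt_eval (zero_pt \<Gamma>) (lin_coeff j f)" using assms(2) by simp
  then show ?thesis
    using 1 2 arg_cong[OF f(3), of "deriv_at (zero_pt \<Gamma>) (XVar j)"]
    by (simp add: deriv_at_add A_eval_eq_pt_eval)
qed

lemma zero_pt_X_monomial: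
  fixes a :: "'a::field"
  assumes "XVar j \<in> Poly_Mapping.keys t"
  shows "pt_eval (zero_pt \<Gamma>) (Poly_Mapping.single t a) = 0"
    "deriv_at (zero_pt \<Gamma>) (AVar i) (Poly_Mapping.single t a) = 0"
proof -
  define u where "u = t - Poly_Mapping.single (XVar j) 1"
  have "t = u + Poly_Mapping.single (XVar j) 1" using assms unfolding u_def
    by (intro poly_mapping_eqI) (auto simp: lookup_add lookup_minus lookup_single when_def in_keys_iff)
  then have eq: "Poly_Mapping.single t a = Poly_Mapping.single u a * Var (XVar j)"
    by (simp add: Var_def mult_single)
  show "pt_eval (zero_pt \<Gamma>) (Poly_Mapping.single t a) = 0"
    "deriv_at (zero_pt \<Gamma>) (AVar i) (Poly_Mapping.single t a) = 0"
    unfolding eq by (simp_all add: hom_distribs deriv_at_mult zero_pt_def)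
qed

text \<open>
  The point \<open>\<Gamma>\<close> is fixed so that the fiber ring and the ring \<open>R\<close> at the zero point become instances of
  \<open>affine_point\<close>.
\<close>

locale positive_family =
  fixes m k :: nat and w :: "nat \<Rightarrow> nat" and I :: "'a::field mpoly set"
    and G :: "'a mpoly list" and \<Gamma> :: "'a vec"
  assumes positive: "positive_algebra m k w I"
    and G: "set G \<subseteq> carrier (P_ring m k)" and I_gen: "I = Idl\<^bsub>P_ring m k\<^esub> (set G)"
begin

abbreviation PV where "PV \<equiv> A_vars m \<union> X_vars k"

lemma weights: "j < k \<Longrightarrow> 0 < w j"
  using positive by (simp add: positive_algebra_def)

lemma I_ideal: "ideal I (mpoly_ring PV)"
  using positive by (simp add: positive_algebra_def W_homogeneous_ideal_def P_ring_def)

lemma I_component: "f \<in> I \<Longrightarrow> W_component w e f \<in> I"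
  using positive by (simp add: positive_algebra_def W_homogeneous_ideal_def)

lemma I_carrier: "f \<in> I \<Longrightarrow> f \<in> carrier (mpoly_ring PV)"
  by (rule mpoly_idealD(1)[OF I_ideal])

text \<open>
  The monomials without any \<open>x\<^sub>j\<close> are those of weight zero, and the component of weight zero of an element of \<open>I\<close>
  lies in \<open>I \<inter> A = {0}\<close>.
\<close>

lemma I_monomial_has_X:
  assumes f: "f \<in> I" and t: "t \<in> Poly_Mapping.keys f"
  shows "\<exists>j. XVar j \<in> Poly_Mapping.keys t"
proof (rule ccontr)
  assume no: "\<not> (\<exists>j. XVar j \<in> Poly_Mapping.keys t)"
  have "var_weight w v = 0" if "v \<in> Poly_Mapping.keys t" for v
    using no that by (cases v) auto
  then have deg: "W_degree w t = 0" by (simp add: W_degree_def)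
  let ?g = "W_component w 0 f"
  have "Poly_Mapping.keys s \<subseteq> A_vars m" if s: "s \<in> Poly_Mapping.keys ?g" for s
  proof
    fix v assume v: "v \<in> Poly_Mapping.keys s"
    have sf: "s \<in> Poly_Mapping.keys f" and "W_degree w s = 0" using s by (auto simp: W_component_keys)
    then have "var_weight w v * Poly_Mapping.lookup s v = 0" using v by (simp add: W_degree_def)
    then have "var_weight w v = 0" using v by (simp add: in_keys_iff)
    moreover have "v \<in> PV" using I_carrier[OF f] sf v by (auto simp: carrier_mpoly_ring mpoly_vars_def)
    ultimately show "v \<in> A_vars m" using weights by (fastforce simp: X_vars_def)
  qed
  then have "?g \<in> carrier (A_ring m)" by (auto simp: A_ring_def carrier_mpoly_ring mpoly_vars_def)
  then have "?g = 0" using I_component[OF f, of 0] positive by (auto simp: positive_algebra_def)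
  moreover have "t \<in> Poly_Mapping.keys ?g" using t deg by (simp add: W_component_keys)
  ultimately show False by simp
qed

lemma I_vanishes:
  assumes f: "f \<in> I"
  shows "pt_eval (zero_pt \<Gamma>) f = 0" "deriv_at (zero_pt \<Gamma>) (AVar i) f = 0"
proof -
  have *: "pt_eval (zero_pt \<Gamma>) (Poly_Mapping.single t a) = 0"
    "deriv_at (zero_pt \<Gamma>) (AVar i) (Poly_Mapping.single t a) = 0" if "t \<in> Poly_Mapping.keys f" for t a
    using I_monomial_has_X[OF f that] zero_pt_X_monomial by blast+
  have f_sum: "f = (\<Sum>t\<in>Poly_Mapping.keys f. Poly_Mapping.single t (Poly_Mapping.lookup f t))"
    by (rule mpoly_sum_singles)
  have "pt_eval (zero_pt \<Gamma>) (\<Sum>t\<in>Poly_Mapping.keys f. Poly_Mapping.single t (Poly_Mapping.lookup f t)) = 0"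
    unfolding pt_eval.hom_sum using * by (intro sum.neutral) auto
  then show "pt_eval (zero_pt \<Gamma>) f = 0" by (simp only: f_sum[symmetric])
  have "deriv_at (zero_pt \<Gamma>) (AVar i) (\<Sum>t\<in>Poly_Mapping.keys f. Poly_Mapping.single t (Poly_Mapping.lookup f t)) = 0"
    unfolding deriv_at_sum using * by (intro sum.neutral) auto
  then show "deriv_at (zero_pt \<Gamma>) (AVar i) f = 0" by (simp only: f_sum[symmetric])
qed

lemma I_sub_zero_point: "I \<subseteq> point_ideal PV (zero_pt \<Gamma>)"
  using I_carrier I_vanishes(1) by (auto simp: point_ideal_def)

lemma G_sub_I: "set G \<subseteq> I"
proof -
  interpret P: cring "P_ring m k :: 'a mpoly ring" by (rule P_ring_cring)
  show ?thesis unfolding I_gen by (rule P.genideal_self[OF G])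
qed

definition xs where "xs = map XVar [0..<k]"
definition axs where "axs = map AVar [0..<m] @ xs"

lemma xs_simps [simp]: "length xs = k" "set xs = X_vars k" "distinct xs" "j < k \<Longrightarrow> xs ! j = XVar j"
  by (auto simp: xs_def X_vars_def distinct_map inj_on_def)

lemma axs_simps [simp]: "length axs = m + k" "set axs = PV" "distinct axs"
  by (auto simp: axs_def A_vars_def X_vars_def distinct_map inj_on_def)

lemma axs_nth: "j < m \<Longrightarrow> axs ! j = AVar j" "j < k \<Longrightarrow> axs ! (m + j) = XVar j"
  by (auto simp: axs_def nth_append)

abbreviation L where "L \<equiv> lin_coeff_mat_at k G \<Gamma>"

lemma L_carrier: "L \<in> carrier_mat (length G) k"
  by (simp add: lin_coeff_mat_at_def lin_coeff_mat_def)

lemma L_eq: "L = mat (length G) (length xs) (\<lambda>(i, j). deriv_at (zero_pt \<Gamma>) (xs ! j) (G ! i))"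
proof (rule eq_matI)
  fix i j assume "i < dim_row (mat (length G) (length xs) (\<lambda>(i, j). deriv_at (zero_pt \<Gamma>) (xs ! j) (G ! i)))"
    "j < dim_col (mat (length G) (length xs) (\<lambda>(i, j). deriv_at (zero_pt \<Gamma>) (xs ! j) (G ! i)))"
  then have ij: "i < length G" "j < k" by simp_all
  have "G ! i \<in> carrier (mpoly_ring PV)" using G nth_mem[OF ij(1)] by (auto simp: P_ring_def)
  then show "L $$ (i, j) = mat (length G) (length xs) (\<lambda>(i, j). deriv_at (zero_pt \<Gamma>) (xs ! j) (G ! i)) $$ (i, j)"
    using ij by (simp add: lin_coeff_mat_at_def lin_coeff_mat_def deriv_at_lin_coeff)
qed (simp_all add: lin_coeff_mat_at_def lin_coeff_mat_def)

lemma I_gen': "I = Idl\<^bsub>mpoly_ring PV\<^esub> (set G)"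
  using I_gen by (simp add: P_ring_def)

lemma G_sub_zero_point: "set G \<subseteq> point_ideal PV (zero_pt \<Gamma>)"
  using G_sub_I I_sub_zero_point by blast

lemma dim_gradients_X:
  "vectorspace.dim class_ring (module_vec TYPE('a) k\<lparr>carrier := gradient xs (zero_pt \<Gamma>) ` I\<rparr>)
    = vec_space.rank (length G) L"
  using gradients_row_space[OF I_gen' G_sub_zero_point, of xs, folded L_eq] dim_row_space[OF L_carrier]
  by simp

text \<open>
  The Jacobian matrix at the zero point is \<open>L\<close> preceded by \<open>m\<close> zero columns.
\<close>

lemma dim_gradients_all:
  "vectorspace.dim class_ring (module_vec TYPE('a) (m + k)\<lparr>carrier := gradient axs (zero_pt \<Gamma>) ` I\<rparr>)
    = vec_space.rank (length G) L"
proof -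
  let ?s = "length G"
  define B where "B = mat ?s (length axs) (\<lambda>(i, j). deriv_at (zero_pt \<Gamma>) (axs ! j) (G ! i))"
  have B: "B \<in> carrier_mat ?s (m + k)" by (simp add: B_def)
  have GI: "G ! i \<in> I" if "i < ?s" for i using G_sub_I nth_mem[OF that] by blast
  have colA: "col B j = 0\<^sub>v ?s" if "j < m" for j
    using that by (intro eq_vecI) (auto simp: B_def axs_nth I_vanishes(2)[OF GI])
  have colX: "col B (m + j) = col L j" if "j < k" for j
    using that by (intro eq_vecI) (auto simp: B_def L_eq axs_nth)
  have "set (cols B) = col B ` {0..<m + k}" using B by (simp add: cols_def)
  also have "{0..<m + k} = {0..<m} \<union> (+) m ` {0..<k}" by auto
  also have "col B ` \<dots> = col B ` {0..<m} \<union> (\<lambda>j. col B (m + j)) ` {0..<k}"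
    by (simp only: image_Un image_image)
  also have "col B ` {0..<m} = (\<lambda>_. 0\<^sub>v ?s) ` {0..<m}" by (intro image_cong) (simp_all add: colA)
  also have "(\<lambda>j. col B (m + j)) ` {0..<k} = col L ` {0..<k}" by (intro image_cong) (simp_all add: colX)
  also have "col L ` {0..<k} = set (cols L)" using L_carrier by (simp add: cols_def)
  finally have "set (cols B) - {0\<^sub>v ?s} = set (cols L) - {0\<^sub>v ?s}" by auto
  then have "vec_space.rank ?s B = vec_space.rank ?s L" by (rule rank_zero_cols[OF L_carrier B])
  moreover have "vectorspace.dim class_ring
      (module_vec TYPE('a) (m + k)\<lparr>carrier := gradient axs (zero_pt \<Gamma>) ` I\<rparr>) = vec_space.rank ?s B"
    using gradients_row_space[OF I_gen' G_sub_zero_point, of axs, folded B_def] dim_row_space[OF B] by simp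
  ultimately show ?thesis by simp
qed

abbreviation J where "J \<equiv> specialize \<Gamma> ` I"

lemma J_ideal: "ideal J (mpoly_ring (X_vars k))"
proof (rule mpoly_idealI)
  note II = mpoly_idealD[OF I_ideal]
  show "J \<subseteq> carrier (mpoly_ring (X_vars k))" using specialize_closed II(1) by blast
  show "0 \<in> J" using II(2) by (metis imageI specialize.hom_zero)
  show "f + g \<in> J" if fg: "f \<in> J" "g \<in> J" for f g
  proof -
    obtain a b where "a \<in> I" "b \<in> I" "f = specialize \<Gamma> a" "g = specialize \<Gamma> b" using fg by blast
    then show ?thesis using II(3)[of a b] by (metis imageI specialize.hom_add)
  qed
  show "h * f \<in> J" if f: "f \<in> J" and h: "h \<in> carrier (mpoly_ring (X_vars k))" for f h
  proof -
    obtain a where a: "a \<in> I" "f = specialize \<Gamma> a" using f by blast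
    have "h \<in> carrier (mpoly_ring PV)" using h by (auto simp: carrier_mpoly_ring)
    then have "h * a \<in> I" using II(5)[OF a(1)] by blast
    moreover have "specialize \<Gamma> (h * a) = h * f"
      using specialize_ident[OF h] a(2) by (simp add: hom_distribs)
    ultimately show ?thesis by (metis imageI)
  qed
qed

lemma J_component: "f \<in> J \<Longrightarrow> W_component w e f \<in> J"
  using I_component by (auto simp: W_component_specialize)

lemma J_sub_origin: "J \<subseteq> point_ideal (X_vars k) (\<lambda>_. 0)"
  using specialize_closed[OF I_carrier] I_vanishes(1) by (auto simp: point_ideal_def pt_eval_specialize)

sublocale F: affine_point xs "X_vars k" "\<lambda>_. 0" J
  by (rule affine_point.intro) (simp_all add: J_ideal J_sub_origin)

sublocale Z: affine_point axs PV "zero_pt \<Gamma>" I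
  by (rule affine_point.intro) (simp_all add: I_ideal I_sub_zero_point)

lemma gradients_fiber: "gradient xs (\<lambda>_. 0) ` J = gradient xs (zero_pt \<Gamma>) ` I"
proof -
  have "gradient xs (\<lambda>_. 0) (specialize \<Gamma> f) = gradient xs (zero_pt \<Gamma>) f" for f
    by (rule eq_vecI) (auto simp: gradient_def deriv_at_specialize)
  then show ?thesis by (simp add: image_image)
qed

lemma cot_dim_fiber: "cot_dim F.scalar F.R (F.cls ` F.M) + vec_space.rank (length G) L = k"
  using F.cot_dim_plus_gradients by (simp add: gradients_fiber dim_gradients_X)

lemma cot_dim_zero_point: "cot_dim Z.scalar Z.R (Z.cls ` Z.M) + vec_space.rank (length G) L = m + k"
  using Z.cot_dim_plus_gradients by (simp add: dim_gradients_all)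

section \<open>Generators and dimension of the fiber ring\<close>

text \<open>
  A polynomial that vanishes at the origin has no constant term.
\<close>

lemma origin_square_monomials:
  assumes "r \<in> point_ideal_square (X_vars k) (\<lambda>_. 0 :: 'a)" "t \<in> Poly_Mapping.keys r"
  shows "\<exists>a b. t = a + b \<and> a \<noteq> 0 \<and> b \<noteq> 0"
  using assms
proof (induction arbitrary: t rule: ideal_prod.induct)
  case (prod f g)
  have ev: "pt_eval (\<lambda>_. 0) h = Poly_Mapping.lookup h 0" for h :: "'a mpoly"
  proof (induction h rule: mpoly_var_induct[OF subset_UNIV])
    case (2 t a)
    have "mono_val (\<lambda>_. 0 :: 'a) t = (if t = 0 then 1 else 0)"
    proof (cases "t = 0")
      case False
      then obtain v where "v \<in> Poly_Mapping.keys t" using keys_eq_empty by blast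
      then show ?thesis using False by (auto simp: mono_val_def in_keys_iff intro!: bexI[of _ v])
    qed simp
    then show ?case by (simp add: pt_eval_single lookup_single when_def)
  qed (simp_all add: hom_distribs lookup_add)
  have "0 \<notin> Poly_Mapping.keys f" "0 \<notin> Poly_Mapping.keys g"
    using prod.hyps by (auto simp: point_ideal_def ev in_keys_iff)
  moreover obtain a b where "t = a + b" "a \<in> Poly_Mapping.keys f" "b \<in> Poly_Mapping.keys g"
    using prod.prems keys_mult[of f g] by auto
  ultimately show ?case by metis
next
  case (sum f g)
  then show ?case using keys_add[of f g] by auto
qed

definition reducible :: "nat set \<Rightarrow> 'a mpoly \<Rightarrow> bool" where
  "reducible B f \<longleftrightarrow> (\<exists>g\<in>carrier (mpoly_ring (XVar ` B)). f - g \<in> J)"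

lemma reducible_poly:
  assumes B: "B \<subseteq> {..<k}" and V: "V \<subseteq> X_vars k" "\<And>v. v \<in> V \<Longrightarrow> reducible B (Var v)"
    and f: "mpoly_vars f \<subseteq> V"
  shows "reducible B f"
  using f
proof (induction rule: mpoly_algebra_induct)
  note JI = mpoly_idealD[OF J_ideal]
  {
    case (Const a)
    then show ?case unfolding reducible_def using JI(2) by (intro bexI[of _ "Const a"]) auto
  next
    case (Var v) then show ?case by (rule V(2))
  next
    case (add f g)
    then obtain f' g' where 1: "f' \<in> carrier (mpoly_ring (XVar ` B))" "f - f' \<in> J"
      "g' \<in> carrier (mpoly_ring (XVar ` B))" "g - g' \<in> J" unfolding reducible_def by blast
    have "(f + g) - (f' + g') = (f - f') + (g - g')" by simp
    then have "(f + g) - (f' + g') \<in> J" using JI(3)[OF 1(2,4)] by (simp only:)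
    then show ?case unfolding reducible_def using 1 by (intro bexI[of _ "f' + g'"]) auto
  next
    case (mult f g)
    then obtain f' g' where 1: "f' \<in> carrier (mpoly_ring (XVar ` B))" "f - f' \<in> J"
      "g' \<in> carrier (mpoly_ring (XVar ` B))" "g - g' \<in> J" unfolding reducible_def by blast
    have "g' \<in> carrier (mpoly_ring (X_vars k))" "f \<in> carrier (mpoly_ring (X_vars k))"
      using 1(3) B mult.hyps V(1) by (auto simp: carrier_mpoly_ring X_vars_def)
    then have "f * (g - g') + g' * (f - f') \<in> J" using JI(3)[OF JI(5)[OF 1(4)] JI(5)[OF 1(2)]] by blast
    moreover have "f * g - f' * g' = f * (g - g') + g' * (f - f')" by (simp add: algebra_simps)
    ultimately have "f * g - f' * g' \<in> J" by (simp only:)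
    then show ?case unfolding reducible_def using 1 by (intro bexI[of _ "f' * g'"]) auto
  }
qed

text \<open>
  The graded Nakayama lemma. In the component of weight \<open>w\<^sub>j\<close> of an element of \<open>\<langle>X\<rangle>\<^sup>2\<close>, every monomial that contains
  \<open>x\<^sub>i\<close> also contains a further factor of positive weight, so \<open>w\<^sub>i < w\<^sub>j\<close>, and induction on the weight applies.
\<close>

lemma variables_reducible:
  assumes B: "B \<subseteq> {..<k}"
    and span: "\<And>j. j < k \<Longrightarrow> \<exists>l\<in>carrier (mpoly_ring (XVar ` B)). \<exists>r\<in>point_ideal_square (X_vars k) (\<lambda>_. 0).
      Var (XVar j) - l - r \<in> J"
    and j: "j < k"
  shows "reducible B (Var (XVar j))"
  using j
proof (induction "w j" arbitrary: j rule: less_induct)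
  case less
  obtain l r where l: "l \<in> carrier (mpoly_ring (XVar ` B))"
    and r: "r \<in> point_ideal_square (X_vars k) (\<lambda>_. 0)" and J: "Var (XVar j) - l - r \<in> J"
    using span[OF less.prems] by blast
  let ?W = "W_component w (w j)"
  have "?W (Var (XVar j) - l - r) \<in> J" by (rule J_component[OF J])
  moreover have "?W (Var (XVar j) :: 'a mpoly) = Var (XVar j)"
    using W_component_pure[OF pure_degree_Var[of w "XVar j"], of "w j"] by simp
  ultimately have 1: "Var (XVar j) - ?W l - ?W r \<in> J" unfolding W_component_diff by (simp only:)
  have vars: "mpoly_vars (?W r) \<subseteq> {XVar i | i. i < k \<and> w i < w j}"
  proof
    fix v assume "v \<in> mpoly_vars (?W r)"
    then obtain t where t: "t \<in> Poly_Mapping.keys r" "W_degree w t = w j" "v \<in> Poly_Mapping.keys t"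
      by (auto simp: mpoly_vars_def W_component_keys)
    have "r \<in> carrier (mpoly_ring (X_vars k))" by (rule mpoly_idealD(1)[OF point_ideal_square_ideal r])
    then have tX: "Poly_Mapping.keys t \<subseteq> X_vars k" using t(1) by (auto simp: carrier_mpoly_ring mpoly_vars_def)
    have le: "w i \<le> W_degree w s" if "XVar i \<in> Poly_Mapping.keys s" for s i
    proof -
      have "w i \<le> var_weight w (XVar i) * Poly_Mapping.lookup s (XVar i)" using that by (simp add: in_keys_iff)
      also have "\<dots> \<le> W_degree w s" unfolding W_degree_def
        by (rule member_le_sum[OF that]) simp_all
      finally show ?thesis .
    qed
    have pos: "0 < W_degree w s" if s: "s \<noteq> 0" "Poly_Mapping.keys s \<subseteq> X_vars k" for s
    proof -
      obtain v where "v \<in> Poly_Mapping.keys s" using s(1) keys_eq_empty by blast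
      then obtain i where "i < k" "XVar i \<in> Poly_Mapping.keys s" using s(2) by (auto simp: X_vars_def)
      then show ?thesis using le[of i s] weights[of i] by simp
    qed
    obtain a b where ab: "t = a + b" "a \<noteq> 0" "b \<noteq> 0" using origin_square_monomials[OF r t(1)] by blast
    then have keys: "Poly_Mapping.keys t = Poly_Mapping.keys a \<union> Poly_Mapping.keys b"
      by (simp add: keys_plus_nat)
    then have p: "0 < W_degree w a" "0 < W_degree w b" using pos ab tX by auto
    obtain i where i: "i < k" "v = XVar i" using t(3) tX by (auto simp: X_vars_def)
    have "w i < W_degree w t" using t(3) p le[of i a] le[of i b] unfolding keys i(2)
      by (auto simp: ab(1) W_degree_add)
    then show "v \<in> {XVar i | i. i < k \<and> w i < w j}" using i t(2) by auto
  qed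
  have "reducible B (Var v)" if "v \<in> {XVar i | i. i < k \<and> w i < w j}" for v
    using that less.hyps by auto
  moreover have "{XVar i | i. i < k \<and> w i < w j} \<subseteq> X_vars k" by (auto simp: X_vars_def)
  ultimately have "reducible B (?W r)" by (intro reducible_poly[OF B _ _ vars])
  then obtain g where g: "g \<in> carrier (mpoly_ring (XVar ` B))" "?W r - g \<in> J"
    unfolding reducible_def by (rule bexE)
  have "Var (XVar j) - (?W l + g) = (Var (XVar j) - ?W l - ?W r) + (?W r - g)" by simp
  then have "Var (XVar j) - (?W l + g) \<in> J" using mpoly_idealD(3)[OF J_ideal 1 g(2)] by (simp only:)
  moreover have "?W l + g \<in> carrier (mpoly_ring (XVar ` B))"
    by (rule mpoly_ring_closed(4)[OF W_component_closed[OF l] g(1)])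
  ultimately show ?case unfolding reducible_def by (rule bexI)
qed

text \<open>
  The fiber ring is a quotient of a polynomial ring in as many indeterminates as the dimension of its cotangent
  space.
\<close>

proposition krull_dim_fiber_le: "krull_dim F.R \<le> ereal (real (cot_dim F.scalar F.R (F.cls ` F.M)))"
proof -
  interpret cov: cotangent_cover F.scalar F.R "F.cls ` F.M" "length xs" F.lin by (rule F.cover)
  obtain B where B: "B \<subseteq> {..<k}" "card B = cot_dim F.scalar F.R (F.cls ` F.M)"
    and all: "\<forall>a\<in>F.cls ` F.M. \<exists>v\<in>carrier_vec k. (\<forall>i<k. i \<notin> B \<longrightarrow> v $ i = 0) \<and>
      a \<ominus>\<^bsub>F.R\<^esub> F.lin v \<in> ideal_prod F.R (F.cls ` F.M) (F.cls ` F.M)"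
    using cov.cotangent_basis_subset unfolding xs_simps(1) by (elim exE conjE)
  have lin_span: "\<exists>l\<in>carrier (mpoly_ring (XVar ` B)). \<exists>r\<in>point_ideal_square (X_vars k) (\<lambda>_. 0).
      Var (XVar j) - l - r \<in> J" if j: "j < k" for j
  proof -
    have x: "(Var (XVar j) :: 'a mpoly) \<in> F.M" using j by (simp add: point_ideal_def X_vars_def)
    obtain v where v: "\<forall>i<k. i \<notin> B \<longrightarrow> v $ i = 0"
      "F.cls (Var (XVar j)) \<ominus>\<^bsub>F.R\<^esub> F.lin v \<in> ideal_prod F.R (F.cls ` F.M) (F.cls ` F.M)"
      using bspec[OF all imageI[OF x]] by (elim bexE conjE)
    let ?l = "linear_form xs (\<lambda>_. 0) v"
    have xQ: "Var (XVar j) \<in> carrier F.Q" using x by (rule point_ideal_carrier)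
    have "F.cls (Var (XVar j) - ?l) \<in> F.cls ` point_ideal_square (X_vars k) (\<lambda>_. 0)"
      using v(2) unfolding F.cls_minus[OF xQ F.linear_form_Q] F.square_of_max_ideal .
    then obtain r where r: "r \<in> point_ideal_square (X_vars k) (\<lambda>_. 0)"
      "F.cls (Var (XVar j) - ?l) = F.cls r" by blast
    have rQ: "r \<in> carrier F.Q" by (rule mpoly_idealD(1)[OF point_ideal_square_ideal r(1)])
    have "Var (XVar j) - ?l - r \<in> J"
      using r(2) F.cls_eq_iff[OF mpoly_ring_closed(7)[OF xQ F.linear_form_Q] rQ] by blast
    moreover have "?l \<in> carrier (mpoly_ring (XVar ` B))"
      unfolding linear_form_def
    proof (rule mpoly_ring_sum_closed)
      fix i assume "i \<in> {..<length xs}"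
      then have i: "i < k" by simp
      show "Const (v $ i) * (Var (xs ! i) - Const 0) \<in> carrier (mpoly_ring (XVar ` B))"
      proof (cases "i \<in> B")
        case True then show ?thesis using i by simp
      next
        case False then show ?thesis using i v(1) by simp
      qed
    qed
    ultimately show ?thesis using r(1) by blast
  qed
  have red: "reducible B f" if "f \<in> carrier F.Q" for f
  proof (rule reducible_poly[OF B(1), of "X_vars k"])
    show "reducible B (Var v)" if "v \<in> X_vars k" for v
      using variables_reducible[OF B(1) lin_span] that by (auto simp: X_vars_def)
  qed (use that in \<open>simp_all add: carrier_mpoly_ring\<close>)
  have BX: "XVar ` B \<subseteq> X_vars k" unfolding X_vars_def by (rule image_mono[OF B(1)])
  note sub = mpoly_ring_mono[OF BX]
  note hom = mpoly_ring_hom_restrict[OF F.cls_hom BX]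
  have "F.cls ` carrier (mpoly_ring (XVar ` B)) = carrier F.R"
  proof
    show "F.cls ` carrier (mpoly_ring (XVar ` B)) \<subseteq> carrier F.R"
      unfolding F.cls_carrier by (rule image_mono[OF sub])
    show "carrier F.R \<subseteq> F.cls ` carrier (mpoly_ring (XVar ` B))"
    proof
      fix y assume "y \<in> carrier F.R"
      then obtain f where f: "f \<in> carrier F.Q" "y = F.cls f" by (rule F.cls_elem)
      obtain g where g: "g \<in> carrier (mpoly_ring (XVar ` B))" "f - g \<in> J"
        using red[OF f(1)] unfolding reducible_def by (rule bexE)
      have "F.cls f = F.cls g" using F.cls_eq_iff[OF f(1) subsetD[OF sub g(1)]] g(2) by (rule iffD2)
      then show "y \<in> F.cls ` carrier (mpoly_ring (XVar ` B))" unfolding f(2) using g(1) by (rule image_eqI)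
    qed
  qed
  then have "krull_dim F.R \<le> krull_dim (mpoly_ring (XVar ` B) :: 'a mpoly ring)"
    by (rule krull_dim_quot_le[OF hom])
  also have "\<dots> \<le> ereal (real (card (XVar ` B)))"
    using B(1) finite_subset by (intro krull_dim_mpoly_ring_le) blast
  also have "card (XVar ` B) = card B" by (rule card_image) (simp add: inj_on_def)
  finally show ?thesis using B(2) by simp
qed

lemma fiber_simps:
  "fiber_ring k I \<Gamma> = F.R" "fiber_scalar k I \<Gamma> = F.scalar" "fiber_origin_ideal k I \<Gamma> = F.cls ` F.M"
  "R_fiber k I \<Gamma> = local_ring_at F.R (F.cls ` F.M)"
  unfolding fiber_ring_def fiber_scalar_def[abs_def] fiber_origin_ideal_def KX_ring_def origin_ideal_eq R_fiber_def
  by (rule refl)+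

lemma zero_point_simps:
  "R_ring m k I = Z.R" "R_scalar m k I = Z.scalar" "R_zero_point_ideal m k I \<Gamma> = Z.cls ` Z.M"
  "R_zero_point m k I \<Gamma> = local_ring_at Z.R (Z.cls ` Z.M)"
  unfolding R_ring_def R_scalar_def[abs_def] R_zero_point_ideal_def P_ring_def zero_point_ideal_eq R_zero_point_def
  by (rule refl)+

lemma d_fiber_le: "d_fiber k I \<Gamma> \<le> ereal (real (cot_dim F.scalar F.R (F.cls ` F.M)))"
  unfolding d_fiber_def fiber_simps using F.krull_dim_local_le krull_dim_fiber_le by (rule order_trans)

text \<open>
  If \<open>D\<close> is infinite, both sides are decided by its sign alone.
\<close>

lemma ecod_positive_iff:
  assumes "e + r = n"
  shows "0 < ereal (real e) - D \<longleftrightarrow> ereal (real r) < ereal (real n) - D"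
  using assms by (cases D) auto

lemma Sing_v_iff:
  assumes "\<Gamma> \<in> carrier_vec m"
  shows "\<Gamma> \<in> Sing_v m k I \<longleftrightarrow>
    ereal (real (vec_space.rank (length G) L)) < ereal (real k) - d_fiber k I \<Gamma>"
proof -
  have "\<Gamma> \<in> Sing_v m k I \<longleftrightarrow> 0 < ereal (real (cot_dim F.scalar F.R (F.cls ` F.M))) - d_fiber k I \<Gamma>"
    unfolding Sing_v_def ecod_def d_fiber_def fiber_simps F.cot_dim_local_eq mem_Collect_eq using assms by blast
  then show ?thesis unfolding ecod_positive_iff[OF cot_dim_fiber] .
qed

lemma Sing_0_iff:
  assumes "\<Gamma> \<in> carrier_vec m"
  shows "\<Gamma> \<in> Sing_0 m k I \<longleftrightarrow>
    ereal (real (vec_space.rank (length G) L)) < ereal (real (m + k)) - d_zero_point m k I \<Gamma>"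
proof -
  have "\<Gamma> \<in> Sing_0 m k I \<longleftrightarrow> 0 < ereal (real (cot_dim Z.scalar Z.R (Z.cls ` Z.M))) - d_zero_point m k I \<Gamma>"
    unfolding Sing_0_def ecod_def d_zero_point_def zero_point_simps Z.cot_dim_local_eq mem_Collect_eq
    using assms by blast
  then show ?thesis unfolding ecod_positive_iff[OF cot_dim_zero_point] .
qed

lemma rank_le:
  "ereal (real (vec_space.rank (length G) L)) \<le> ereal (real k) - d_fiber k I \<Gamma>"
  using d_fiber_le cot_dim_fiber by (cases "d_fiber k I \<Gamma>") auto

end

theorem theorem6p7:
  fixes m k n s d :: nat
    and w :: "nat \<Rightarrow> nat"
    and I :: "'a::field mpoly set"
    and G :: "'a mpoly list"
  assumes "n = m + k"
    and "positive_algebra m k w I"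
    and "krull_dim (R_ring m k I) = ereal (real d)"
    and "length G = s"
    and "\<forall>g \<in> set G. g \<in> carrier (P_ring m k) \<and> W_homogeneous w g"
    and "I = Idl\<^bsub>P_ring m k\<^esub> (set G)"
  shows
    "(\<forall>\<Gamma> \<in> carrier_vec m.
        int (vec_space.rank s (lin_coeff_mat_at k G \<Gamma>)) =
          int n - int m
            - int (cot_dim (fiber_scalar k I \<Gamma>) (fiber_ring k I \<Gamma>) (fiber_origin_ideal k I \<Gamma>)) \<and>
        ereal (real (vec_space.rank s (lin_coeff_mat_at k G \<Gamma>))) \<le>
          ereal (real n) - ereal (real m) - d_fiber k I \<Gamma>) \<and>
     Sing_v m k I =
       {\<Gamma> \<in> carrier_vec m.
         ereal (real (vec_space.rank s (lin_coeff_mat_at k G \<Gamma>))) <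
           ereal (real n) - ereal (real m) - d_fiber k I \<Gamma>} \<and>
     Sing_0 m k I - Sing_v m k I =
       {\<Gamma> \<in> carrier_vec m.
         ereal (real (vec_space.rank s (lin_coeff_mat_at k G \<Gamma>))) =
           ereal (real n) - ereal (real m) - d_fiber k I \<Gamma> \<and>
         ereal (real n) - ereal (real m) - d_fiber k I \<Gamma> <
           ereal (real n) - d_zero_point m k I \<Gamma>}"
proof -
  have fam: "positive_family m k w I G" using assms by unfold_locales auto
  have nm: "ereal (real n) - ereal (real m) = ereal (real k)" using assms(1) by simp
  have a: "int (vec_space.rank s (lin_coeff_mat_at k G \<Gamma>)) = int n - int m
      - int (cot_dim (fiber_scalar k I \<Gamma>) (fiber_ring k I \<Gamma>) (fiber_origin_ideal k I \<Gamma>))" for \<Gamma>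
    using positive_family.cot_dim_fiber[OF fam, of \<Gamma>] assms(1,4)
    by (simp add: positive_family.fiber_simps[OF fam])
  note le = positive_family.rank_le[OF fam, unfolded assms(4)]
  note v = positive_family.Sing_v_iff[OF fam, unfolded assms(4)]
  note z = positive_family.Sing_0_iff[OF fam, unfolded assms(4) assms(1)[symmetric]]
  have sub: "Sing_v m k I \<subseteq> carrier_vec m" "Sing_0 m k I \<subseteq> carrier_vec m"
    by (auto simp: Sing_v_def Sing_0_def)
  have c: "\<Gamma> \<in> Sing_0 m k I - Sing_v m k I \<longleftrightarrow>
      ereal (real (vec_space.rank s (lin_coeff_mat_at k G \<Gamma>))) = ereal (real k) - d_fiber k I \<Gamma> \<and>
      ereal (real k) - d_fiber k I \<Gamma> < ereal (real n) - d_zero_point m k I \<Gamma>"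
    if "\<Gamma> \<in> carrier_vec m" for \<Gamma>
    using v[OF that] z[OF that] le[of \<Gamma>] by (auto simp: less_le)
  show ?thesis
    unfolding nm using a le v c sub by blast
qed

end
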